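(* Let $T=(\mathbb{C}^* )^l$ be the algebraic torus. Then $$C_l(\mathrm{GL}_n(\mathbb{C}))/\mathrm{GL}_n(\mathbb{C}) = \{\text{invariant } D\text{-modules of rank } n \text{ over } T\}/\sim,$$ where $\sim$ denotes the relation of $D(T)$-module isomorphism. Moreover, identifying $\operatorname{Hom}(\operatorname{Lie}T,\mathrm{GL}_n(\mathbb{C}))/\mathrm{GL}_n(\mathbb{C})$ with $C_l(\mathrm{GL}_n(\mathbb{C}))/\mathrm{GL}_n(\mathbb{C})$, the fiber of the surjective exponential map $$\operatorname{Exp}:\operatorname{Hom}_{\text{Lie alg}}(\operatorname{Lie}T,\mathfrak{gl}_n(\mathbb{C}))\twoheadrightarrow \operatorname{Hom}(\operatorname{Lie}T,\mathrm{GL}_n(\mathbb{C}))/\mathrm{GL}_n(\mathbb{C}),\qquad \operatorname{Exp}(\rho)(t)=[\exp(\rho(t))],\quad t\in\operatorname{Lie}T,$$ is exactly an isomorphism class of invariant $D$-modules of rank $n$ on $T$ (a representation $\rho$ being regarded as the invariant $D$-module $\mathbb{M}_{\alpha_\rho}$).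
   Context: Everything is over $\mathbb{C}$. $C_l(\mathrm{GL}_n(\mathbb{C}))$ is the set of $l$-tuples of pairwise commuting matrices in $\mathrm{GL}_n(\mathbb{C})$, and $C_l(\mathrm{GL}_n(\mathbb{C}))/\mathrm{GL}_n(\mathbb{C})$ is its set of orbits under simultaneous conjugation. $\operatorname{Hom}_{\text{Lie alg}}(\operatorname{Lie}T,\mathfrak{gl}_n(\mathbb{C}))$ is the set of Lie algebra homomorphisms, i.e. $n$-dimensional representations of $\operatorname{Lie}T$. In $\operatorname{Hom}(\operatorname{Lie}T,\mathrm{GL}_n(\mathbb{C}))/\mathrm{GL}_n(\mathbb{C})$ the quotient is by conjugation and $[\cdot]$ denotes the conjugacy class (one $g\in\mathrm{GL}_n(\mathbb{C})$ for all $t$); its identification with $C_l(\mathrm{GL}_n(\mathbb{C}))/\mathrm{GL}_n(\mathbb{C})$ is by taking values on a basis $e_1,\dots,e_l$ of $\operatorname{Lie}T$, so that the class of $t\mapsto\exp(\rho(t))$ corresponds to the class of $(\exp\rho(e_1),\dots,\exp\rho(e_l))$. $D(T)$ is the algebra of algebraic differential operators on $T$, and $\operatorname{Der}_{\mathbb{C}}(\mathbb{C}[T])$ is the Lie algebra of polynomial vector fields on $T$. A matrix-valued 1-form $\alpha\in M_n(\Omega_{\mathbb{C}[T]})$ (with $\Omega_{\mathbb{C}[T]}$ the Kähler differentials) is flat if $d\alpha+\alpha\wedge\alpha=0$. For flat $\alpha$, $\mathbb{M}_\alpha$ is the $D(T)$-module structure on $\mathbb{C}[T]^{\oplus n}$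 extending its $\mathbb{C}[T]$-module structure with $v(f_1,\dots,f_n)=(f_1,\dots,f_n)\alpha(v)$ for $v\in\operatorname{Der}_{\mathbb{C}}(\mathbb{C}[T])$, where $f_1,\dots,f_n$ is the standard basis; its rank is $n$. An invariant $D$-module of rank $n$ over $T$ is a module $\mathbb{M}_\alpha$ with $\alpha$ flat and invariant under the multiplication action of $T$ on itself. For a representation $\rho:\operatorname{Lie}T\to\mathfrak{gl}_n(\mathbb{C})$ put $\alpha_\rho=\sum_j\rho(e_j)e^j$, where $e^1,\dots,e^l$ is the basis of invariant 1-forms dual to $e_1,\dots,e_l$; the map $\rho\mapsto\alpha_\rho$ is a bijection from $n$-dimensional representations of $\operatorname{Lie}T$ to flat invariant 1-forms in $M_n(\Omega_{\mathbb{C}[T]})$.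
   Formalization: The basis e_1,…,e_l of Lie T used for the identification must also be a ℤ-basis of the kernel of exp: Lie T → T (e.g. 2πi x_j∂/∂x_j); for an arbitrary basis such as x∂/∂x with l=n=1 the fiber claim fails, since ρ(e)=0 and ρ(e)=1 give isomorphic D-modules. *)

theory Defs
  imports "HOL-Analysis.Analysis" "HOL-Library.Poly_Mapping"
begin

section \<open>The coordinate ring of the torus\<close>

text \<open>The torus \<open>T = (\<complex>\<^sup>*)\<^sup>l\<close>, with \<open>l = CARD('l)\<close>.\<close>

definition torus :: "(complex ^ 'l) set" where
  "torus = {a. \<forall>j. a $ j \<noteq> 0}"

text \<open>
  \<open>\<complex>[T]\<close> is the ring of Laurent polynomials in the coordinates \<open>x\<^sub>j\<close>, i.e. the group algebra of
  the character lattice \<open>\<int>\<^sup>l\<close>: \<^term>\<open>Poly_Mapping.single m c\<close> is the monomial \<open>c x\<^sup>m\<close>, and the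
  ring structure (convolution) is the one from \<^theory>\<open>HOL-Library.Poly_Mapping\<close>.
\<close>

type_synonym 'l laurent = "(int ^ 'l) \<Rightarrow>\<^sub>0 complex"

definition const :: "complex \<Rightarrow> ('l::finite) laurent" where
  "const c = Poly_Mapping.single 0 c"

definition coord :: "'l \<Rightarrow> ('l::finite) laurent" where
  "coord j = Poly_Mapping.single (axis j 1) 1"

definition eval_at_1 :: "('l::finite) laurent \<Rightarrow> complex" where
  "eval_at_1 f = (\<Sum>m\<in>Poly_Mapping.keys f. Poly_Mapping.lookup f m)"

text \<open>The action of \<open>a \<in> T\<close> on functions, \<open>(translate a f)(x) = f(ax)\<close>; on monomials this is
  \<open>x\<^sup>m \<mapsto> a\<^sup>m x\<^sup>m\<close>.\<close>

definition translate :: "complex ^ 'l \<Rightarrow> ('l::finite) laurent \<Rightarrow> 'l laurent" where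
  "translate a = Poly_Mapping.mapp (\<lambda>m c. (\<Prod>j\<in>UNIV. (a $ j) powi (m $ j)) * c)"

section \<open>Vector fields and differential operators\<close>

definition derivation :: "(('l::finite) laurent \<Rightarrow> 'l laurent) \<Rightarrow> bool" where
  "derivation v \<longleftrightarrow>
     (\<forall>f g. v (f + g) = v f + v g) \<and>
     (\<forall>c f. v (const c * f) = const c * v f) \<and>
     (\<forall>f g. v (f * g) = f * v g + g * v f)"

definition Der :: "(('l::finite) laurent \<Rightarrow> 'l laurent) set" where
  "Der = {v. derivation v}"

text \<open>\<open>D(T)\<close>: since \<open>T\<close> is smooth and affine, this is the subalgebra of \<open>End\<^sub>\<complex>(\<complex>[T])\<close> generated by
  the multiplication operators and the vector fields.  Its product is composition.\<close>

inductive_set diff_ops :: "(('l::finite) laurent \<Rightarrow> 'l laurent) set" where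
  mult: "(\<lambda>g. f * g) \<in> diff_ops"
| deriv: "v \<in> Der \<Longrightarrow> v \<in> diff_ops"
| add: "P \<in> diff_ops \<Longrightarrow> Q \<in> diff_ops \<Longrightarrow> (\<lambda>g. P g + Q g) \<in> diff_ops"
| comp: "P \<in> diff_ops \<Longrightarrow> Q \<in> diff_ops \<Longrightarrow> P \<circ> Q \<in> diff_ops"

text \<open>\<open>Lie T\<close> is the space of invariant vector fields, with the commutator as bracket.\<close>

definition Lie_T :: "(('l::finite) laurent \<Rightarrow> 'l laurent) set" where
  "Lie_T = {v \<in> Der. \<forall>a\<in>torus. v \<circ> translate a = translate a \<circ> v}"

definition vf_bracket ::
  "(('l::finite) laurent \<Rightarrow> 'l laurent) \<Rightarrow> ('l laurent \<Rightarrow> 'l laurent) \<Rightarrow> 'l laurent \<Rightarrow> 'l laurent" where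
  "vf_bracket u v = (\<lambda>f. u (v f) - v (u f))"

definition lincomb :: "('l \<Rightarrow> complex) \<Rightarrow> ('l \<Rightarrow> ('l::finite) laurent \<Rightarrow> 'l laurent) \<Rightarrow> 'l laurent \<Rightarrow> 'l laurent" where
  "lincomb c e = (\<lambda>f. \<Sum>j\<in>UNIV. const (c j) * e j f)"

text \<open>The exponential map \<open>Lie T \<rightarrow> T\<close>.  The tangent vector at the identity given by \<open>v\<close> has the
  coordinates \<open>(v x\<^sub>j)(1)\<close>, and the exponential map of \<open>T\<close> is componentwise \<open>exp\<close>.\<close>

definition exp_T :: "(('l::finite) laurent \<Rightarrow> 'l laurent) \<Rightarrow> complex ^ 'l" where
  "exp_T v = (\<chi> j. exp (eval_at_1 (v (coord j))))"

definition basis_Lie_T :: "('l \<Rightarrow> ('l::finite) laurent \<Rightarrow> 'l laurent) \<Rightarrow> bool" where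
  "basis_Lie_T e \<longleftrightarrow> (\<forall>j. e j \<in> Lie_T) \<and> (\<forall>v\<in>Lie_T. \<exists>!c. v = lincomb c e)"

text \<open>
  A basis \<open>e\<^sub>1, \<dots>, e\<^sub>l\<close> of \<open>Lie T\<close> that is also a \<open>\<int>\<close>-basis of the kernel \<open>\<pi>\<^sub>1(T)\<close> of \<open>exp: Lie T \<rightarrow> T\<close>;
  the standard one is \<open>e\<^sub>j = 2\<pi>i x\<^sub>j \<partial>/\<partial>x\<^sub>j\<close>.  For a basis of \<open>Lie T\<close> without this normalisation, such
  as \<open>x\<^sub>j \<partial>/\<partial>x\<^sub>j\<close>, the matrices \<open>exp \<rho>(e\<^sub>j)\<close> are not invariants of the D-module attached to \<open>\<rho>\<close>.
\<close>

definition lattice_basis :: "('l \<Rightarrow> ('l::finite) laurent \<Rightarrow> 'l laurent) \<Rightarrow> bool" where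
  "lattice_basis e \<longleftrightarrow> basis_Lie_T e \<and>
     {v \<in> Lie_T. exp_T v = 1} = {lincomb (\<lambda>j. of_int (k j)) e | k. True}"

section \<open>Free modules and their quotients\<close>

text \<open>The free module with basis \<open>'k\<close> is \<open>'k \<Rightarrow>\<^sub>0 'a\<close>, with the following scalar multiplication.\<close>

definition fsmul :: "'a::comm_ring_1 \<Rightarrow> ('k \<Rightarrow>\<^sub>0 'a) \<Rightarrow> 'k \<Rightarrow>\<^sub>0 'a" where
  "fsmul c x = Poly_Mapping.map ((*) c) x"

lemma lookup_fsmul [simp]: "Poly_Mapping.lookup (fsmul c x) k = c * Poly_Mapping.lookup x k"
  unfolding fsmul_def by (auto simp: Poly_Mapping.map.rep_eq when_def)

global_interpretation free: module "fsmul :: 'a::comm_ring_1 \<Rightarrow> ('k \<Rightarrow>\<^sub>0 'a) \<Rightarrow> _"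
  defines free_span = "free.span"
  by unfold_locales (auto intro!: poly_mapping_eqI simp: lookup_add algebra_simps)

lemma fsmul_single [simp]: "fsmul c (Poly_Mapping.single k d) = Poly_Mapping.single k (c * d)"
  by (rule poly_mapping_eqI) (simp add: lookup_single when_def)

definition extend :: "('a::comm_ring_1 \<Rightarrow> 'k \<Rightarrow> 'm::ab_group_add) \<Rightarrow> ('k \<Rightarrow>\<^sub>0 'a) \<Rightarrow> 'm" where
  "extend h x = (\<Sum>k\<in>Poly_Mapping.keys x. h (Poly_Mapping.lookup x k) k)"

lemma extend_single: "h 0 k = 0 \<Longrightarrow> extend h (Poly_Mapping.single k c) = h c k"
  by (simp add: extend_def)

lemma extend_superset:
  assumes "finite K" "Poly_Mapping.keys x \<subseteq> K" "\<And>k. h 0 k = 0"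
  shows "extend h x = (\<Sum>k\<in>K. h (Poly_Mapping.lookup x k) k)"
  unfolding extend_def using assms
  by (intro sum.mono_neutral_left) (auto simp: in_keys_iff)

lemma extend_add:
  assumes h: "\<And>a b k. h (a + b) k = h a k + h b k"
  shows "extend h (x + y) = extend h x + extend h y"
proof -
  have h0: "h 0 k = 0" for k using h[of 0 0 k] by simp
  let ?K = "Poly_Mapping.keys x \<union> Poly_Mapping.keys y"
  have "extend h (x + y) = (\<Sum>k\<in>?K. h (Poly_Mapping.lookup (x + y) k) k)"
    by (rule extend_superset) (use keys_add[of x y] h0 in auto)
  also have "\<dots> = (\<Sum>k\<in>?K. h (Poly_Mapping.lookup x k) k) + (\<Sum>k\<in>?K. h (Poly_Mapping.lookup y k) k)"
    by (simp add: lookup_add h sum.distrib)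
  also have "\<dots> = extend h x + extend h y"
    by (simp add: extend_superset[of ?K _ h] h0)
  finally show ?thesis .
qed

lemma extend_diff:
  assumes h: "\<And>a b k. h (a + b) k = h a k + h b k"
  shows "extend h (x - y) = extend h x - extend h y"
  using extend_add[of h "x - y" y, OF h] by (simp add: algebra_simps)

lemma extend_span:
  assumes h: "\<And>a b k. h (a + b) k = h a k + h b k"
    and S: "\<And>c s. s \<in> S \<Longrightarrow> extend h (fsmul c s) = 0"
    and x: "x \<in> free_span S"
  shows "extend h x = 0"
  using x by (induction rule: free.span_induct_alt) (simp_all add: extend_def[of h 0] extend_add[OF h] S)

section \<open>Kaehler differentials\<close>

text \<open>\<open>\<Omega>\<close> for \<open>\<complex>[T]\<close>: the \<open>\<complex>[T]\<close>-module generated by symbols \<open>df\<close> subject to \<open>\<complex>\<close>-linearity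
  and the Leibniz rule.  The symbol \<open>df\<close> is the basis vector \<^term>\<open>Poly_Mapping.single f 1\<close>.\<close>

definition kaehler_relations :: "(('l::finite) laurent \<Rightarrow>\<^sub>0 'l laurent) set" where
  "kaehler_relations =
     {Poly_Mapping.single (f + g) 1 - Poly_Mapping.single f 1 - Poly_Mapping.single g 1 | f g. True} \<union>
     {Poly_Mapping.single (const c * f) 1 - Poly_Mapping.single f (const c) | c f. True} \<union>
     {Poly_Mapping.single (f * g) 1 - Poly_Mapping.single g f - Poly_Mapping.single f g | f g. True}"

lemma equivp_mod_span: "equivp (\<lambda>x y. x - y \<in> free_span S)"
proof (rule equivpI)
  show "reflp (\<lambda>x y. x - y \<in> free_span S)"
    by (rule reflpI) (simp add: free.span_zero)
  show "symp (\<lambda>x y. x - y \<in> free_span S)"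
    by (rule sympI) (use free.span_neg in force)
  show "transp (\<lambda>x y. x - y \<in> free_span S)"
    by (rule transpI) (use free.span_add in force)
qed

lemma span_add_diff:
  "a - b \<in> free_span S \<Longrightarrow> c - d \<in> free_span S \<Longrightarrow> (a + c) - (b + d) \<in> free_span S"
  unfolding add_diff_add by (rule free.span_add)

lemma span_diff_diff:
  "a - b \<in> free_span S \<Longrightarrow> c - d \<in> free_span S \<Longrightarrow> (a - c) - (b - d) \<in> free_span S"
  using free.span_diff[of "a - b" S "c - d"] by (simp add: algebra_simps)

lemma span_minus_diff: "a - b \<in> free_span S \<Longrightarrow> - a - - b \<in> free_span S"
  using free.span_neg[of "a - b" S] by simp

quotient_type (overloaded) 'l kform =
  "('l::finite) laurent \<Rightarrow>\<^sub>0 'l laurent" / "\<lambda>x y. x - y \<in> free_span kaehler_relations"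
  by (rule equivp_mod_span)

instantiation kform :: (finite) ab_group_add
begin
lift_definition zero_kform :: "'a kform" is 0 .
lift_definition plus_kform :: "'a kform \<Rightarrow> 'a kform \<Rightarrow> 'a kform" is "(+)"
  by (rule span_add_diff)
lift_definition uminus_kform :: "'a kform \<Rightarrow> 'a kform" is uminus
  by (rule span_minus_diff)
lift_definition minus_kform :: "'a kform \<Rightarrow> 'a kform \<Rightarrow> 'a kform" is "(-)"
  by (rule span_diff_diff)
instance
  by (standard; transfer) (simp_all add: free.span_zero algebra_simps)
end

definition scale_kform :: "('l::finite) laurent \<Rightarrow> 'l kform \<Rightarrow> 'l kform" where
  "scale_kform f \<omega> = abs_kform (fsmul f (rep_kform \<omega>))"

definition dd :: "('l::finite) laurent \<Rightarrow> 'l kform" where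
  "dd f = abs_kform (Poly_Mapping.single f 1)"

lemma rep_abs_kform: "rep_kform (abs_kform x) - x \<in> free_span kaehler_relations"
  using Quotient3_abs_rep[OF Quotient3_kform, of "abs_kform x"] by (simp only: kform.abs_eq_iff)

lemma scale_kform_abs: "scale_kform f (abs_kform x) = abs_kform (fsmul f x)"
  unfolding scale_kform_def kform.abs_eq_iff free.scale_right_diff_distrib[symmetric]
  by (rule free.span_scale) (rule rep_abs_kform)

lemma scale_kform_add: "scale_kform (f + g) \<omega> = scale_kform f \<omega> + scale_kform g \<omega>"
  by (simp add: scale_kform_def plus_kform.abs_eq free.scale_left_distrib)

lemma scale_kform_add_right: "scale_kform f (\<omega> + \<eta>) = scale_kform f \<omega> + scale_kform f \<eta>"
  by (induct \<omega>, induct \<eta>) (simp add: scale_kform_abs plus_kform.abs_eq free.scale_right_distrib)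

lemma scale_kform_scale: "scale_kform f (scale_kform g \<omega>) = scale_kform (f * g) \<omega>"
  by (induct \<omega>) (simp add: scale_kform_abs)

lemma dd_add: "dd (f + g) = dd f + dd g"
proof -
  have "Poly_Mapping.single (f + g) 1 - (Poly_Mapping.single f 1 + Poly_Mapping.single g 1)
          \<in> free_span kaehler_relations"
    unfolding kaehler_relations_def
    by (rule free.span_base) (auto simp: diff_diff_eq)
  then show ?thesis by (simp add: dd_def plus_kform.abs_eq kform.abs_eq_iff)
qed

lemma dd_const_mult: "dd (const c * f) = scale_kform (const c) (dd f)"
proof -
  have "Poly_Mapping.single (const c * f) 1 - Poly_Mapping.single f (const c)
          \<in> free_span kaehler_relations"
    unfolding kaehler_relations_def by (rule free.span_base) blast
  then show ?thesis by (simp add: dd_def scale_kform_abs kform.abs_eq_iff)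
qed

lemma dd_mult: "dd (f * g) = scale_kform f (dd g) + scale_kform g (dd f)"
proof -
  have "Poly_Mapping.single (f * g) 1 - (Poly_Mapping.single g f + Poly_Mapping.single f g)
          \<in> free_span kaehler_relations"
    unfolding kaehler_relations_def
    by (rule free.span_base) (auto simp: diff_diff_eq)
  then show ?thesis by (simp add: dd_def scale_kform_abs plus_kform.abs_eq kform.abs_eq_iff)
qed

lemma scale_kform_0 [simp]: "scale_kform 0 \<omega> = 0"
  using scale_kform_add[of 0 0 \<omega>] by simp

lemma scale_kform_zero_right [simp]: "scale_kform f 0 = 0"
  using scale_kform_add_right[of f 0 0] by simp

lemma scale_kform_1 [simp]: "scale_kform 1 \<omega> = \<omega>"
  by (simp add: scale_kform_def Quotient3_abs_rep[OF Quotient3_kform])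

lemma dd_0 [simp]: "dd 0 = 0"
  using dd_add[of 0 0] by simp

lemma dd_const [simp]: "dd (const c :: ('l::finite) laurent) = 0"
proof -
  have "dd (1 :: 'l laurent) = dd 1 + dd 1"
    using dd_mult[of "1 :: 'l laurent" 1] by simp
  then have "dd (1 :: 'l laurent) = 0" by simp
  then show ?thesis using dd_const_mult[of c "1 :: 'l laurent"] by simp
qed

lemma extend_rep_kform:
  assumes h: "\<And>a b k. h (a + b) k = h a k + h b k"
    and S: "\<And>c s. s \<in> kaehler_relations \<Longrightarrow> extend h (fsmul c s) = 0"
  shows "extend h (rep_kform (abs_kform x)) = extend h x"
  using extend_span[OF h S rep_abs_kform, of x] by (simp add: extend_diff[OF h])

text \<open>
  Contraction \<open>\<omega> \<mapsto> \<omega>(v)\<close> with a vector field, the \<open>\<complex>[T]\<close>-linear map with \<open>(df)(v) = v f\<close>, and the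
  action of \<open>a \<in> T\<close> on forms, \<open>f dg \<mapsto> (translate a f) d(translate a g)\<close>.  Both are defined on
  representatives; they do not depend on the choice if \<open>v\<close> is a derivation and \<open>a \<in> T\<close>.
\<close>

definition contract :: "(('l::finite) laurent \<Rightarrow> 'l laurent) \<Rightarrow> 'l kform \<Rightarrow> 'l laurent" where
  "contract v \<omega> = extend (\<lambda>f g. f * v g) (rep_kform \<omega>)"

lemma contract_abs:
  assumes "derivation v"
  shows "contract v (abs_kform x) = extend (\<lambda>f g. f * v g) x"
  unfolding contract_def
proof (rule extend_rep_kform)
  fix c and s :: "'a laurent \<Rightarrow>\<^sub>0 'a laurent"
  assume "s \<in> kaehler_relations"
  moreover have "v (f + g) = v f + v g" "v (const b * f) = const b * v f"
    "v (f * g) = f * v g + g * v f" for b f g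
    using assms unfolding derivation_def by blast+
  ultimately show "extend (\<lambda>f g. f * v g) (fsmul c s) = 0"
    unfolding kaehler_relations_def
    by (auto simp: free.scale_right_diff_distrib extend_diff extend_single distrib_left
        distrib_right mult.assoc)
qed (simp add: distrib_right)

lemma contract_scale_dd: "derivation v \<Longrightarrow> contract v (scale_kform f (dd g)) = f * v g"
  by (simp add: dd_def scale_kform_abs contract_abs extend_single)

lemma contract_add: "derivation v \<Longrightarrow> contract v (\<omega> + \<eta>) = contract v \<omega> + contract v \<eta>"
  by (induct \<omega>, induct \<eta>) (simp add: plus_kform.abs_eq contract_abs extend_add algebra_simps)

definition translate_kform :: "complex ^ 'l \<Rightarrow> ('l::finite) kform \<Rightarrow> 'l kform" where
  "translate_kform a \<omega> = extend (\<lambda>f g. scale_kform (translate a f) (dd (translate a g))) (rep_kform \<omega>)"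

lemma lookup_translate:
  "Poly_Mapping.lookup (translate a f) m = (\<Prod>j\<in>UNIV. (a $ j) powi (m $ j)) * Poly_Mapping.lookup f m"
  by (simp add: translate_def lookup_mapp when_def in_keys_iff)

lemma translate_add: "translate a (f + g) = translate a f + translate a g"
  by (rule poly_mapping_eqI) (simp add: lookup_translate lookup_add distrib_left)

lemma translate_0 [simp]: "translate a 0 = 0"
  using translate_add[of a 0 0] by simp

lemma translate_single:
  "translate a (Poly_Mapping.single m c) = Poly_Mapping.single m ((\<Prod>j\<in>UNIV. (a $ j) powi (m $ j)) * c)"
  by (rule poly_mapping_eqI) (simp add: lookup_translate lookup_single when_def)

lemma poly_mapping_add_induct [case_names zero add]:
  assumes "P 0" "\<And>f k c. P f \<Longrightarrow> P (f + Poly_Mapping.single k c)"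
  shows "P f"
proof (induction f rule: update_induct)
  case const
  show ?case by (rule assms(1))
next
  case (update f k c)
  have "Poly_Mapping.update k c f = f + Poly_Mapping.single k c"
    using update by (intro poly_mapping_eqI) (auto simp: lookup_update lookup_add lookup_single in_keys_iff)
  then show ?case using assms(2) update by simp
qed

lemma translate_mult:
  assumes "a \<in> torus"
  shows "translate a (f * g) = translate a f * translate a g"
proof (induction f rule: poly_mapping_add_induct)
  case (add f m c)
  have "translate a (Poly_Mapping.single m c * g) = translate a (Poly_Mapping.single m c) * translate a g"
  proof (induction g rule: poly_mapping_add_induct)
    case (add g m' c')
    have "(\<Prod>j\<in>UNIV. (a $ j) powi (m $ j + m' $ j)) =
        (\<Prod>j\<in>UNIV. (a $ j) powi (m $ j)) * (\<Prod>j\<in>UNIV. (a $ j) powi (m' $ j))"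
      unfolding prod.distrib[symmetric] using assms
      by (intro prod.cong) (auto simp: torus_def power_int_add)
    then have "translate a (Poly_Mapping.single m c * Poly_Mapping.single m' c') =
        translate a (Poly_Mapping.single m c) * translate a (Poly_Mapping.single m' c')"
      by (simp add: mult_single translate_single mult.assoc mult.left_commute)
    then show ?case by (simp only: add translate_add distrib_left)
  qed simp
  then show ?case by (simp only: add translate_add distrib_right)
qed simp

lemma translate_const [simp]: "translate a (const c) = const c"
  by (simp add: const_def translate_single)

lemma translate_kform_abs:
  assumes "a \<in> torus"
  shows "translate_kform a (abs_kform x) =
    extend (\<lambda>f g. scale_kform (translate a f) (dd (translate a g))) x"
  unfolding translate_kform_def
proof (rule extend_rep_kform)
  fix c and s :: "'a laurent \<Rightarrow>\<^sub>0 'a laurent"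
  assume "s \<in> kaehler_relations"
  then show "extend (\<lambda>f g. scale_kform (translate a f) (dd (translate a g))) (fsmul c s) = 0"
    unfolding kaehler_relations_def
    by (auto simp: free.scale_right_diff_distrib extend_diff extend_single translate_add
        translate_mult[OF assms] scale_kform_add scale_kform_add_right scale_kform_scale dd_add
        dd_const_mult dd_mult)
qed (simp add: translate_add scale_kform_add)

lemma translate_kform_scale_dd:
  "a \<in> torus \<Longrightarrow> translate_kform a (scale_kform f (dd g)) = scale_kform (translate a f) (dd (translate a g))"
  by (simp add: dd_def[of g] scale_kform_abs translate_kform_abs extend_single)

lemma translate_kform_add:
  "a \<in> torus \<Longrightarrow> translate_kform a (\<omega> + \<eta>) = translate_kform a \<omega> + translate_kform a \<eta>"
  by (induct \<omega>, induct \<eta>)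
    (simp add: plus_kform.abs_eq translate_kform_abs extend_add translate_add scale_kform_add)

text \<open>\<open>\<Lambda>\<^sup>2 \<Omega>\<close> over \<open>\<complex>[T]\<close>: generated by symbols \<open>\<omega> \<and> \<eta>\<close>, which are bilinear and alternating.\<close>

definition wedge_relations :: "(('l::finite) kform \<times> 'l kform \<Rightarrow>\<^sub>0 'l laurent) set" where
  "wedge_relations =
     {Poly_Mapping.single (\<omega> + \<omega>', \<eta>) 1 - Poly_Mapping.single (\<omega>, \<eta>) 1 - Poly_Mapping.single (\<omega>', \<eta>) 1
        | \<omega> \<omega>' \<eta>. True} \<union>
     {Poly_Mapping.single (\<omega>, \<eta> + \<eta>') 1 - Poly_Mapping.single (\<omega>, \<eta>) 1 - Poly_Mapping.single (\<omega>, \<eta>') 1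
        | \<omega> \<eta> \<eta>'. True} \<union>
     {Poly_Mapping.single (scale_kform f \<omega>, \<eta>) 1 - Poly_Mapping.single (\<omega>, \<eta>) f | f \<omega> \<eta>. True} \<union>
     {Poly_Mapping.single (\<omega>, scale_kform f \<eta>) 1 - Poly_Mapping.single (\<omega>, \<eta>) f | f \<omega> \<eta>. True} \<union>
     {Poly_Mapping.single (\<omega>, \<omega>) 1 | \<omega>. True}"

quotient_type (overloaded) 'l kform2 =
  "('l::finite) kform \<times> 'l kform \<Rightarrow>\<^sub>0 'l laurent" / "\<lambda>x y. x - y \<in> free_span wedge_relations"
  by (rule equivp_mod_span)

instantiation kform2 :: (finite) ab_group_add
begin
lift_definition zero_kform2 :: "'a kform2" is 0 .
lift_definition plus_kform2 :: "'a kform2 \<Rightarrow> 'a kform2 \<Rightarrow> 'a kform2" is "(+)"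
  by (rule span_add_diff)
lift_definition uminus_kform2 :: "'a kform2 \<Rightarrow> 'a kform2" is uminus
  by (rule span_minus_diff)
lift_definition minus_kform2 :: "'a kform2 \<Rightarrow> 'a kform2 \<Rightarrow> 'a kform2" is "(-)"
  by (rule span_diff_diff)
instance
  by (standard; transfer) (simp_all add: free.span_zero algebra_simps)
end

definition wedge :: "('l::finite) kform \<Rightarrow> 'l kform \<Rightarrow> 'l kform2" where
  "wedge \<omega> \<eta> = abs_kform2 (Poly_Mapping.single (\<omega>, \<eta>) 1)"

definition scale_kform2 :: "('l::finite) laurent \<Rightarrow> 'l kform2 \<Rightarrow> 'l kform2" where
  "scale_kform2 f \<theta> = abs_kform2 (fsmul f (rep_kform2 \<theta>))"

lemma rep_abs_kform2: "rep_kform2 (abs_kform2 x) - x \<in> free_span wedge_relations"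
  using Quotient3_abs_rep[OF Quotient3_kform2, of "abs_kform2 x"] by (simp only: kform2.abs_eq_iff)

lemma scale_kform2_abs: "scale_kform2 f (abs_kform2 x) = abs_kform2 (fsmul f x)"
  unfolding scale_kform2_def kform2.abs_eq_iff free.scale_right_diff_distrib[symmetric]
  by (rule free.span_scale) (rule rep_abs_kform2)

lemma scale_kform2_add_right:
  "scale_kform2 f (\<omega> + \<eta>) = scale_kform2 f \<omega> + scale_kform2 f \<eta>"
  by (induct \<omega>, induct \<eta>) (simp add: scale_kform2_abs plus_kform2.abs_eq free.scale_right_distrib)

lemma wedge_add_left: "wedge (\<omega> + \<omega>') \<eta> = wedge \<omega> \<eta> + wedge \<omega>' \<eta>"
proof -
  have "Poly_Mapping.single (\<omega> + \<omega>', \<eta>) 1 -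
      (Poly_Mapping.single (\<omega>, \<eta>) 1 + Poly_Mapping.single (\<omega>', \<eta>) 1) \<in> free_span wedge_relations"
    unfolding diff_diff_eq[symmetric] wedge_relations_def
    by (intro free.span_base UnI1) blast
  then show ?thesis by (simp add: wedge_def plus_kform2.abs_eq kform2.abs_eq_iff)
qed

lemma wedge_add_right: "wedge \<omega> (\<eta> + \<eta>') = wedge \<omega> \<eta> + wedge \<omega> \<eta>'"
proof -
  have "Poly_Mapping.single (\<omega>, \<eta> + \<eta>') 1 -
      (Poly_Mapping.single (\<omega>, \<eta>) 1 + Poly_Mapping.single (\<omega>, \<eta>') 1) \<in> free_span wedge_relations"
    unfolding diff_diff_eq[symmetric] wedge_relations_def
    by (intro free.span_base) blast
  then show ?thesis by (simp add: wedge_def plus_kform2.abs_eq kform2.abs_eq_iff)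
qed

lemma wedge_scale_left: "wedge (scale_kform f \<omega>) \<eta> = scale_kform2 f (wedge \<omega> \<eta>)"
proof -
  have "Poly_Mapping.single (scale_kform f \<omega>, \<eta>) 1 - Poly_Mapping.single (\<omega>, \<eta>) f
      \<in> free_span wedge_relations"
    unfolding wedge_relations_def by (intro free.span_base) blast
  then show ?thesis by (simp add: wedge_def scale_kform2_abs kform2.abs_eq_iff)
qed

lemma wedge_scale_right: "wedge \<omega> (scale_kform f \<eta>) = scale_kform2 f (wedge \<omega> \<eta>)"
proof -
  have "Poly_Mapping.single (\<omega>, scale_kform f \<eta>) 1 - Poly_Mapping.single (\<omega>, \<eta>) f
      \<in> free_span wedge_relations"
    unfolding wedge_relations_def by (intro free.span_base) blast
  then show ?thesis by (simp add: wedge_def scale_kform2_abs kform2.abs_eq_iff)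
qed

lemma wedge_self [simp]: "wedge \<omega> \<omega> = 0"
proof -
  have "Poly_Mapping.single (\<omega>, \<omega>) 1 - 0 \<in> free_span wedge_relations"
    unfolding wedge_relations_def diff_zero by (intro free.span_base) blast
  then show ?thesis by (simp add: wedge_def zero_kform2_def kform2.abs_eq_iff)
qed

lemma wedge_swap: "wedge \<omega> \<eta> = - wedge \<eta> \<omega>"
  using wedge_self[of "\<omega> + \<eta>"]
  by (simp add: wedge_add_left wedge_add_right eq_neg_iff_add_eq_0 del: wedge_self)
     (simp add: add.commute)

text \<open>The exterior derivative on 1-forms, \<open>f dg \<mapsto> df \<and> dg\<close>; independent of the representative.\<close>

definition dd1 :: "('l::finite) kform \<Rightarrow> 'l kform2" where
  "dd1 \<omega> = extend (\<lambda>f g. wedge (dd f) (dd g)) (rep_kform \<omega>)"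

lemma wedge_0_left [simp]: "wedge 0 \<eta> = 0"
  using wedge_add_left[of 0 0 \<eta>] by simp

lemma dd1_abs: "dd1 (abs_kform x) = extend (\<lambda>f g. wedge (dd f) (dd g)) x"
  unfolding dd1_def
proof (rule extend_rep_kform)
  fix c and s :: "'a laurent \<Rightarrow>\<^sub>0 'a laurent"
  assume "s \<in> kaehler_relations"
  then show "extend (\<lambda>f g. wedge (dd f) (dd g)) (fsmul c s) = 0"
    unfolding kaehler_relations_def
  proof (elim UnE)
    assume "s \<in> {Poly_Mapping.single (f * g) 1 - Poly_Mapping.single g f - Poly_Mapping.single f g | f g. True}"
    then obtain f g where s:
      "s = Poly_Mapping.single (f * g) 1 - Poly_Mapping.single g f - Poly_Mapping.single f g" by blast
    have "scale_kform2 c (wedge (dd g) (dd f)) = - scale_kform2 c (wedge (dd f) (dd g))"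
      unfolding wedge_scale_left[symmetric] wedge_scale_right[symmetric]
      by (metis wedge_swap wedge_scale_left wedge_scale_right)
    then show ?thesis
      by (simp add: s free.scale_right_diff_distrib extend_diff extend_single dd_add dd_mult
          wedge_add_left wedge_add_right wedge_scale_left wedge_scale_right)
  qed (auto simp: free.scale_right_diff_distrib extend_diff extend_single dd_add dd_const_mult dd_mult
        wedge_add_left wedge_add_right wedge_scale_left wedge_scale_right)
qed (simp add: dd_add wedge_add_left)

lemma dd1_scale_dd: "dd1 (scale_kform f (dd g)) = wedge (dd f) (dd g)"
  by (simp add: dd_def[of g] scale_kform_abs dd1_abs extend_single)

lemma dd1_add: "dd1 (\<omega> + \<eta>) = dd1 \<omega> + dd1 \<eta>"
  by (induct \<omega>, induct \<eta>) (simp add: plus_kform.abs_eq dd1_abs extend_add dd_add wedge_add_left)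

section \<open>Matrix-valued forms and D-modules\<close>

definition flat :: "('l::finite) kform ^ 'n ^ 'n \<Rightarrow> bool" where
  "flat \<alpha> \<longleftrightarrow> (\<forall>i j. dd1 (\<alpha> $ i $ j) + (\<Sum>k\<in>UNIV. wedge (\<alpha> $ i $ k) (\<alpha> $ k $ j)) = 0)"

definition invariant_form :: "('l::finite) kform \<Rightarrow> bool" where
  "invariant_form \<omega> \<longleftrightarrow> (\<forall>a\<in>torus. translate_kform a \<omega> = \<omega>)"

definition invariant_matrix_form :: "('l::finite) kform ^ 'n ^ 'n \<Rightarrow> bool" where
  "invariant_matrix_form \<alpha> \<longleftrightarrow> (\<forall>i j. invariant_form (\<alpha> $ i $ j))"

text \<open>
  A left \<open>D(T)\<close>-module structure on an abelian group, given by the action of the operators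
  (HOL-Algebra and HOL only have modules over commutative rings).  Values of the action outside of
  \<open>D(T)\<close> are fixed, so that equal module structures are equal functions.
\<close>

definition D_module :: "((('l::finite) laurent \<Rightarrow> 'l laurent) \<Rightarrow> 'm::ab_group_add \<Rightarrow> 'm) \<Rightarrow> bool" where
  "D_module act \<longleftrightarrow>
     act \<in> extensional diff_ops \<and>
     (\<forall>P\<in>diff_ops. \<forall>u w. act P (u + w) = act P u + act P w) \<and>
     (\<forall>P\<in>diff_ops. \<forall>Q\<in>diff_ops. \<forall>u. act (\<lambda>f. P f + Q f) u = act P u + act Q u) \<and>
     (\<forall>P\<in>diff_ops. \<forall>Q\<in>diff_ops. \<forall>u. act (P \<circ> Q) u = act P (act Q u)) \<and>
     (\<forall>u. act id u = u)"

definition D_module_iso ::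
  "((('l::finite) laurent \<Rightarrow> 'l laurent) \<Rightarrow> 'm::ab_group_add \<Rightarrow> 'm) \<Rightarrow>
   (('l laurent \<Rightarrow> 'l laurent) \<Rightarrow> 'p::ab_group_add \<Rightarrow> 'p) \<Rightarrow> bool" where
  "D_module_iso act act' \<longleftrightarrow>
     (\<exists>\<phi>. bij \<phi> \<and> (\<forall>u w. \<phi> (u + w) = \<phi> u + \<phi> w) \<and> (\<forall>P\<in>diff_ops. \<forall>u. \<phi> (act P u) = act' P (\<phi> u)))"

text \<open>
  The module \<open>\<M>\<^sub>\<alpha>\<close>: the unique \<open>D(T)\<close>-module structure on \<open>\<complex>[T]\<^sup>n\<close> that extends the \<open>\<complex>[T]\<close>-module
  structure and satisfies \<open>v f\<^sub>j = \<Sum>\<^sub>i \<alpha>(v)\<^sub>i\<^sub>j f\<^sub>i\<close> for the standard basis \<open>f\<^sub>j = axis j 1\<close>.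
\<close>

type_synonym ('l, 'n) D_mod = "('l laurent \<Rightarrow> 'l laurent) \<Rightarrow> 'l laurent ^ 'n \<Rightarrow> 'l laurent ^ 'n"

definition D_module_of :: "('l::finite) kform ^ 'n ^ 'n \<Rightarrow> ('l, 'n::finite) D_mod" where
  "D_module_of \<alpha> = (THE act. D_module act \<and>
     (\<forall>f u. act (\<lambda>g. f * g) u = f *s u) \<and>
     (\<forall>v\<in>Der. \<forall>j. act v (axis j 1) = (\<Sum>i\<in>UNIV. contract v (\<alpha> $ i $ j) *s axis i 1)))"

definition invariant_D_modules :: "('l::finite, 'n::finite) D_mod set" where
  "invariant_D_modules = {D_module_of \<alpha> | \<alpha>. flat \<alpha> \<and> invariant_matrix_form \<alpha>}"

definition D_mod_iso_rel :: "(('l::finite, 'n::finite) D_mod \<times> ('l, 'n) D_mod) set" where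
  "D_mod_iso_rel =
     {(N, N'). N \<in> invariant_D_modules \<and> N' \<in> invariant_D_modules \<and> D_module_iso N N'}"

section \<open>Commuting tuples, representations and the exponential map\<close>

definition commuting_tuples :: "('l \<Rightarrow> complex ^ 'n ^ 'n) set" where
  "commuting_tuples = {A. (\<forall>j. invertible (A j)) \<and> (\<forall>i j. A i ** A j = A j ** A i)}"

definition conj_rel :: "(('l \<Rightarrow> complex ^ 'n ^ 'n) \<times> ('l \<Rightarrow> complex ^ 'n ^ 'n)) set" where
  "conj_rel = {(A, B). A \<in> commuting_tuples \<and> B \<in> commuting_tuples \<and>
     (\<exists>g. invertible g \<and> (\<forall>j. B j = g ** A j ** matrix_inv g))}"

definition Lie_reps :: "((('l::finite) laurent \<Rightarrow> 'l laurent) \<Rightarrow> complex ^ 'n ^ 'n) set" where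
  "Lie_reps = {\<rho> \<in> extensional Lie_T.
     (\<forall>u\<in>Lie_T. \<forall>v\<in>Lie_T. \<rho> (\<lambda>f. u f + v f) = \<rho> u + \<rho> v) \<and>
     (\<forall>c. \<forall>v\<in>Lie_T. \<rho> (\<lambda>f. const c * v f) = (\<chi> i k. c * \<rho> v $ i $ k)) \<and>
     (\<forall>u\<in>Lie_T. \<forall>v\<in>Lie_T. \<rho> (vf_bracket u v) = \<rho> u ** \<rho> v - \<rho> v ** \<rho> u)}"

text \<open>The matrix exponential.  The type class operations \<open>exp\<close> and \<open>^\<close> do not apply, since
  the multiplication of the type \<open>complex ^ 'n ^ 'n\<close> is the componentwise one.\<close>

definition matrix_exp :: "complex ^ 'n ^ 'n \<Rightarrow> complex ^ 'n ^ 'n" where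
  "matrix_exp A = suminf (\<lambda>k. (1 / fact k) *\<^sub>R ((\<lambda>B. A ** B) ^^ k) (mat 1))"

text \<open>The class of \<open>t \<mapsto> exp(\<rho>(t))\<close>, identified with the class of its values on \<open>e\<^sub>1, \<dots>, e\<^sub>l\<close>.\<close>

definition Exp :: "('l \<Rightarrow> ('l::finite) laurent \<Rightarrow> 'l laurent) \<Rightarrow>
    (('l laurent \<Rightarrow> 'l laurent) \<Rightarrow> complex ^ 'n ^ 'n) \<Rightarrow> ('l \<Rightarrow> complex ^ 'n ^ 'n) set" where
  "Exp e \<rho> = conj_rel `` {\<lambda>j. matrix_exp (\<rho> (e j))}"

text \<open>\<open>e'\<close> is the basis of invariant 1-forms dual to \<open>e\<close>.\<close>

definition dual_basis :: "('l \<Rightarrow> ('l::finite) laurent \<Rightarrow> 'l laurent) \<Rightarrow> ('l \<Rightarrow> 'l kform) \<Rightarrow> bool" where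
  "dual_basis e e' \<longleftrightarrow> (\<forall>j. invariant_form (e' j)) \<and> (\<forall>i j. contract (e i) (e' j) = (if i = j then 1 else 0))"

definition rep_form :: "('l \<Rightarrow> ('l::finite) laurent \<Rightarrow> 'l laurent) \<Rightarrow> ('l \<Rightarrow> 'l kform) \<Rightarrow>
    (('l laurent \<Rightarrow> 'l laurent) \<Rightarrow> complex ^ 'n ^ 'n) \<Rightarrow> 'l kform ^ 'n ^ 'n" where
  "rep_form e e' \<rho> = (\<chi> i k. \<Sum>j\<in>UNIV. scale_kform (const (\<rho> (e j) $ i $ k)) (e' j))"

end

theory Submission
  imports Defs "HOL-Computational_Algebra.Fundamental_Theorem_Algebra"
begin

text \<open>
  A flat invariant form is \<open>\<Sum> A\<^sub>j e\<^sup>j\<close> with constant commuting matrices \<open>A\<^sub>j\<close>, and on its module \<open>e\<^sub>j\<close> acts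
  as \<open>\<nabla>\<^sub>j = e\<^sub>j + A\<^sub>j\<close>.  The lattice condition gives \<open>e\<^sub>j x\<^sup>m = 2\<pi>i N\<^sub>j(m) x\<^sup>m\<close> where \<open>N\<close> maps \<open>\<int>\<^sup>l\<close> onto \<open>\<int>\<^sup>l\<close>.  An
  isomorphism between the modules of \<open>A\<close> and \<open>A'\<close> is a matrix \<open>g = \<Sum> x\<^sup>m g\<^sub>m\<close> over \<open>\<complex>[T]\<close> with
  \<open>g\<^sub>m A\<^sub>j = (2\<pi>i N\<^sub>j(m) + A'\<^sub>j) g\<^sub>m\<close>.  Exponentiating kills the integers, so the value of \<open>g\<close> at \<open>1\<close> conjugates
  the tuples of exponentials.

  Conversely, let \<open>L\<^sub>j\<close> be a logarithm of \<open>exp A\<^sub>j\<close> in the bicommutant of \<open>exp A\<^sub>j\<close>.  Since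
  \<open>exp (A\<^sub>j - L\<^sub>j) = 1\<close>, there is a decomposition \<open>A\<^sub>j - L\<^sub>j = \<Sum> 2\<pi>i k P\<^sub>k\<close> with orthogonal projections \<open>P\<^sub>k\<close>, and
  \<open>\<Sum> x\<^bsup>m(k)\<^esup> P\<^sub>k\<close> with \<open>N\<^sub>j(m(k)) = k\<close> and \<open>N\<^sub>i(m(k)) = 0\<close> for \<open>i \<noteq> j\<close> replaces \<open>A\<^sub>j\<close> by \<open>L\<^sub>j\<close>.  As \<open>L\<close> depends
  only on the exponentials, they determine the module.
\<close>

section \<open>Square complex matrices as a Banach algebra\<close>

text \<open>The modules are given by a definite description over an algebra known only through
  generators inside the endomorphisms of C[T], so their existence is a step of its own. An operator
  has many expressions \<Sum> g e_s, and a tuple A defines an action only if every expression of the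
  zero operator acts by zero. Testing such an expression on monomials yields polynomials that vanish
  on 2 pi i Z^l, because the weights are onto; they then vanish at all tuples of commuting matrices,
  and flatness supplies the commutation.

  Logarithms must lie in the bicommutant because the coordinates are treated one at a time: after
  each replacement the tuple has to be commuting again. No normal form of matrices is used. A
  logarithm is an integral along a path of invertible matrices 1 + z (B - 1), and the projections
  P_k are averages of one-parameter groups over a period; both inherit commutation from their
  integrands.\<close>

text \<open>The type \<open>complex ^ 'n ^ 'n\<close> carries the componentwise product and the Euclidean norm; a copy of
  it with the matrix product and the operator norm gives access to the library's \<^const>\<open>exp\<close>.\<close>

typedef 'n sqmat = "UNIV :: (complex ^ 'n::finite ^ 'n) set"
  morphisms mat_of to_sq ..

setup_lifting type_definition_sqmat

instantiation sqmat :: (finite) real_normed_algebra_1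
begin
lift_definition zero_sqmat :: "'a sqmat" is 0 .
lift_definition one_sqmat :: "'a sqmat" is "mat 1" .
lift_definition plus_sqmat :: "'a sqmat \<Rightarrow> 'a sqmat \<Rightarrow> 'a sqmat" is "(+)" .
lift_definition minus_sqmat :: "'a sqmat \<Rightarrow> 'a sqmat \<Rightarrow> 'a sqmat" is "(-)" .
lift_definition uminus_sqmat :: "'a sqmat \<Rightarrow> 'a sqmat" is uminus .
lift_definition times_sqmat :: "'a sqmat \<Rightarrow> 'a sqmat \<Rightarrow> 'a sqmat" is "(**)" .
lift_definition scaleR_sqmat :: "real \<Rightarrow> 'a sqmat \<Rightarrow> 'a sqmat" is scaleR .
lift_definition norm_sqmat :: "'a sqmat \<Rightarrow> real" is "\<lambda>A. onorm ((*v) A)" .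
definition "dist_sqmat A B = norm (A - B)" for A B :: "'a sqmat"
definition "sgn_sqmat A = scaleR (inverse (norm A)) A" for A :: "'a sqmat"
definition [code del]:
  "(uniformity :: ('a sqmat \<times> 'a sqmat) filter) = (INF e\<in>{0<..}. principal {(A, B). dist A B < e})"
definition [code del]:
  "open (U :: 'a sqmat set) = (\<forall>A\<in>U. \<forall>\<^sub>F (A', B) in uniformity. A' = A \<longrightarrow> B \<in> U)"
instance
proof
  fix a b c :: "'a sqmat" and r s :: real
  show "a + b + c = a + (b + c)" "a + b = b + a" "0 + a = a" "- a + a = 0" "a - b = a + - b"
    by (transfer; simp add: algebra_simps)+
  show "r *\<^sub>R (a + b) = r *\<^sub>R a + r *\<^sub>R b" "(r + s) *\<^sub>R a = r *\<^sub>R a + s *\<^sub>R a"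
    "r *\<^sub>R s *\<^sub>R a = (r * s) *\<^sub>R a" "1 *\<^sub>R a = a"
    by (transfer; simp add: algebra_simps)+
  show "a * b * c = a * (b * c)" "1 * a = a" "a * 1 = a"
    by (transfer; simp add: matrix_mul_assoc)+
  show "(a + b) * c = a * c + b * c" "a * (b + c) = a * b + a * c"
    by (transfer; simp add: matrix_matrix_mult_def vec_eq_iff sum.distrib algebra_simps)+
  show "r *\<^sub>R a * b = r *\<^sub>R (a * b)" "a * r *\<^sub>R b = r *\<^sub>R (a * b)"
    by (transfer; simp add: matrix_matrix_mult_def vec_eq_iff scaleR_right.sum)+
  show "(0::'a sqmat) \<noteq> 1"
    by transfer (auto simp: vec_eq_iff mat_def)
  show "dist a b = norm (a - b)" "sgn a = scaleR (inverse (norm a)) a"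
    by (simp_all add: dist_sqmat_def sgn_sqmat_def)
  show "(uniformity :: ('a sqmat \<times> 'a sqmat) filter) = (INF e\<in>{0<..}. principal {(A, B). dist A B < e})"
    by (rule uniformity_sqmat_def)
  show "open U = (\<forall>A\<in>U. \<forall>\<^sub>F (A', B) in uniformity. A' = A \<longrightarrow> B \<in> U)" for U :: "'a sqmat set"
    by (rule open_sqmat_def)
  show "(norm a = 0) = (a = 0)"
  proof transfer
    fix a :: "complex ^ 'a ^ 'a"
    show "(onorm ((*v) a) = 0) = (a = 0)"
      by (simp add: onorm_eq_0 matrix_eq)
  qed
  show "norm (a + b) \<le> norm a + norm b"
  proof transfer
    fix a b :: "complex ^ 'a ^ 'a"
    have "(*v) (a + b) = (\<lambda>x. a *v x + b *v x)"
      by (simp add: fun_eq_iff matrix_vector_mult_add_rdistrib)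
    then show "onorm ((*v) (a + b)) \<le> onorm ((*v) a) + onorm ((*v) b)"
      by (simp add: onorm_triangle)
  qed
  show "norm (r *\<^sub>R a) = \<bar>r\<bar> * norm a"
  proof transfer
    fix r :: real and a :: "complex ^ 'a ^ 'a"
    have "(*v) (r *\<^sub>R a) = (\<lambda>x. r *\<^sub>R (a *v x))"
      by (simp add: fun_eq_iff matrix_vector_mult_def vec_eq_iff scaleR_right.sum)
    then show "onorm ((*v) (r *\<^sub>R a)) = \<bar>r\<bar> * onorm ((*v) a)"
      by (simp add: onorm_scaleR)
  qed
  show "norm (a * b) \<le> norm a * norm b"
  proof transfer
    fix a b :: "complex ^ 'a ^ 'a"
    have "(*v) (a ** b) = (*v) a \<circ> (*v) b"
      by (simp add: fun_eq_iff matrix_vector_mul_assoc)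
    then show "onorm ((*v) (a ** b)) \<le> onorm ((*v) a) * onorm ((*v) b)"
      by (simp add: onorm_compose)
  qed
  show "norm (1 :: 'a sqmat) = 1"
  proof transfer
    have "(*v) (mat 1 :: complex ^ 'a ^ 'a) = (\<lambda>x. x)" by (simp add: fun_eq_iff)
    then show "onorm ((*v) (mat 1 :: complex ^ 'a ^ 'a)) = 1" by (simp add: onorm_id)
  qed
qed
end

section \<open>Completeness of the operator norm and comparison with
  \<open>matrix_exp\<close>\<close>

lemma norm_entry_le_sqmat: "norm (mat_of A $ i $ j) \<le> norm (A :: 'n::finite sqmat)"
proof transfer
  fix A :: "complex ^ 'n ^ 'n" and i j
  have "norm (A $ i $ j) = norm ((A *v axis j 1) $ i)"
    by (simp add: matrix_vector_mult_def axis_def if_distrib cong: if_cong)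
  also have "\<dots> \<le> norm (A *v axis j 1)" by (rule Finite_Cartesian_Product.norm_nth_le)
  also have "\<dots> \<le> onorm ((*v) A) * norm (axis j (1::complex) :: complex ^ 'n)"
    by (rule onorm) simp
  finally show "norm (A $ i $ j) \<le> onorm ((*v) A)" by simp
qed

lemma norm_vec_le_sum: "norm x \<le> (\<Sum>i\<in>UNIV. norm (x $ i))"
  unfolding norm_vec_def by (rule L2_set_le_sum) simp

lemma norm_sqmat_le: "norm (A :: 'n::finite sqmat) \<le> (\<Sum>i\<in>UNIV. \<Sum>j\<in>UNIV. norm (mat_of A $ i $ j))"
proof transfer
  fix A :: "complex ^ 'n ^ 'n"
  show "onorm ((*v) A) \<le> (\<Sum>i\<in>UNIV. \<Sum>j\<in>UNIV. norm (A $ i $ j))"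
  proof (rule onorm_le)
    fix x :: "complex ^ 'n"
    have "norm (A *v x) \<le> (\<Sum>i\<in>UNIV. norm ((A *v x) $ i))" by (rule norm_vec_le_sum)
    also have "\<dots> \<le> (\<Sum>i\<in>UNIV. \<Sum>j\<in>UNIV. norm (A $ i $ j) * norm x)"
      unfolding matrix_vector_mult_def vec_lambda_beta
      by (intro sum_mono order_trans[OF norm_sum])
        (simp add: norm_mult mult_left_mono Finite_Cartesian_Product.norm_nth_le)
    finally show "norm (A *v x) \<le> (\<Sum>i\<in>UNIV. \<Sum>j\<in>UNIV. norm (A $ i $ j)) * norm x"
      by (simp add: sum_distrib_right)
  qed
qed

text \<open>The entries are bounded by the operator norm, so they have limits; the operator norm is
  at most the sum of the entry norms, so the matrix of these limits is the limit in norm.\<close>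

instance sqmat :: (finite) banach
proof
  fix X :: "nat \<Rightarrow> 'a sqmat"
  assume X: "Cauchy X"
  have "convergent (\<lambda>n. mat_of (X n) $ i $ j)" for i j
  proof (rule Cauchy_convergent, rule metric_CauchyI)
    fix r :: real assume "0 < r"
    with X obtain M where M: "\<And>m n. m \<ge> M \<Longrightarrow> n \<ge> M \<Longrightarrow> dist (X m) (X n) < r"
      by (meson metric_CauchyD)
    have "dist (mat_of (X m) $ i $ j) (mat_of (X n) $ i $ j) \<le> dist (X m) (X n)" for m n
      using norm_entry_le_sqmat[of "X m - X n" i j] by (simp add: dist_norm minus_sqmat.rep_eq)
    with M show "\<exists>M. \<forall>m\<ge>M. \<forall>n\<ge>M. dist (mat_of (X m) $ i $ j) (mat_of (X n) $ i $ j) < r"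
      by (meson order_le_less_trans)
  qed
  then obtain L where L: "\<And>i j. (\<lambda>n. mat_of (X n) $ i $ j) \<longlonglongrightarrow> L i j"
    unfolding convergent_def by metis
  have "(\<lambda>n. \<Sum>i\<in>UNIV. \<Sum>j\<in>UNIV. norm (mat_of (X n) $ i $ j - L i j))
      \<longlonglongrightarrow> (\<Sum>i\<in>(UNIV::'a set). \<Sum>j\<in>(UNIV::'a set). norm (L i j - L i j))"
    by (intro tendsto_intros L)
  then have lim0: "(\<lambda>n. \<Sum>i\<in>UNIV. \<Sum>j\<in>UNIV. norm (mat_of (X n) $ i $ j - L i j)) \<longlonglongrightarrow> 0"
    by simp
  have "X \<longlonglongrightarrow> to_sq (\<chi> i j. L i j)"
  proof (rule metric_tendsto_imp_tendsto[OF lim0], intro always_eventually allI)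
    fix n
    show "dist (X n) (to_sq (\<chi> i j. L i j)) \<le> dist (\<Sum>i\<in>UNIV. \<Sum>j\<in>UNIV. norm (mat_of (X n) $ i $ j - L i j)) 0"
      using norm_sqmat_le[of "X n - to_sq (\<chi> i j. L i j)"]
      by (simp add: dist_norm minus_sqmat.rep_eq to_sq_inverse sum_nonneg)
  qed
  then show "convergent X" by (auto simp: convergent_def)
qed

text \<open>Continuity from the operator norm to the Euclidean norm is what allows the exponential
  series to be moved between the two types.\<close>

lemma bounded_linear_mat_of: "bounded_linear (mat_of :: 'n::finite sqmat \<Rightarrow> _)"
proof (rule bounded_linear_intro)
  show "norm (mat_of A) \<le> norm A * (\<Sum>i\<in>(UNIV::'n set). \<Sum>j\<in>(UNIV::'n set). 1)" for A :: "'n sqmat"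
  proof -
    have "norm (mat_of A) \<le> (\<Sum>i\<in>UNIV. norm (mat_of A $ i))" by (rule norm_vec_le_sum)
    also have "\<dots> \<le> (\<Sum>i\<in>UNIV. \<Sum>j\<in>UNIV. norm (mat_of A $ i $ j))"
      by (intro sum_mono norm_vec_le_sum)
    also have "\<dots> \<le> (\<Sum>i\<in>(UNIV::'n set). \<Sum>j\<in>(UNIV::'n set). norm A)"
      by (intro sum_mono norm_entry_le_sqmat)
    finally show ?thesis by (simp add: algebra_simps)
  qed
qed (simp_all add: plus_sqmat.rep_eq scaleR_sqmat.rep_eq)

lemma matrix_exp_eq: "matrix_exp (A :: complex ^ 'n::finite ^ 'n) = mat_of (exp (to_sq A))"
proof -
  have pow: "mat_of (to_sq A ^ k) = ((\<lambda>B. A ** B) ^^ k) (mat 1)" for k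
    by (induction k) (simp_all add: one_sqmat.rep_eq times_sqmat.rep_eq to_sq_inverse)
  have "mat_of (exp (to_sq A)) = suminf (\<lambda>k. mat_of (to_sq A ^ k /\<^sub>R fact k))"
    unfolding exp_def
    by (rule bounded_linear.suminf[OF bounded_linear_mat_of summable_exp_generic])
  then show ?thesis
    by (simp add: matrix_exp_def scaleR_sqmat.rep_eq pow inverse_eq_divide)
qed

text \<open>\<open>sqmat\<close> is an algebra over the reals; complex scalars enter as these
  central elements, so commutation arguments treat them like any other factor.\<close>

definition scal :: "complex \<Rightarrow> 'n::finite sqmat" where
  "scal z = to_sq (mat z)"

lemma mat_of_scal: "mat_of (scal z) = mat z"
  by (simp add: scal_def to_sq_inverse)

lemma mat_matrix_mult: "mat z ** A = (\<chi> i j. (z :: complex) * A $ i $ j)"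
  by (simp add: vec_eq_iff matrix_matrix_mult_def mat_def)
    (auto simp: if_distrib if_distribR sum.delta'[OF finite] sum.delta[OF finite] cong: if_cong)

lemma matrix_mult_mat: "A ** mat z = (\<chi> i j. (z :: complex) * A $ i $ j)"
  by (simp add: vec_eq_iff matrix_matrix_mult_def mat_def)
    (auto simp: if_distrib if_distribR sum.delta'[OF finite] sum.delta[OF finite] mult.commute cong: if_cong)

lemma scal_0 [simp]: "scal 0 = 0" and scal_1 [simp]: "scal 1 = 1"
  and scal_add: "scal (a + b) = scal a + scal b"
  and scal_diff: "scal (a - b) = scal a - scal b"
  and scal_minus: "scal (- a) = - scal a"
  and scal_scaleR: "scal (r *\<^sub>R a) = r *\<^sub>R scal a"
  by (simp_all add: mat_of_inject[symmetric] mat_of_scal zero_sqmat.rep_eq one_sqmat.rep_eq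
      plus_sqmat.rep_eq minus_sqmat.rep_eq uminus_sqmat.rep_eq scaleR_sqmat.rep_eq vec_eq_iff mat_def)

lemma scal_mult: "scal (a * b) = scal a * scal b"
  by (simp add: mat_of_inject[symmetric] mat_of_scal times_sqmat.rep_eq mat_matrix_mult)
    (simp add: vec_eq_iff mat_def)

lemma scal_commute: "scal z * A = A * scal z"
  by (simp add: mat_of_inject[symmetric] mat_of_scal times_sqmat.rep_eq mat_matrix_mult matrix_mult_mat)

lemma bounded_linear_scal: "bounded_linear (scal :: _ \<Rightarrow> 'n::finite sqmat)"
  by (rule linear_conv_bounded_linear[THEN iffD1])
    (auto intro!: linearI simp: scal_add scal_scaleR)

lemma scal_power: "scal (z ^ k) = scal z ^ k"
  by (induction k) (simp_all add: scal_mult)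

lemma exp_scal: "exp (scal z) = (scal (exp z) :: 'n::finite sqmat)"
  unfolding exp_def
  by (subst bounded_linear.suminf[OF bounded_linear_scal summable_exp_generic])
    (simp add: scal_scaleR scal_power)

lemma scal_mult_eq_0: "scal z * A = 0 \<longleftrightarrow> z = 0 \<or> A = 0"
proof -
  have "scal (inverse z) * (scal z * A) = A" if "z \<noteq> 0"
    using that by (simp add: mult.assoc[symmetric] scal_mult[symmetric])
  then show ?thesis by (metis mult_zero_left mult_zero_right scal_0)
qed

section \<open>Exponentials and logarithms in Banach algebras\<close>

text \<open>The hypothesis passes to all powers and then to the series. G may be singular, which
  matters for the coefficients of a gauge matrix; with X = Y the conclusion is that G commutes with
  the exponential.\<close>

lemma exp_intertwine:
  fixes X Y G :: "'a::{real_normed_algebra_1, banach}"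
  assumes "X * G = G * Y"
  shows "exp X * G = G * exp Y"
proof -
  have pow: "X ^ k * G = G * Y ^ k" for k
    by (induction k) (simp_all add: mult.assoc, metis assms mult.assoc)
  have "exp X * G = suminf (\<lambda>k. (X ^ k /\<^sub>R fact k) * G)"
    unfolding exp_def by (rule suminf_mult2[OF summable_exp_generic])
  also have "\<dots> = suminf (\<lambda>k. G * (Y ^ k /\<^sub>R fact k))"
    by (simp add: pow)
  also have "\<dots> = G * exp Y"
    unfolding exp_def by (rule suminf_mult[OF summable_exp_generic])
  finally show ?thesis .
qed

text \<open>The tail from degree two on is dominated by the same tail of the real series at
  \<open>norm x\<close>, which is at most the square on the unit interval.\<close>

lemma norm_exp_remainder:
  fixes x :: "'a::{real_normed_algebra_1, banach}"
  assumes "norm x \<le> 1"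
  shows "norm (exp x - 1 - x) \<le> (norm x)\<^sup>2"
proof -
  let ?f = "\<lambda>n. inverse (fact (n + 2)) *\<^sub>R (x ^ (n + 2))"
  let ?g = "\<lambda>n. inverse (fact (n + 2)) *\<^sub>R (norm x ^ (n + 2))"
  have g: "summable ?g"
    using summable_ignore_initial_segment[OF summable_exp_generic[of "norm x"], of 2] by simp
  have fg: "norm (?f n) \<le> ?g n" for n
    using norm_power_ineq[of x "n + 2"] by (simp add: mult_left_mono)
  have f: "summable (\<lambda>n. norm (?f n))"
    by (rule summable_comparison_test[OF _ g]) (use fg in auto)
  have "norm (exp x - 1 - x) = norm (suminf ?f)"
    using exp_first_two_terms[of x] by simp
  also have "\<dots> \<le> suminf (\<lambda>n. norm (?f n))"
    by (rule summable_norm[OF f])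
  also have "\<dots> \<le> suminf ?g"
    by (rule suminf_le[OF fg f g])
  also have "\<dots> = exp (norm x) - 1 - norm x"
    using exp_first_two_terms[of "norm x"] by simp
  also have "\<dots> \<le> (norm x)\<^sup>2"
    using exp_bound[of "norm x"] assms by simp
  finally show ?thesis .
qed

lemma has_derivative_exp_0:
  "((exp :: 'a::{real_normed_algebra_1, banach} \<Rightarrow> 'a) has_derivative (\<lambda>h. h)) (at 0)"
  unfolding has_derivative_at
proof (intro conjI)
  show "bounded_linear (\<lambda>h::'a. h)" by (rule bounded_linear_ident)
  show "((\<lambda>h. norm (exp (0 + h) - exp 0 - h) / norm h) \<longlongrightarrow> 0) (at (0::'a))"
  proof (rule tendsto_sandwich[of "\<lambda>_. 0" _ _ norm])
    have "eventually (\<lambda>h::'a. norm h < 1) (at 0)"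
      by (metis dist_0_norm dist_commute eventually_at zero_less_one)
    then show "eventually (\<lambda>h::'a. norm (exp (0 + h) - exp 0 - h) / norm h \<le> norm h) (at 0)"
    proof eventually_elim
      case (elim h)
      then show ?case
        using norm_exp_remainder[of h] by (cases "h = 0") (simp_all add: divide_le_eq power2_eq_square)
    qed
    show "(norm \<longlongrightarrow> 0) (at (0::'a))" by (rule tendsto_norm_zero) (rule tendsto_ident_at)
  qed auto
qed

text \<open>Since the values commute, exp (L s) = exp (L t) exp (L s - L t), which reduces the claim
  to the derivative of \<open>exp\<close> at 0.\<close>

lemma exp_commuting_has_vector_derivative:
  fixes L :: "real \<Rightarrow> 'a::{real_normed_algebra_1, banach}"
  assumes L: "(L has_vector_derivative L') (at t within S)" and t: "t \<in> S"
    and comm: "\<And>s. s \<in> S \<Longrightarrow> L s * L t = L t * L s"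
  shows "((\<lambda>s. exp (L s)) has_vector_derivative exp (L t) * L') (at t within S)"
proof -
  have "((\<lambda>s. L s - L t) has_derivative (\<lambda>x. x *\<^sub>R L')) (at t within S)"
    using has_vector_derivative_diff[OF L has_vector_derivative_const[of "L t"]]
    by (simp add: has_vector_derivative_def)
  moreover have "(exp has_derivative (\<lambda>h. h)) (at (L t - L t))"
    using has_derivative_exp_0 by simp
  ultimately have "((\<lambda>s. exp (L s - L t)) has_derivative (\<lambda>x. x *\<^sub>R L')) (at t within S)"
    by (rule has_derivative_compose)
  then have "((\<lambda>s. exp (L s - L t)) has_vector_derivative L') (at t within S)"
    by (simp add: has_vector_derivative_def)
  then have "((\<lambda>s. exp (L t) * exp (L s - L t)) has_vector_derivative exp (L t) * L') (at t within S)"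
    by (rule has_vector_derivative_mult_right)
  moreover have "exp (L t) * exp (L s - L t) = exp (L s)" if "s \<in> S" for s
    using comm[OF that] by (subst exp_add_commuting[symmetric]) (simp_all add: algebra_simps)
  ultimately show ?thesis
    using t by (intro has_vector_derivative_transform[OF t, of "\<lambda>s. exp (L s)" "\<lambda>s. exp (L t) * exp (L s - L t)"]) auto
qed

text \<open>The identity W t - W s = W t (X s - X t) W s bounds the difference by norm (W t) times
  the small quantity \<delta>. As norm (W t) is at most norm (W t - W s) + norm (W s), the first
  summand can be absorbed on the left once \<delta> is below 1/2.\<close>

lemma continuous_on_inverse_algebra:
  fixes X W :: "real \<Rightarrow> 'a::real_normed_algebra_1"
  assumes X: "continuous_on S X"
    and W: "\<And>t. t \<in> S \<Longrightarrow> W t * X t = 1" "\<And>t. t \<in> S \<Longrightarrow> X t * W t = 1"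
  shows "continuous_on S W"
  unfolding continuous_on_def
proof
  fix s assume s: "s \<in> S"
  define \<delta> where "\<delta> t = norm (X s - X t) * norm (W s)" for t
  have "((\<lambda>t. norm (X s - X t) * norm (W s)) \<longlongrightarrow> norm (X s - X s) * norm (W s)) (at s within S)"
    using X s by (intro tendsto_intros) (simp add: continuous_on_def)
  then have \<delta>: "(\<delta> \<longlongrightarrow> 0) (at s within S)" by (simp add: \<delta>_def[abs_def])
  then have "eventually (\<lambda>t. \<delta> t < 1 / 2) (at s within S)"
    by (rule order_tendstoD) simp
  moreover have "eventually (\<lambda>t. t \<in> S) (at s within S)"
    by (simp add: eventually_at_filter)
  ultimately have "eventually (\<lambda>t. norm (W t - W s) \<le> 2 * (\<delta> t * norm (W s))) (at s within S)"
  proof eventually_elim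
    case (elim t)
    have "W t - W s = W t * (X s * W s) - (W t * X t) * W s"
      using W s elim by simp
    also have "\<dots> = W t * ((X s - X t) * W s)" by (simp add: algebra_simps)
    finally have "norm (W t - W s) \<le> norm (W t) * norm ((X s - X t) * W s)"
      by (simp add: norm_mult_ineq)
    also have "\<dots> \<le> norm (W t) * \<delta> t"
      by (simp add: \<delta>_def mult_left_mono norm_mult_ineq)
    also have "\<dots> \<le> (norm (W t - W s) + norm (W s)) * \<delta> t"
      by (intro mult_right_mono) (metis diff_add_cancel norm_triangle_ineq, simp add: \<delta>_def)
    finally have "norm (W t - W s) \<le> norm (W t - W s) * \<delta> t + norm (W s) * \<delta> t"
      by (simp add: algebra_simps)
    moreover have "norm (W t - W s) * \<delta> t \<le> norm (W t - W s) * (1 / 2)"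
      using elim by (intro mult_left_mono) auto
    ultimately show ?case by (simp add: mult.commute)
  qed
  moreover have "((\<lambda>t. 2 * (\<delta> t * norm (W s))) \<longlongrightarrow> 0) (at s within S)"
    using tendsto_mult_right_zero[OF tendsto_mult_left_zero[OF \<delta>, of "norm (W s)"], of 2] .
  ultimately have "((\<lambda>t. W t - W s) \<longlongrightarrow> 0) (at s within S)"
    by (rule Lim_null_comparison)
  then show "(W \<longlongrightarrow> W s) (at s within S)" by (rule Lim_null[THEN iffD2])
qed

text \<open>Left and right multiplication by D are bounded linear, so both pass through the
  integral.\<close>

lemma integral_commute_algebra:
  fixes f :: "real \<Rightarrow> 'a::{real_normed_algebra_1, banach}"
  assumes f: "f integrable_on S" and D: "\<And>s. s \<in> S \<Longrightarrow> D * f s = f s * D"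
  shows "D * integral S f = integral S f * D"
proof -
  have "((\<lambda>s. D * f s) has_integral D * integral S f) S"
    using has_integral_linear[OF integrable_integral[OF f] bounded_linear_mult_right[of D]]
    by (simp add: o_def)
  then have "((\<lambda>s. f s * D) has_integral D * integral S f) S"
    by (rule has_integral_eq[rotated]) (rule D)
  moreover have "((\<lambda>s. f s * D) has_integral integral S f * D) S"
    using has_integral_linear[OF integrable_integral[OF f] bounded_linear_mult_left[of D]]
    by (simp add: o_def)
  ultimately show ?thesis by (rule has_integral_unique)
qed

text \<open>The logarithm of \<open>X 1\<close> is \<open>\<integral> X\<inverse> X'\<close> along a path of commuting invertible elements.\<close>

lemma log_along_path:
  fixes X X' W :: "real \<Rightarrow> 'a::{real_normed_algebra_1, banach}"
  assumes X': "\<And>t. t \<in> {0..1} \<Longrightarrow> (X has_vector_derivative X' t) (at t within {0..1})"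
    and cont: "continuous_on {0..1} X'" and X0: "X 0 = 1"
    and W: "\<And>t. t \<in> {0..1} \<Longrightarrow> W t * X t = 1" "\<And>t. t \<in> {0..1} \<Longrightarrow> X t * W t = 1"
    and comm: "\<And>s t. s \<in> {0..1} \<Longrightarrow> t \<in> {0..1} \<Longrightarrow> (W s * X' s) * (W t * X' t) = (W t * X' t) * (W s * X' s)"
      "\<And>s t. s \<in> {0..1} \<Longrightarrow> t \<in> {0..1} \<Longrightarrow> (W s * X' s) * X t = X t * (W s * X' s)"
  obtains L where "exp L = X 1"
    "\<And>D. (\<And>s. s \<in> {0..1} \<Longrightarrow> D * (W s * X' s) = (W s * X' s) * D) \<Longrightarrow> D * L = L * D"
proof -
  have contX: "continuous_on {0..1} X"
    using X' by (rule continuous_on_vector_derivative)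
  have contW: "continuous_on {0..1} W"
    by (rule continuous_on_inverse_algebra[OF contX W])
  have contf: "continuous_on {0..1} (\<lambda>s. W s * X' s)"
    by (intro continuous_intros contW cont)
  define L where "L t = integral {0..t} (\<lambda>s. W s * X' s)" for t
  have L': "(L has_vector_derivative W t * X' t) (at t within {0..1})" if "t \<in> {0..1}" for t
    unfolding L_def[abs_def] using integral_has_vector_derivative[OF contf that] .
  have int: "(\<lambda>s. W s * X' s) integrable_on {0..t}" if "t \<in> {0..1}" for t
    using that by (intro integrable_continuous_interval continuous_on_subset[OF contf]) auto
  have Lcomm: "D * L t = L t * D" if "t \<in> {0..1}"
    and "\<And>s. s \<in> {0..1} \<Longrightarrow> D * (W s * X' s) = (W s * X' s) * D" for D t
    unfolding L_def using that by (intro integral_commute_algebra int) auto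
  have LL: "L s * L t = L t * L s" if "s \<in> {0..1}" "t \<in> {0..1}" for s t
    using that Lcomm comm by metis
  have XL: "X t * L s = L s * X t" if "s \<in> {0..1}" "t \<in> {0..1}" for s t
    by (rule Lcomm) (use that comm in auto)
  \<comment> \<open>The product is constant: L has derivative W X', and W X' X = X W X' = X', so the
    two terms of the derivative cancel.\<close>
  have F: "((\<lambda>t. exp (- L t) * X t) has_vector_derivative 0) (at t within {0..1})"
    if t: "t \<in> {0..1}" for t
  proof -
    have "((\<lambda>t. exp (- L t)) has_vector_derivative exp (- L t) * (- (W t * X' t))) (at t within {0..1})"
      by (rule exp_commuting_has_vector_derivative)
        (use t L' LL in \<open>auto intro: has_vector_derivative_minus\<close>)
    from has_vector_derivative_mult[OF this X'[OF t]]
    have "((\<lambda>t. exp (- L t) * X t) has_vector_derivative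
        exp (- L t) * X' t + exp (- L t) * (- (W t * X' t)) * X t) (at t within {0..1})" .
    moreover have "(W t * X' t) * X t = X' t"
      using comm(2)[OF t t] W(2)[OF t] by (simp add: mult.assoc[symmetric])
    then have "exp (- L t) * X' t + exp (- L t) * (- (W t * X' t)) * X t = 0"
      by (simp add: mult.assoc)
    ultimately show ?thesis by simp
  qed
  have "exp (- L 1) * X 1 = exp (- L 0) * X 0"
    using has_vector_derivative_zero_constant[of "{0..1}", OF _ F]
    by (metis atLeastAtMost_iff convex_real_interval(5) order_refl zero_le_one)
  then have "exp (- L 1) * X 1 = 1" by (simp add: L_def X0)
  then have "exp (L 1) * (exp (- L 1) * X 1) = exp (L 1)" by simp
  then have "exp (L 1) = X 1"
    by (simp add: mult.assoc[symmetric] exp_minus_inverse)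
  then show ?thesis using that Lcomm by simp
qed

section \<open>Periodic one-parameter groups\<close>

lemma integrable_exp_scaleR:
  "(\<lambda>t. exp (t *\<^sub>R Z)) integrable_on {0..1}" for Z :: "'a::{real_normed_algebra_1, banach}"
  by (intro integrable_continuous_interval continuous_on_vector_derivative)
    (rule exp_scaleR_has_vector_derivative_right)

text \<open>The average of the one-parameter group of \<open>Z\<close> over a period is the projection onto the kernel
  of \<open>Z\<close>.\<close>

definition periodic_proj :: "'a::{real_normed_algebra_1, banach} \<Rightarrow> 'a" where
  "periodic_proj Z = integral {0..1} (\<lambda>t. exp (t *\<^sub>R Z))"

lemma periodic_proj_commute:
  assumes "D * Z = Z * D"
  shows "D * periodic_proj Z = periodic_proj Z * D"
  unfolding periodic_proj_def
  by (rule integral_commute_algebra[OF integrable_exp_scaleR], rule exp_intertwine[symmetric]) (simp add: assms)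

text \<open>The derivative of exp (t Z) is exp (t Z) Z, so the integral of the latter over the
  period is exp Z - 1 = 0.\<close>

lemma mult_periodic_proj:
  assumes "exp Z = 1"
  shows "Z * periodic_proj Z = 0"
proof -
  have "((\<lambda>t. exp (t *\<^sub>R Z) * Z) has_integral exp (1 *\<^sub>R Z) - exp (0 *\<^sub>R Z)) {0..1}"
    by (intro fundamental_theorem_of_calculus exp_scaleR_has_vector_derivative_right) simp
  then have "((\<lambda>t. exp (t *\<^sub>R Z) * Z) has_integral 0) {0..1}" using assms by simp
  moreover have "((\<lambda>t. exp (t *\<^sub>R Z) * Z) has_integral periodic_proj Z * Z) {0..1}"
    using has_integral_linear[OF integrable_integral[OF integrable_exp_scaleR[of Z]] bounded_linear_mult_left[of Z]]
    by (simp add: o_def periodic_proj_def)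
  ultimately have "periodic_proj Z * Z = 0" by (auto dest: has_integral_unique)
  then show ?thesis by (simp add: periodic_proj_commute)
qed

text \<open>If Z annihilates C, then exp (t Z) C = C for all t, and so the average fixes C. Together
  with \<open>mult_periodic_proj\<close> this makes the average idempotent.\<close>

lemma periodic_proj_fix:
  assumes "Z * C = 0"
  shows "periodic_proj Z * C = C"
proof -
  have e: "exp (t *\<^sub>R Z) * C = C" for t
  proof -
    have "(t *\<^sub>R Z) * C = C * 0" using assms by simp
    from exp_intertwine[OF this] show ?thesis by simp
  qed
  have "((\<lambda>t. exp (t *\<^sub>R Z) * C) has_integral periodic_proj Z * C) {0..1}"
    using has_integral_linear[OF integrable_integral[OF integrable_exp_scaleR[of Z]] bounded_linear_mult_left[of C]]
    unfolding o_def periodic_proj_def .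
  then have "((\<lambda>t. C) has_integral periodic_proj Z * C) {0..1::real}" unfolding e .
  moreover have "((\<lambda>t. C) has_integral C) {0..1::real}"
    using has_integral_const_real[of C 0 1] by simp
  ultimately show ?thesis by (rule has_integral_unique)
qed

section \<open>Spectral decomposition and logarithms of matrices\<close>

definition peval :: "complex poly \<Rightarrow> 'n::finite sqmat \<Rightarrow> 'n sqmat" where
  "peval p Y = (\<Sum>i\<le>degree p. scal (coeff p i) * Y ^ i)"

lemma peval_eq:
  assumes "degree p \<le> n"
  shows "peval p Y = (\<Sum>i\<le>n. scal (coeff p i) * Y ^ i)"
  unfolding peval_def using assms
  by (intro sum.mono_neutral_left) (auto simp: coeff_eq_0)

lemma peval_pCons: "peval (pCons c q) Y = scal c + Y * peval q Y"
proof -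
  have "peval (pCons c q) Y = (\<Sum>i\<le>Suc (degree q). scal (coeff (pCons c q) i) * Y ^ i)"
    by (rule peval_eq) (rule degree_pCons_le)
  also have "\<dots> = scal c + (\<Sum>i\<le>degree q. scal (coeff q i) * (Y * Y ^ i))"
    by (subst sum.atMost_Suc_shift) simp
  also have "(\<Sum>i\<le>degree q. scal (coeff q i) * (Y * Y ^ i)) = Y * peval q Y"
    unfolding peval_def sum_distrib_left
    by (intro sum.cong refl) (metis mult.assoc scal_commute)
  finally show ?thesis .
qed

lemma peval_add: "peval (p + q) Y = peval p Y + peval q Y"
  by (simp add: peval_eq[of p "max (degree p) (degree q)"] peval_eq[of q "max (degree p) (degree q)"]
      peval_eq[of "p + q" "max (degree p) (degree q)"] degree_add_le scal_add distrib_right sum.distrib)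

lemma peval_smult: "peval (smult c p) Y = scal c * peval p Y"
  by (simp add: peval_eq[of "smult c p" "degree p"] degree_smult_le peval_def sum_distrib_left
      scal_mult mult.assoc)

lemma peval_const: "peval [:c:] Y = scal c"
  by (simp add: peval_def)

lemma peval_linear_mult: "peval ([:- a, 1:] * q) Y = (Y - scal a) * peval q Y"
proof -
  have "[:- a, 1:] * q = pCons 0 q + smult (- a) q" by simp
  then show ?thesis
    by (simp only: peval_add peval_pCons peval_smult) (simp add: scal_minus algebra_simps)
qed

lemma peval_commute:
  assumes "D * Y = Y * D"
  shows "D * peval p Y = peval p Y * D"
  unfolding peval_def sum_distrib_left sum_distrib_right
proof (intro sum.cong refl)
  fix i
  have "D * Y ^ i = Y ^ i * D"
    using assms by (metis power_commuting_commutes)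
  then show "D * (scal (coeff p i) * Y ^ i) = scal (coeff p i) * Y ^ i * D"
    by (metis mult.assoc scal_commute)
qed

text \<open>The matrices have finite real dimension N, so the N + 1 powers of Y from 0 to N satisfy
  a linear relation, even with real coefficients.\<close>

lemma annihilating_poly_exists:
  fixes Y :: "'n::finite sqmat"
  obtains p where "p \<noteq> 0" "peval p Y = 0"
proof -
  define f where "f i = mat_of (Y ^ i)" for i
  have *: thesis if "(\<Sum>i\<le>N. u i *\<^sub>R f i) = 0" "j \<le> N" "u j \<noteq> 0" for u :: "nat \<Rightarrow> real" and j N
  proof -
    define p where "p = (\<Sum>i\<le>N. monom (complex_of_real (u i)) i)"
    have c: "coeff p i = (if i \<le> N then complex_of_real (u i) else 0)" for i
      by (simp add: p_def coeff_sum)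
    have "degree p \<le> N" by (rule degree_le) (simp add: c)
    moreover have "scal (complex_of_real r) * A = r *\<^sub>R A" for r and A :: "'n sqmat"
    proof -
      have "scal (r *\<^sub>R 1) = r *\<^sub>R (scal 1 :: 'n sqmat)" by (rule scal_scaleR)
      then show ?thesis by (simp add: scaleR_conv_of_real)
    qed
    ultimately have "peval p Y = (\<Sum>i\<le>N. u i *\<^sub>R Y ^ i)"
      by (simp add: peval_eq c)
    moreover have "mat_of (\<Sum>i\<le>N. u i *\<^sub>R Y ^ i) = (\<Sum>i\<le>N. u i *\<^sub>R f i)"
      by (simp add: linear_sum[OF bounded_linear.linear[OF bounded_linear_mat_of]] f_def scaleR_sqmat.rep_eq)
    ultimately have "peval p Y = 0"
      using that(1) by (simp add: mat_of_inject[symmetric] zero_sqmat.rep_eq)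
    moreover have "p \<noteq> 0" using that(2,3) c[of j] by auto
    ultimately show thesis using \<open>\<And>p. p \<noteq> 0 \<Longrightarrow> peval p Y = 0 \<Longrightarrow> thesis\<close> by blast
  qed
  define N where "N = DIM(complex ^ 'n ^ 'n)"
  show thesis
  proof (cases "inj_on f {..N}")
    case True
    have "card (f ` {..N}) > DIM(complex ^ 'n ^ 'n)"
      unfolding card_image[OF True] N_def[symmetric] by simp
    then have "dependent (f ` {..N})"
      by (intro dependent_biggerset) auto
    then obtain u where u: "\<exists>v\<in>f ` {..N}. u v \<noteq> 0" "(\<Sum>v\<in>f ` {..N}. u v *\<^sub>R v) = 0"
      by (subst (asm) dependent_finite) auto
    then obtain j where "j \<le> N" "u (f j) \<noteq> 0" by auto
    moreover have "(\<Sum>i\<le>N. u (f i) *\<^sub>R f i) = 0"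
      using u(2) by (simp add: sum.reindex[OF True] o_def)
    ultimately show thesis using *[where u = "\<lambda>i. u (f i)"] by blast
  \<comment> \<open>Dependence is a property of sets, so a repetition among the powers is treated
    apart: the relation is then the difference of two equal powers.\<close>
  next
    case False
    then obtain i j where ij: "i \<le> N" "j \<le> N" "i \<noteq> j" "f i = f j" by (auto simp: inj_on_def)
    define u where "u k = (if k = i then 1 else if k = j then -1 else 0 :: real)" for k
    have "(\<Sum>k\<le>N. u k *\<^sub>R f k) = (\<Sum>k\<in>{i, j}. u k *\<^sub>R f k)"
      using ij by (intro sum.mono_neutral_right) (auto simp: u_def)
    also have "\<dots> = 0" using ij by (simp add: u_def)
    finally show thesis using *[of u N i] ij by (simp add: u_def)
  qed
qed

text \<open>Linear factors are split off p one at a time. Since p(Y) C = 0 and C is not 0, some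
  factor x - a is the first to turn a nonzero matrix q(Y) C into 0; the nonzero columns of that
  matrix are eigenvectors.\<close>

lemma annihilated_eigenvector:
  assumes "p \<noteq> 0" "peval p Y * C = 0" "C \<noteq> 0"
  obtains a q where "poly p a = 0" "peval q Y * C \<noteq> 0" "(Y - scal a) * (peval q Y * C) = 0"
  using assms(1,2)
proof (induction "degree p" arbitrary: p thesis rule: less_induct)
  case less
  show ?case
  proof (cases "degree p = 0")
    case True
    then obtain c where "p = [:c:]" by (metis degree_eq_zeroE)
    with less.prems assms(3) show ?thesis by (simp add: peval_const scal_mult_eq_0)
  next
    case False
    then obtain a where a: "poly p a = 0"
      using fundamental_theorem_of_algebra[of p] by (auto simp: constant_degree)
    then obtain q where q: "p = [:- a, 1:] * q" by (auto simp: poly_eq_0_iff_dvd)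
    with less.prems have "q \<noteq> 0" by auto
    then have deg: "degree q < degree p" by (simp add: q degree_mult_eq del: mult_pCons_left)
    show ?thesis
    proof (cases "peval q Y * C = 0")
      case True
      from less.hyps[OF deg _ \<open>q \<noteq> 0\<close> True] show ?thesis
        using less.prems(1) by (metis q poly_mult mult_zero_right)
    next
      case False
      then show ?thesis
        using less.prems a by (metis q peval_linear_mult mult.assoc)
    qed
  qed
qed

text \<open>Division of p - p(a) by x - a gives (C - a) q(C) = - p(a). Being a polynomial in C, the
  resulting inverse is two-sided.\<close>

lemma inverse_of_nonroot:
  assumes "peval p C = 0" "poly p a \<noteq> 0"
  obtains W where "W * (C - scal a) = 1" "(C - scal a) * W = 1"
proof -
  have "poly (p - [:poly p a:]) a = 0" by simp
  then have "[:- a, 1:] dvd p - [:poly p a:]" by (simp only: poly_eq_0_iff_dvd)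
  then obtain q where q: "p - [:poly p a:] = [:- a, 1:] * q" by (rule dvdE)
  have "p = [:- a, 1:] * q + [:poly p a:]" using q by (metis diff_add_cancel)
  then have "(C - scal a) * peval q C + scal (poly p a) = 0"
    using assms(1) by (metis peval_add peval_const peval_linear_mult)
  then have "(C - scal a) * peval q C = scal (- poly p a)"
    by (simp add: scal_minus eq_neg_iff_add_eq_0)
  then have 1: "(C - scal a) * (peval q C * scal (inverse (- poly p a))) = 1"
    using assms(2) by (metis mult.assoc scal_mult scal_1 neg_equal_0_iff_equal right_inverse)
  moreover have "(C - scal a) * (peval q C * scal (inverse (- poly p a))) =
      (peval q C * scal (inverse (- poly p a))) * (C - scal a)"
    using peval_commute[of "C - scal a" C q] scal_commute
    by (metis (no_types, lifting) left_diff_distrib right_diff_distrib mult.assoc)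
  ultimately show thesis using that by metis
qed

lemma exp_2pi_i_int: "exp (2 * pi * \<i> * of_int k) = 1"
  by (simp add: exp_eq_1)

text \<open>Y - 2 pi i k also has exponential 1, so its periodic average P k projects onto the
  eigenspace of Y for 2 pi i k. That these eigenspaces span is the diagonalisability of Y; K
  collects the k for which 2 pi i k is a root of an annihilating polynomial.\<close>

lemma exp_eq_one_decomposition:
  fixes Y :: "'n::finite sqmat"
  assumes Y: "exp Y = 1"
  obtains K :: "int set" and P where "finite K" "(\<Sum>k\<in>K. P k) = 1"
    "\<And>k. Y * P k = scal (2 * pi * \<i> * of_int k) * P k"
    "\<And>k l. k \<noteq> l \<Longrightarrow> P k * P l = 0"
    "\<And>k. P k * P k = P k"
    "\<And>k D. D * Y = Y * D \<Longrightarrow> D * P k = P k * D"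
proof -
  define c where "c k = 2 * pi * \<i> * of_int k" for k
  define Z where "Z k = Y - scal (c k)" for k
  define P where "P k = periodic_proj (Z k)" for k
  have expZ: "exp (Z k) = 1" for k
  proof -
    have "exp (Z k) = exp Y * exp (scal (- c k))"
      unfolding Z_def by (subst exp_add_commuting[symmetric]) (simp_all add: scal_commute scal_minus)
    then show ?thesis
      using exp_2pi_i_int[of "- k"] Y by (simp add: exp_scal c_def)
  qed
  have commZ: "D * Z k = Z k * D" if "D * Y = Y * D" for D k
    using that by (simp add: Z_def algebra_simps scal_commute)
  have comm: "D * P k = P k * D" if "D * Y = Y * D" for D k
    unfolding P_def by (intro periodic_proj_commute commZ that)
  have ZP: "Z k * P k = 0" for k
    unfolding P_def by (rule mult_periodic_proj[OF expZ])
  have PP: "P k * P k = P k" for k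
    using periodic_proj_fix[OF ZP] by (simp add: P_def)
  have YP: "Y * P k = scal (c k) * P k" for k
    using ZP[of k] by (simp add: Z_def algebra_simps)
  \<comment> \<open>Multiplication by Y scales P k * P l by c k as well as by c l, and these
    differ.\<close>
  have orth: "P k * P l = 0" if "k \<noteq> l" for k l
  proof -
    have "P l * Y = Y * P l" by (rule comm[symmetric]) simp
    have "scal (c k) * (P k * P l) = Y * P k * P l" by (simp add: YP mult.assoc)
    also have "\<dots> = P k * (Y * P l)" by (simp add: comm[of Y] mult.assoc)
    also have "\<dots> = scal (c l) * (P k * P l)"
      by (metis YP mult.assoc scal_commute)
    finally have "scal (c k - c l) * (P k * P l) = 0"
      by (simp add: scal_diff left_diff_distrib)
    moreover have "c k - c l \<noteq> 0" using that by (simp add: c_def)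
    ultimately show ?thesis by (simp add: scal_mult_eq_0)
  qed
  obtain p where p: "p \<noteq> 0" "peval p Y = 0" by (rule annihilating_poly_exists)
  define K where "K = {k. poly p (c k) = 0}"
  have "inj c" by (rule injI) (simp add: c_def)
  then have K: "finite K"
    using finite_vimageI[OF poly_roots_finite[OF p(1)]] by (simp add: K_def vimage_def)
  define Q where "Q = 1 - (\<Sum>k\<in>K. P k)"
  have YQ: "Q * Y = Y * Q"
    by (simp add: Q_def algebra_simps sum_distrib_left sum_distrib_right comm[of Y])
  have PQ: "P k * Q = 0" if "k \<in> K" for k
  proof -
    have "P k * (\<Sum>l\<in>K. P l) = (\<Sum>l\<in>K. if l = k then P k else 0)"
      unfolding sum_distrib_left by (intro sum.cong) (auto simp: PP orth)
    then show ?thesis using that K by (simp add: Q_def right_diff_distrib)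
  qed
  \<comment> \<open>A nonzero complement Q would contain eigenvectors of Y, whose eigenvalue is a
    root of p with exponential 1, hence c k for some k in K. Then P k fixes them, but it commutes
    with polynomials in Y and annihilates Q.\<close>
  have "Q = 0"
  proof (rule ccontr)
    assume "Q \<noteq> 0"
    then obtain a q where q: "poly p a = 0" "peval q Y * Q \<noteq> 0" "(Y - scal a) * (peval q Y * Q) = 0"
      using annihilated_eigenvector[of p Y Q] p by auto
    define C where "C = peval q Y * Q"
    have "Y * C = C * scal a" using q(3) by (simp add: C_def[symmetric] scal_commute[symmetric] algebra_simps)
    then have "C = C * scal (exp a)" using exp_intertwine[of Y C "scal a"] by (simp add: Y exp_scal)
    then have "scal (exp a - 1) * C = 0" by (simp add: scal_diff algebra_simps scal_commute)
    then have "exp a = 1" using q(2) by (simp add: scal_mult_eq_0 C_def)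
    then obtain k :: int where "Re a = 0" "Im a = of_int (2 * k) * pi" by (auto simp only: exp_eq_1)
    then have k: "a = c k" by (simp add: c_def complex_eq_iff)
    then have kK: "k \<in> K" using q(1) by (simp add: K_def)
    have "P k * C = C"
      unfolding P_def by (rule periodic_proj_fix) (use q(3) k in \<open>simp add: Z_def C_def\<close>)
    moreover have "P k * C = 0"
      using PQ[OF kK] comm[of "peval q Y" k] peval_commute[of Y Y q] by (metis C_def mult.assoc mult_zero_right)
    ultimately show False using q(2) by (simp add: C_def)
  qed
  then have "(\<Sum>k\<in>K. P k) = 1" by (simp add: Q_def)
  then show thesis using that[OF K _ YP[unfolded c_def] orth PP comm] by blast
qed

section \<open>Logarithms in the bicommutant\<close>

text \<open>The parabolas t + i s t (1 - t) share the endpoints 0 and 1. Any other point b lies on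
  at most one of them, the one with s = Im b / (Re b (1 - Re b)), so only finitely many s are
  excluded.\<close>

lemma path_avoiding_finite:
  assumes "finite (S :: complex set)" "0 \<notin> S" "1 \<notin> S"
  obtains s :: real where "\<And>t. t \<in> {0..1} \<Longrightarrow> complex_of_real t + \<i> * of_real (s * (t * (1 - t))) \<notin> S"
proof -
  have "finite ((\<lambda>b. Im b / (Re b * (1 - Re b))) ` S)" using assms(1) by simp
  then obtain s :: real where s: "s \<notin> (\<lambda>b. Im b / (Re b * (1 - Re b))) ` S"
    using ex_new_if_finite[OF infinite_UNIV_char_0] by blast
  show thesis
  proof (rule that[of s])
    fix t :: real assume t: "t \<in> {0..1}"
    show "complex_of_real t + \<i> * of_real (s * (t * (1 - t))) \<notin> S"
    proof
      assume b: "complex_of_real t + \<i> * of_real (s * (t * (1 - t))) \<in> S"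
      then have "t \<noteq> 0" "t \<noteq> 1" using assms by auto
      then have "t * (1 - t) \<noteq> 0" by simp
      then have "s = s * (t * (1 - t)) / (t * (1 - t))" by simp
      then have "s \<in> (\<lambda>b. Im b / (Re b * (1 - Re b))) ` S"
        by (intro image_eqI[OF _ b]) simp
      with s show False ..
    qed
  qed
qed

text \<open>The matrices 1 + z (B - 1) lead from 1 to B as z goes from 0 to 1. For z other than 0
  and 1 such a matrix can be singular only if - 1/z is a root of a polynomial annihilating B - 1,
  and a path in the complex plane can go around these finitely many z. All matrices on it are affine
  in B, so whatever commutes with B commutes with the integrand and with its integral.\<close>

lemma matrix_log_exists:
  fixes B B' :: "'n::finite sqmat"
  assumes B: "B' * B = 1" "B * B' = 1"
  obtains L where "exp L = B" "\<And>D. D * B = B * D \<Longrightarrow> D * L = L * D"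
proof -
  define C where "C = B - 1"
  obtain p where p: "p \<noteq> 0" "peval p C = 0" by (rule annihilating_poly_exists)
  \<comment> \<open>At 0 and 1 the path is at 1 and at B, both invertible, so these two values are
    removed; 0 may appear because \<open>inverse 0 = 0\<close>.\<close>
  define S where "S = (\<lambda>a. - inverse a) ` {a. poly p a = 0} - {0, 1}"
  have "finite S" unfolding S_def using poly_roots_finite[OF p(1)] by simp
  then obtain s where s: "\<And>t. t \<in> {0..1} \<Longrightarrow> complex_of_real t + \<i> * of_real (s * (t * (1 - t))) \<notin> S"
    using path_avoiding_finite[of S] unfolding S_def by blast
  define g where "g t = complex_of_real t + \<i> * of_real (s * (t * (1 - t)))" for t
  define g' where "g' t = 1 + \<i> * of_real (s * (1 - 2 * t))" for t
  define X where "X t = 1 + scal (g t) * C" for t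
  define X' where "X' t = scal (g' t) * C" for t
  have "\<exists>W. W * X t = 1 \<and> X t * W = 1" if t: "t \<in> {0..1}" for t
  proof -
    consider "g t = 0" | "g t = 1" | "g t \<noteq> 0" "g t \<noteq> 1" by blast
    then show ?thesis
    proof cases
      case 1
      then show ?thesis by (auto simp: X_def)
    next
      case 2
      then show ?thesis using B by (auto simp: X_def C_def)
    next
      case 3
      have "poly p (- inverse (g t)) \<noteq> 0"
      proof
        assume "poly p (- inverse (g t)) = 0"
        then have "g t \<in> S" using 3 unfolding S_def by (intro DiffI image_eqI[of _ _ "- inverse (g t)"]) auto
        with s[OF t] show False by (simp add: g_def)
      qed
      then obtain W where W: "W * (C - scal (- inverse (g t))) = 1" "(C - scal (- inverse (g t))) * W = 1"
        using inverse_of_nonroot[OF p(2)] by blast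
      have X: "X t = scal (g t) * (C - scal (- inverse (g t)))"
        using 3 by (simp add: X_def algebra_simps scal_minus scal_mult[symmetric])
      have "(W * scal (inverse (g t))) * X t = 1" "X t * (W * scal (inverse (g t))) = 1"
      proof -
        have i: "scal (inverse (g t)) * scal (g t) = (1 :: 'n sqmat)"
          using 3 by (simp add: scal_mult[symmetric])
        have "(W * scal (inverse (g t))) * X t = W * (scal (inverse (g t)) * scal (g t)) * (C - scal (- inverse (g t)))"
          by (simp add: X mult.assoc)
        then show "(W * scal (inverse (g t))) * X t = 1" using W i by simp
        have "X t * (W * scal (inverse (g t))) = scal (g t) * ((C - scal (- inverse (g t))) * W) * scal (inverse (g t))"
          by (simp add: X mult.assoc)
        then show "X t * (W * scal (inverse (g t))) = 1"
          using W(2) 3(1) by (simp add: scal_mult[symmetric])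
      qed
      then show ?thesis by blast
    qed
  qed
  then obtain W where W: "\<And>t. t \<in> {0..1} \<Longrightarrow> W t * X t = 1" "\<And>t. t \<in> {0..1} \<Longrightarrow> X t * W t = 1"
    by metis
  have g: "(g has_vector_derivative g' t) (at t within T)" for t T
    unfolding g_def[abs_def] g'_def
    by (auto intro!: derivative_eq_intros simp: algebra_simps)
  have X: "(X has_vector_derivative X' t) (at t within {0..1})" for t
    unfolding X_def[abs_def] X'_def
    using has_vector_derivative_add[OF has_vector_derivative_const has_vector_derivative_mult_left[OF
        bounded_linear.has_vector_derivative[OF bounded_linear_scal g]]] by simp
  have commX: "D * X t = X t * D" "D * X' t = X' t * D" if "D * B = B * D" for D t
  proof -
    have "D * C = C * D" using that by (simp add: C_def algebra_simps)
    then have "D * (scal z * C) = scal z * C * D" for z by (metis mult.assoc scal_commute)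
    then show "D * X t = X t * D" "D * X' t = X' t * D" by (simp_all add: X_def X'_def algebra_simps)
  qed
  have commW: "D * W t = W t * D" if "D * B = B * D" "t \<in> {0..1}" for D t
    using commX(1)[OF that(1), of t] W[OF that(2)] by (metis mult.assoc mult.left_neutral mult.right_neutral)
  have commf: "D * (W t * X' t) = W t * X' t * D" if "D * B = B * D" "t \<in> {0..1}" for D t
    using commX(2)[OF that(1), of t] commW[OF that] by (metis mult.assoc)
  have comm1: "B * (W t * X' t) = W t * X' t * B" if "t \<in> {0..1}" for t
    by (rule commf[OF refl that])
  have ff: "(W s * X' s) * (W t * X' t) = (W t * X' t) * (W s * X' s)"
    if "s \<in> {0..1}" "t \<in> {0..1}" for s t
    by (rule commf[OF comm1[OF that(1), symmetric] that(2)])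
  have fX: "(W s * X' s) * X t = X t * (W s * X' s)" if "s \<in> {0..1}" for s t
    by (rule commX(1)[OF comm1[OF that, symmetric]])
  have contX': "continuous_on {0..1} X'"
    unfolding X'_def[abs_def] g'_def[abs_def]
    by (intro continuous_intros bounded_linear.continuous_on[OF bounded_linear_scal])
  have "X 0 = 1" by (simp add: X_def g_def)
  from log_along_path[OF X contX' this W ff fX]
  obtain L where L: "exp L = X 1"
    "\<And>D. (\<And>s. s \<in> {0..1} \<Longrightarrow> D * (W s * X' s) = (W s * X' s) * D) \<Longrightarrow> D * L = L * D"
    by metis
  have "exp L = B" using L(1) by (simp add: X_def g_def C_def)
  then show thesis using that L(2) commf by blast
qed

subsection \<open>Consequences for the matrix exponential\<close>

lemma to_sq_mult: "to_sq (A ** B) = to_sq A * to_sq B"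
  and to_sq_add: "to_sq (A + B) = to_sq A + to_sq B"
  and to_sq_minus: "to_sq (- A) = - to_sq A"
  and to_sq_1: "to_sq (mat 1) = 1"
  by (simp_all add: mat_of_inject[symmetric] times_sqmat.rep_eq plus_sqmat.rep_eq
      uminus_sqmat.rep_eq one_sqmat.rep_eq to_sq_inverse)

lemma matrix_exp_intertwine:
  fixes X Y G :: "complex ^ 'n::finite ^ 'n"
  assumes "X ** G = G ** Y"
  shows "matrix_exp X ** G = G ** matrix_exp Y"
proof -
  have "exp (to_sq X) * to_sq G = to_sq G * exp (to_sq Y)"
    by (rule exp_intertwine) (metis assms to_sq_mult)
  then have "mat_of (exp (to_sq X) * to_sq G) = mat_of (to_sq G * exp (to_sq Y))" by simp
  then show ?thesis by (simp add: times_sqmat.rep_eq matrix_exp_eq to_sq_inverse)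
qed

lemma matrix_exp_add:
  assumes "X ** Y = Y ** X"
  shows "matrix_exp (X + Y) = matrix_exp X ** matrix_exp (Y :: complex ^ 'n::finite ^ 'n)"
  by (simp add: matrix_exp_eq to_sq_add times_sqmat.rep_eq[symmetric])
    (subst exp_add_commuting, metis assms to_sq_mult, rule refl)

lemma matrix_exp_mat: "matrix_exp (mat z :: complex ^ 'n::finite ^ 'n) = mat (exp z)"
  by (simp add: matrix_exp_eq scal_def[symmetric] exp_scal mat_of_scal)

lemma matrix_exp_minus: "matrix_exp (- X) ** matrix_exp (X :: complex ^ 'n::finite ^ 'n) = mat 1"
  using exp_minus_inverse[of "- to_sq X"]
  by (simp add: matrix_exp_eq to_sq_minus times_sqmat.rep_eq[symmetric] one_sqmat.rep_eq)

lemma invertible_matrix_exp: "invertible (matrix_exp (X :: complex ^ 'n::finite ^ 'n))"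
  unfolding invertible_def using matrix_exp_minus[of X] matrix_exp_minus[of "- X"] by auto

lemma matrix_log:
  fixes B :: "complex ^ 'n::finite ^ 'n"
  assumes "invertible B"
  obtains L where "matrix_exp L = B" "\<And>D. D ** B = B ** D \<Longrightarrow> D ** L = L ** D"
proof -
  obtain B' where "B' ** B = mat 1" "B ** B' = mat 1" using assms by (auto simp: invertible_def)
  then have "to_sq B' * to_sq B = 1" "to_sq B * to_sq B' = 1"
    by (simp_all add: to_sq_mult[symmetric] to_sq_1)
  then obtain L where L: "exp L = to_sq B" "\<And>D. D * to_sq B = to_sq B * D \<Longrightarrow> D * L = L * D"
    by (rule matrix_log_exists) blast
  show thesis
  proof (rule that[of "mat_of L"])
    show "matrix_exp (mat_of L) = B" by (simp add: matrix_exp_eq mat_of_inverse L(1) to_sq_inverse)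
    show "D ** mat_of L = mat_of L ** D" if "D ** B = B ** D" for D
    proof -
      have "to_sq D * L = L * to_sq D" by (rule L(2)) (metis that to_sq_mult)
      then have "mat_of (to_sq D * L) = mat_of (L * to_sq D)" by simp
      then show ?thesis by (simp add: times_sqmat.rep_eq to_sq_inverse)
    qed
  qed
qed

lemma matrix_exp_eq_one_decomposition:
  fixes Y :: "complex ^ 'n::finite ^ 'n"
  assumes "matrix_exp Y = mat 1"
  obtains K :: "int set" and P where "finite K" "(\<Sum>k\<in>K. P k) = mat 1"
    "\<And>k. Y ** P k = mat (2 * pi * \<i> * of_int k) ** P k"
    "\<And>k l. k \<noteq> l \<Longrightarrow> P k ** P l = 0"
    "\<And>k. P k ** P k = P k"
    "\<And>k D. D ** Y = Y ** D \<Longrightarrow> D ** P k = P k ** D"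
proof -
  have "exp (to_sq Y) = 1"
    using assms by (simp add: matrix_exp_eq mat_of_inject[symmetric] one_sqmat.rep_eq)
  from exp_eq_one_decomposition[OF this]
  obtain K P where K: "finite K" "(\<Sum>k\<in>K. P k) = 1"
    "\<And>k. to_sq Y * P k = scal (2 * pi * \<i> * of_int k) * P k"
    "\<And>k l. k \<noteq> l \<Longrightarrow> P k * P l = 0"
    "\<And>k. P k * P k = P k"
    "\<And>k D. D * to_sq Y = to_sq Y * D \<Longrightarrow> D * P k = P k * D"
    by metis
  show thesis
  proof (rule that[of K "\<lambda>k. mat_of (P k)"])
    show "(\<Sum>k\<in>K. mat_of (P k)) = mat 1"
      using arg_cong[OF K(2), of mat_of]
      by (simp add: linear_sum[OF bounded_linear.linear[OF bounded_linear_mat_of]] one_sqmat.rep_eq)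
    show "Y ** mat_of (P k) = mat (2 * pi * \<i> * of_int k) ** mat_of (P k)" for k
      using arg_cong[OF K(3), of mat_of k] by (simp add: times_sqmat.rep_eq to_sq_inverse mat_of_scal)
    show "mat_of (P k) ** mat_of (P l) = 0" if "k \<noteq> l" for k l
      using arg_cong[OF K(4)[OF that], of mat_of] by (simp add: times_sqmat.rep_eq zero_sqmat.rep_eq)
    show "mat_of (P k) ** mat_of (P k) = mat_of (P k)" for k
      using arg_cong[OF K(5), of mat_of k] by (simp add: times_sqmat.rep_eq)
    show "D ** mat_of (P k) = mat_of (P k) ** D" if "D ** Y = Y ** D" for D k
    proof -
      have "to_sq D * P k = P k * to_sq D" by (rule K(6)) (metis that to_sq_mult)
      from arg_cong[OF this, of mat_of] show ?thesis by (simp add: times_sqmat.rep_eq to_sq_inverse)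
    qed
  qed (rule K(1))
qed

section \<open>Laurent polynomials and invariant vector fields\<close>

abbreviation xpow :: "int ^ 'l \<Rightarrow> ('l::finite) laurent" where
  "xpow m \<equiv> Poly_Mapping.single m 1"

lemma lookup_const_mult: "Poly_Mapping.lookup (const c * f) m = c * Poly_Mapping.lookup f m"
  unfolding const_def
proof (induction f rule: poly_mapping_add_induct)
  case (add f k d)
  then show ?case
    by (simp add: distrib_left lookup_add mult_single) (simp add: lookup_single when_def)
qed simp

lemma const_0 [simp]: "const 0 = 0" and const_1 [simp]: "const 1 = 1"
  and const_add: "const (a + b) = const a + const b"
  and const_diff: "const (a - b) = const a - const b"
  and const_mult: "const (a * b) = const a * const b"
  by (simp_all add: const_def single_add single_diff mult_single)

lemma const_sum: "const (sum f A) = (\<Sum>x\<in>A. const (f x))"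
  by (induction A rule: infinite_finite_induct) (simp_all add: const_add)

lemma const_of_int: "const (of_int k) = of_int k"
  by (induction k rule: int_induct[of _ 0]) (simp_all add: const_add const_diff)

lemma const_eq_iff: "const a = const b \<longleftrightarrow> a = b"
  unfolding const_def by (metis lookup_single_eq)

lemma single_eq_const_mult: "Poly_Mapping.single m c = const c * xpow m"
  by (simp add: const_def mult_single)

lemma xpow_add: "xpow (m + n) = xpow m * xpow n"
  by (simp add: mult_single)

lemma xpow_minus [simp]: "xpow (- m) * xpow m = 1" "xpow m * xpow (- m) = 1"
  by (simp_all add: mult_single)

lemma additive_int_vec_eqI:
  fixes \<phi> \<psi> :: "int ^ 'l::finite \<Rightarrow> 'b::ab_group_add"
  assumes \<phi>: "\<And>m n. \<phi> (m + n) = \<phi> m + \<phi> n" and \<psi>: "\<And>m n. \<psi> (m + n) = \<psi> m + \<psi> n"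
    and axis: "\<And>i. \<phi> (axis i 1) = \<psi> (axis i 1)"
  shows "\<phi> m = \<psi> m"
proof -
  have zero: "\<phi> 0 = 0" "\<psi> 0 = 0" using \<phi>[of 0 0] \<psi>[of 0 0] by simp_all
  have minus: "\<phi> (- m) = - \<phi> m" "\<psi> (- m) = - \<psi> m" for m
    using \<phi>[of "- m" m] \<psi>[of "- m" m] zero by (simp_all add: eq_neg_iff_add_eq_0)
  have axk: "\<phi> (axis i k) = \<psi> (axis i k)" for i k
  proof (induction k rule: int_induct[of _ 0])
    case base
    have "axis i (0::int) = 0" by (simp add: vec_eq_iff axis_def)
    then show ?case by (simp only: zero)
  next
    case (step1 k)
    have "axis i (k + 1) = axis i k + axis i (1::int)" by (simp add: vec_eq_iff axis_def)
    then show ?case by (simp add: \<phi> \<psi> step1 axis)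
  next
    case (step2 k)
    have "axis i (k - 1) = axis i k + - axis i (1::int)" by (simp add: vec_eq_iff axis_def)
    then show ?case by (simp only: \<phi> \<psi> step2 axis minus)
  qed
  have "m = (\<Sum>i\<in>UNIV. axis i (m $ i))"
    by (simp add: vec_eq_iff axis_def if_distrib cong: if_cong)
  moreover have "\<phi> (\<Sum>i\<in>I. axis i (m $ i)) = \<psi> (\<Sum>i\<in>I. axis i (m $ i))" for I
    by (induction I rule: infinite_finite_induct) (simp_all add: zero \<phi> \<psi> axk)
  ultimately show ?thesis by metis
qed

lemma additive_int_vec_expand:
  fixes \<phi> :: "int ^ 'l::finite \<Rightarrow> 'b::ring_1"
  assumes "\<And>m n. \<phi> (m + n) = \<phi> m + \<phi> n"
  shows "\<phi> m = (\<Sum>i\<in>UNIV. of_int (m $ i) * \<phi> (axis i 1))"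
  by (rule additive_int_vec_eqI[of \<phi>])
    (simp_all add: assms distrib_right sum.distrib axis_def if_distrib if_distribR cong: if_cong)

section \<open>Invariant vector fields as diagonal operators on monomials\<close>

text \<open>For additive w this is the field \<Sum> w(axis i 1) x_i d/dx_i; \<open>Lie_T\<close>
  consists exactly of these operators.\<close>

definition log_deriv :: "(int ^ 'l \<Rightarrow> complex) \<Rightarrow> ('l::finite) laurent \<Rightarrow> 'l laurent" where
  "log_deriv w = Poly_Mapping.mapp (\<lambda>m c. w m * c)"

lemma lookup_log_deriv: "Poly_Mapping.lookup (log_deriv w f) m = w m * Poly_Mapping.lookup f m"
  by (simp add: log_deriv_def lookup_mapp when_def in_keys_iff)

lemma log_deriv_add: "log_deriv w (f + g) = log_deriv w f + log_deriv w g"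
  by (rule poly_mapping_eqI) (simp add: lookup_log_deriv lookup_add distrib_left)

lemma log_deriv_0 [simp]: "log_deriv w 0 = 0"
  using log_deriv_add[of w 0 0] by simp

lemma log_deriv_single: "log_deriv w (Poly_Mapping.single m c) = Poly_Mapping.single m (w m * c)"
  by (rule poly_mapping_eqI) (simp add: lookup_log_deriv lookup_single when_def)

lemma log_deriv_mult:
  assumes w: "\<And>m n. w (m + n) = w m + w n"
  shows "log_deriv w (f * g) = f * log_deriv w g + g * log_deriv w f"
proof (induction f rule: poly_mapping_add_induct)
  case (add f m c)
  have "log_deriv w (Poly_Mapping.single m c * g) =
      Poly_Mapping.single m c * log_deriv w g + g * log_deriv w (Poly_Mapping.single m c)"
  proof (induction g rule: poly_mapping_add_induct)
    case (add g m' c')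
    have "log_deriv w (Poly_Mapping.single m c * Poly_Mapping.single m' c') =
        Poly_Mapping.single m c * log_deriv w (Poly_Mapping.single m' c') +
        Poly_Mapping.single m' c' * log_deriv w (Poly_Mapping.single m c)"
      by (simp add: mult_single log_deriv_single w single_add[symmetric] add.commute algebra_simps)
    then show ?case by (simp only: add log_deriv_add distrib_left distrib_right) (simp add: algebra_simps)
  qed simp
  then show ?case by (simp only: add log_deriv_add distrib_left distrib_right) (simp add: algebra_simps)
qed simp

lemma log_deriv_translate: "log_deriv w (translate a f) = translate a (log_deriv w f)"
  by (rule poly_mapping_eqI) (simp add: lookup_log_deriv lookup_translate)

lemma log_deriv_in_Lie_T:
  assumes "\<And>m n. w (m + n) = w m + w n"
  shows "log_deriv w \<in> Lie_T"
proof -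
  have "log_deriv w (const c * f) = const c * log_deriv w f" for c f
    by (rule poly_mapping_eqI) (simp add: lookup_log_deriv lookup_const_mult)
  then show ?thesis
    by (auto simp: Lie_T_def Der_def derivation_def log_deriv_add log_deriv_mult[OF assms]
        fun_eq_iff log_deriv_translate)
qed

lemma prod_powi_two:
  "(\<Prod>i\<in>UNIV. ((\<chi> i. if i = j then 2 else 1) :: complex ^ 'l) $ i powi (m $ i)) = 2 powi (m $ j)"
proof -
  have "(\<Prod>i\<in>UNIV. ((\<chi> i. if i = j then 2 else 1) :: complex ^ 'l) $ i powi (m $ i)) =
      (\<Prod>i\<in>UNIV. if i = j then 2 powi (m $ j) else 1)"
    by (intro prod.cong) auto
  then show ?thesis by simp
qed

lemma two_powi_inject: "(2::complex) powi k = 2 powi l \<longleftrightarrow> k = l"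
proof
  assume "(2::complex) powi k = 2 powi l"
  then have "norm ((2::complex) powi k) = norm ((2::complex) powi l)" by simp
  then have "(2::real) powi k = 2 powi l" by (simp add: norm_power_int)
  then show "k = l"
    by (metis linorder_neqE_linordered_idom order_less_irrefl power_int_strict_increasing one_less_numeral_iff semiring_norm(76))
qed simp

text \<open>An element \<open>a\<close> with one coordinate \<open>2\<close> and all others \<open>1\<close> separates the characters.\<close>

lemma characters_separated:
  assumes "\<And>a. a \<in> torus \<Longrightarrow>
    (\<Prod>j\<in>UNIV. (a $ j) powi (m $ j)) * c = (\<Prod>j\<in>UNIV. (a $ j) powi (n $ j)) * (c :: complex)"
    and "c \<noteq> 0"
  shows "m = n"
proof -
  have "m $ j = n $ j" for j
  proof -
    have "(\<chi> i. if i = j then 2 else 1) \<in> torus" by (simp add: torus_def)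
    from assms(1)[OF this] have "2 powi (m $ j) * c = 2 powi (n $ j) * c"
      by (simp only: prod_powi_two)
    then have "(2::complex) powi (m $ j) = 2 powi (n $ j)" using assms(2) by simp
    then show ?thesis by (simp only: two_powi_inject)
  qed
  then show ?thesis by (simp add: vec_eq_iff)
qed

text \<open>Commuting with all translations, v preserves their common eigenspaces, which are spanned
  by single monomials because characters are separated. The Leibniz rule makes the eigenvalue
  additive in the exponent.\<close>

lemma Lie_T_eq_log_deriv:
  assumes v: "v \<in> Lie_T"
  obtains w where "\<And>m n. w (m + n) = w m + w n" "v = log_deriv w"
proof -
  have vadd: "v (f + g) = v f + v g" and vconst: "v (const c * f) = const c * v f"
    and vmult: "v (f * g) = f * v g + g * v f" for f g c
    using v unfolding Lie_T_def Der_def derivation_def by blast+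
  have v0: "v 0 = 0" using vadd[of 0 0] by simp
  have vt: "v (translate a f) = translate a (v f)" if "a \<in> torus" for a f
    using v that by (auto simp: Lie_T_def fun_eq_iff)
  define w where "w m = Poly_Mapping.lookup (v (xpow m)) m" for m
  have vx: "v (xpow m) = Poly_Mapping.single m (w m)" for m
  proof (rule poly_mapping_eqI)
    fix q
    have "q = m" if "Poly_Mapping.lookup (v (xpow m)) q \<noteq> 0"
    proof (rule characters_separated[OF _ that])
      fix a :: "complex ^ 'a" assume a: "a \<in> torus"
      have "translate a (xpow m) = const (\<Prod>j\<in>UNIV. (a $ j) powi (m $ j)) * xpow m"
        by (simp only: translate_single mult_1_right single_eq_const_mult[symmetric])
      then have "translate a (v (xpow m)) = const (\<Prod>j\<in>UNIV. (a $ j) powi (m $ j)) * v (xpow m)"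
        using vt[OF a, of "xpow m"] by (simp only: vconst)
      then show "(\<Prod>j\<in>UNIV. (a $ j) powi (q $ j)) * Poly_Mapping.lookup (v (xpow m)) q =
          (\<Prod>j\<in>UNIV. (a $ j) powi (m $ j)) * Poly_Mapping.lookup (v (xpow m)) q"
        by (metis lookup_translate lookup_const_mult)
    qed
    then show "Poly_Mapping.lookup (v (xpow m)) q = Poly_Mapping.lookup (Poly_Mapping.single m (w m)) q"
      by (auto simp: lookup_single when_def w_def)
  qed
  have "w (m + n) = w m + w n" for m n
  proof -
    have "Poly_Mapping.single (m + n) (w (m + n)) = Poly_Mapping.single (m + n) (w m + w n)"
      using vmult[of "xpow m" "xpow n"] vx
      by (simp add: xpow_add[symmetric] mult_single single_add add.commute)
    then show ?thesis by (metis lookup_single_eq)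
  qed
  moreover have "v f = log_deriv w f" for f
  proof (induction f rule: poly_mapping_add_induct)
    case (add f m c)
    have "v (Poly_Mapping.single m c) = log_deriv w (Poly_Mapping.single m c)"
    proof -
      have "v (Poly_Mapping.single m c) = const c * Poly_Mapping.single m (w m)"
        unfolding single_eq_const_mult[of m c] vconst vx ..
      then show ?thesis by (simp add: log_deriv_single const_def mult_single mult.commute)
    qed
    then show ?case by (simp only: vadd log_deriv_add add)
  qed (simp add: v0)
  ultimately show thesis using that by blast
qed

lemma log_deriv_inject: "log_deriv w = log_deriv w' \<longleftrightarrow> w = w'"
proof
  assume "log_deriv w = log_deriv w'"
  then have "w m = w' m" for m
    using lookup_log_deriv[of w "xpow m" m] lookup_log_deriv[of w' "xpow m" m] by simp
  then show "w = w'" by (simp add: fun_eq_iff)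
qed simp

lemma lincomb_log_deriv: "lincomb c (\<lambda>j. log_deriv (w j)) = log_deriv (\<lambda>m. \<Sum>j\<in>UNIV. c j * w j m)"
  unfolding lincomb_def fun_eq_iff
  by (intro allI poly_mapping_eqI)
    (simp add: lookup_sum lookup_const_mult lookup_log_deriv sum_distrib_right mult.assoc)

lemma exp_T_log_deriv: "exp_T (log_deriv w) = (\<chi> j. exp (w (axis j 1)))"
proof -
  have "eval_at_1 (Poly_Mapping.single m c) = c" for m :: "int ^ 'a" and c
    by (simp add: eval_at_1_def)
  then show ?thesis by (simp add: exp_T_def coord_def log_deriv_single)
qed

text \<open>The field x_i d/dx_i. These fields serve as a frame that does not depend on the choice
  of e.\<close>

definition euler :: "'l \<Rightarrow> ('l::finite) laurent \<Rightarrow> 'l laurent" where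
  "euler i = log_deriv (\<lambda>m. of_int (m $ i))"

lemma euler_in_Lie_T: "euler i \<in> Lie_T"
  unfolding euler_def by (rule log_deriv_in_Lie_T) simp

lemma euler_single: "euler i (Poly_Mapping.single m c) = of_int (m $ i) * (const c * xpow m)"
proof -
  have "euler i (Poly_Mapping.single m c) = Poly_Mapping.single m (of_int (m $ i) * c)"
    by (simp add: euler_def log_deriv_single)
  also have "\<dots> = const (of_int (m $ i) * c) * xpow m" by (rule single_eq_const_mult)
  finally show ?thesis by (simp only: const_mult const_of_int mult.assoc)
qed

text \<open>The logarithmic derivative x^(-m) v(x^m) is additive in m by the Leibniz rule, so its
  values at the coordinates determine it.\<close>

lemma derivation_eq_euler:
  assumes "derivation v"
  shows "v f = (\<Sum>i\<in>UNIV. xpow (- axis i 1) * v (coord i) * euler i f)"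
proof -
  have vadd: "v (f + g) = v f + v g" and vconst: "v (const c * f) = const c * v f"
    and vmult: "v (f * g) = f * v g + g * v f" for f g c
    using assms unfolding derivation_def by blast+
  have v0: "v 0 = 0" using vadd[of 0 0] by simp
  define D where "D m = xpow (- m) * v (xpow m)" for m
  have D: "D (m + n) = D m + D n" for m n
  proof -
    have "D (m + n) = xpow (- m) * xpow (- n) * (xpow m * v (xpow n) + xpow n * v (xpow m))"
      by (simp add: D_def xpow_add vmult del: mult_single) (simp add: mult_single)
    also have "\<dots> = (xpow (- m) * xpow m) * (xpow (- n) * v (xpow n)) + (xpow (- n) * xpow n) * (xpow (- m) * v (xpow m))"
      by (simp only: algebra_simps)
    finally show ?thesis by (simp add: D_def)
  qed
  have vx: "v (xpow m) = xpow m * D m" for m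
    by (simp add: D_def mult.assoc[symmetric])
  show ?thesis
  proof (induction f rule: poly_mapping_add_induct)
    case zero
    show ?case by (simp add: v0 euler_def)
  next
    case (add f m c)
    have "v (Poly_Mapping.single m c) = const c * (xpow m * (\<Sum>i\<in>UNIV. of_int (m $ i) * D (axis i 1)))"
      by (subst single_eq_const_mult) (simp only: vconst vx additive_int_vec_expand[of D, OF D, of m])
    also have "\<dots> = (\<Sum>i\<in>UNIV. D (axis i 1) * euler i (Poly_Mapping.single m c))"
      unfolding sum_distrib_left euler_single
      by (intro sum.cong refl) (simp only: mult_ac)
    finally show ?case
      by (simp add: vadd add euler_def log_deriv_add distrib_left sum.distrib D_def coord_def)
  qed
qed

section \<open>Integer weights of a lattice basis\<close>

locale lattice_frame =
  fixes e :: "'l \<Rightarrow> ('l::finite) laurent \<Rightarrow> 'l laurent"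
  assumes lattice_basis: "lattice_basis e"
begin

lemma e_Lie_T: "e j \<in> Lie_T"
  using lattice_basis by (simp add: lattice_basis_def basis_Lie_T_def)

lemma e_derivation: "derivation (e j)"
  using e_Lie_T[of j] by (simp add: Lie_T_def Der_def)

lemma Lie_T_coords:
  assumes "v \<in> Lie_T"
  shows "\<exists>!c. v = lincomb c e"
  using lattice_basis assms by (simp add: lattice_basis_def basis_Lie_T_def)

lemma exp_T_kernel_iff:
  "v \<in> Lie_T \<and> exp_T v = 1 \<longleftrightarrow> (\<exists>k :: 'l \<Rightarrow> int. v = lincomb (\<lambda>j. of_int (k j)) e)"
proof -
  have "{v \<in> Lie_T. exp_T v = 1} = {lincomb (\<lambda>j. of_int (k j)) e | k. True}"
    using lattice_basis by (simp only: lattice_basis_def)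
  then have "(v \<in> {v \<in> Lie_T. exp_T v = 1}) = (v \<in> {lincomb (\<lambda>j. of_int (k j)) e | k. True})"
    by (rule arg_cong)
  then show ?thesis by simp
qed

definition is_weight :: "'l \<Rightarrow> (int ^ 'l \<Rightarrow> int) \<Rightarrow> bool" where
  "is_weight j N \<longleftrightarrow> (\<forall>m n. N (m + n) = N m + N n) \<and> e j = log_deriv (\<lambda>m. 2 * pi * \<i> * of_int (N m))"

text \<open>The vector e_j belongs to the lattice it helps to generate, so its exponential in T is
  trivial, and this says that its eigenvalues on the coordinates lie in 2 pi i Z.\<close>

lemma exists_weight: "\<exists>N. is_weight j N"
proof -
  obtain w where w: "\<And>m n. w (m + n) = w m + w n" "e j = log_deriv w"
    by (rule Lie_T_eq_log_deriv[OF e_Lie_T[of j]]) blast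
  have "e j = lincomb (\<lambda>i. of_int (if i = j then 1 else 0)) e"
    by (simp add: lincomb_def fun_eq_iff if_distrib if_distribR cong: if_cong)
  then have "exp_T (e j) = 1"
    using exp_T_kernel_iff[of "e j"] by metis
  then have "exp (w (axis i 1)) = 1" for i
    by (simp add: w(2) exp_T_log_deriv vec_eq_iff)
  then have "\<exists>k::int. w (axis i 1) = 2 * pi * \<i> * of_int k" for i
  proof -
    assume "\<And>i. exp (w (axis i 1)) = 1"
    then obtain k :: int where "Re (w (axis i 1)) = 0" "Im (w (axis i 1)) = of_int (2 * k) * pi"
      by (metis exp_eq_1)
    then have "w (axis i 1) = 2 * pi * \<i> * of_int k" by (simp add: complex_eq_iff)
    then show ?thesis ..
  qed
  then obtain k :: "'l \<Rightarrow> int" where k: "\<And>i. w (axis i 1) = 2 * pi * \<i> * of_int (k i)" by metis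
  have "w = (\<lambda>m. 2 * pi * \<i> * of_int (\<Sum>i\<in>UNIV. m $ i * k i))"
    by (rule ext, subst additive_int_vec_expand[of w, OF w(1)]) (simp add: k sum_distrib_left mult_ac)
  then have "e j = log_deriv (\<lambda>m. 2 * pi * \<i> * of_int (\<Sum>i\<in>UNIV. m $ i * k i))"
    using w(2) by simp
  then show ?thesis
    unfolding is_weight_def
    by (intro exI[of _ "\<lambda>m. \<Sum>i\<in>UNIV. m $ i * k i"] conjI) (simp_all add: distrib_right sum.distrib)
qed

definition weight :: "'l \<Rightarrow> int ^ 'l \<Rightarrow> int" where
  "weight j = (SOME N. is_weight j N)"

lemma is_weight_weight: "is_weight j (weight j)"
  unfolding weight_def by (rule someI_ex[of "is_weight j"]) (rule exists_weight)

lemma weight_add: "weight j (m + n) = weight j m + weight j n"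
  and e_eq_log_deriv: "e j = log_deriv (\<lambda>m. 2 * pi * \<i> * of_int (weight j m))"
  using is_weight_weight[of j] unfolding is_weight_def by blast+

lemma weight_0 [simp]: "weight j 0 = 0"
  using weight_add[of j 0 0] by simp

lemma weight_minus [simp]: "weight j (- m) = - weight j m"
  using weight_add[of j "- m" m] by simp

abbreviation eig :: "'l \<Rightarrow> int ^ 'l \<Rightarrow> complex" where
  "eig j m \<equiv> 2 * pi * \<i> * of_int (weight j m)"

lemma lookup_e: "Poly_Mapping.lookup (e j f) m = eig j m * Poly_Mapping.lookup f m"
  by (simp add: e_eq_log_deriv lookup_log_deriv)

lemma e_single: "e j (Poly_Mapping.single m c) = Poly_Mapping.single m (eig j m * c)"
  by (simp add: e_eq_log_deriv log_deriv_single)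

lemma e_add: "e j (f + g) = e j f + e j g"
  by (rule poly_mapping_eqI) (simp only: lookup_e lookup_add distrib_left)

lemma e_0 [simp]: "e j 0 = 0"
  using e_add[of j 0 0] by simp

lemma e_sum: "e j (sum f A) = (\<Sum>x\<in>A. e j (f x))"
  by (induction A rule: infinite_finite_induct) (simp_all add: e_add)

lemma e_mult: "e j (f * g) = f * e j g + g * e j f"
  using e_derivation[of j] unfolding derivation_def by blast

lemma lincomb_e: "lincomb c e = log_deriv (\<lambda>m. \<Sum>j\<in>UNIV. c j * eig j m)"
proof -
  have "e = (\<lambda>j. log_deriv (\<lambda>m. eig j m))" by (rule ext) (rule e_eq_log_deriv)
  then have "lincomb c e = lincomb c (\<lambda>j. log_deriv (\<lambda>m. eig j m))" by (rule arg_cong)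
  then show ?thesis by (simp only: lincomb_log_deriv)
qed

text \<open>The fields \<open>2\<pi>i x\<^sub>i \<partial>/\<partial>x\<^sub>i\<close> lie in the lattice spanned by \<open>e\<close>; this inverts the integer matrix
  of weights.\<close>

lemma weight_surj:
  obtains m where "\<And>j. weight j m = \<kappa> j"
proof -
  define u where "u i = log_deriv (\<lambda>m. 2 * pi * \<i> * of_int (m $ i))" for i :: 'l
  have u: "u i \<in> Lie_T" for i
    unfolding u_def by (rule log_deriv_in_Lie_T) (simp add: distrib_left)
  have "exp_T (u i) = 1" for i
    by (auto simp: u_def exp_T_log_deriv vec_eq_iff axis_def)
  then have "\<exists>k. u i = lincomb (\<lambda>j. of_int (k j)) e" for i
    using u exp_T_kernel_iff[of "u i"] by metis
  then obtain k where k: "\<And>i. u i = lincomb (\<lambda>j. of_int (k i j)) e" by metis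
  have k': "m $ i = (\<Sum>j\<in>UNIV. k i j * weight j m)" for i m
  proof -
    have "log_deriv (\<lambda>m. 2 * pi * \<i> * of_int (m $ i)) =
        log_deriv (\<lambda>m. \<Sum>j\<in>UNIV. of_int (k i j) * (2 * pi * \<i> * of_int (weight j m)))"
      using k[of i] unfolding lincomb_e u_def .
    then have "2 * pi * \<i> * of_int (m $ i) = (\<Sum>j\<in>UNIV. of_int (k i j) * (2 * pi * \<i> * of_int (weight j m)))"
      unfolding log_deriv_inject by metis
    also have "\<dots> = 2 * pi * \<i> * of_int (\<Sum>j\<in>UNIV. k i j * weight j m)"
      by (simp add: sum_distrib_left mult_ac)
    finally show ?thesis by (simp only: mult_cancel_left of_int_eq_iff) auto
  qed
  \<comment> \<open>By \<open>k'\<close> the integer matrix k is a left inverse of the matrix of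
    weights. Uniqueness of coordinates with respect to e makes it a right inverse as well.\<close>
  have inv: "(\<Sum>i\<in>UNIV. weight j (axis i 1) * k i p) = (if j = p then 1 else 0)" for j p
  proof -
    have "e j = lincomb (\<lambda>p. of_int (\<Sum>i\<in>UNIV. weight j (axis i 1) * k i p)) e"
    proof -
      have "weight j m = (\<Sum>p\<in>UNIV. (\<Sum>i\<in>UNIV. weight j (axis i 1) * k i p) * weight p m)" for m
      proof -
        have "weight j m = (\<Sum>i\<in>UNIV. m $ i * weight j (axis i 1))"
          using additive_int_vec_expand[of "weight j" m] weight_add by simp
        also have "\<dots> = (\<Sum>i\<in>UNIV. (\<Sum>p\<in>UNIV. k i p * weight p m) * weight j (axis i 1))"
          using k'[of m] by simp
        also have "\<dots> = (\<Sum>p\<in>UNIV. (\<Sum>i\<in>UNIV. weight j (axis i 1) * k i p) * weight p m)"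
          unfolding sum_distrib_right by (subst sum.swap) (simp add: mult_ac)
        finally show ?thesis .
      qed
      then have "eig j m = (\<Sum>p\<in>UNIV. of_int (\<Sum>i\<in>UNIV. weight j (axis i 1) * k i p) * eig p m)" for m
      proof -
        assume "\<And>m. weight j m = (\<Sum>p\<in>UNIV. (\<Sum>i\<in>UNIV. weight j (axis i 1) * k i p) * weight p m)"
        from this[of m] have "eig j m = 2 * pi * \<i> * of_int (\<Sum>p\<in>UNIV. (\<Sum>i\<in>UNIV. weight j (axis i 1) * k i p) * weight p m)"
          by simp
        then show ?thesis by (simp only: of_int_sum of_int_mult sum_distrib_left mult_ac)
      qed
      then show ?thesis
        unfolding lincomb_e by (simp only: e_eq_log_deriv[of j])
    qed
    moreover have "e j = lincomb (\<lambda>p. of_int (if j = p then 1 else 0)) e"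
      by (simp add: lincomb_def fun_eq_iff if_distrib if_distribR cong: if_cong)
    ultimately have "(\<lambda>p. of_int (\<Sum>i\<in>UNIV. weight j (axis i 1) * k i p) :: complex) =
        (\<lambda>p. of_int (if j = p then 1 else 0))"
      using Lie_T_coords[OF e_Lie_T[of j]] by blast
    then show ?thesis unfolding fun_eq_iff of_int_eq_iff by blast
  qed
  show thesis
  proof (rule that)
    fix j
    \<comment> \<open>The preimage of \<kappa> under the weights is k applied to \<kappa>.\<close>
    let ?m = "\<chi> i. \<Sum>p\<in>UNIV. k i p * \<kappa> p"
    have "weight j ?m = (\<Sum>i\<in>UNIV. (\<Sum>p\<in>UNIV. k i p * \<kappa> p) * weight j (axis i 1))"
      using additive_int_vec_expand[of "weight j" ?m] weight_add by simp
    also have "\<dots> = (\<Sum>p\<in>UNIV. (\<Sum>i\<in>UNIV. weight j (axis i 1) * k i p) * \<kappa> p)"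
      unfolding sum_distrib_right by (subst sum.swap) (simp add: mult_ac)
    also have "\<dots> = \<kappa> j" by (simp add: inv if_distrib if_distribR cong: if_cong)
    finally show "weight j ?m = \<kappa> j" .
  qed
qed

lemma euler_eq_lincomb: "\<exists>c. \<forall>i. euler i = lincomb (c i) e"
  using Lie_T_coords[OF euler_in_Lie_T] by metis

lemma derivation_eq_e:
  assumes "derivation v"
  obtains g where "\<And>f. v f = (\<Sum>j\<in>UNIV. g j * e j f)"
proof -
  obtain c where c: "\<And>i. euler i = lincomb (c i) e" using euler_eq_lincomb by blast
  show thesis
  proof (rule that)
    fix f
    show "v f = (\<Sum>j\<in>UNIV. (\<Sum>i\<in>UNIV. xpow (- axis i 1) * v (coord i) * const (c i j)) * e j f)"
      unfolding derivation_eq_euler[OF assms, of f] c lincomb_def sum_distrib_left sum_distrib_right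
      by (subst sum.swap) (simp only: mult.assoc)
  qed
qed

end

section \<open>Invariant forms\<close>

lemma kform_induct [case_names zero add scale_dd]:
  assumes "P 0" "\<And>\<omega> \<eta>. P \<omega> \<Longrightarrow> P \<eta> \<Longrightarrow> P (\<omega> + \<eta>)" "\<And>f g. P (scale_kform f (dd g))"
  shows "P (\<omega> :: ('l::finite) kform)"
proof (induct \<omega>)
  fix x :: "'l laurent \<Rightarrow>\<^sub>0 'l laurent"
  show "P (abs_kform x)"
  proof (induction x rule: poly_mapping_add_induct)
    case zero
    show ?case using assms(1) by (simp add: zero_kform_def)
  next
    case (add x k c)
    have "abs_kform (Poly_Mapping.single k c) = scale_kform c (dd k)"
      by (simp add: dd_def scale_kform_abs)
    then have "P (abs_kform x + abs_kform (Poly_Mapping.single k c))"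
      using assms(2)[OF add] assms(3)[of c k] by simp
    then show ?case by (simp only: plus_kform.abs_eq)
  qed
qed

lemma contract_0 [simp]: "derivation v \<Longrightarrow> contract v 0 = 0"
  using contract_add[of v 0 0] by simp

lemma contract_scale: "derivation v \<Longrightarrow> contract v (scale_kform f \<omega>) = f * contract v \<omega>"
  by (induction \<omega> rule: kform_induct)
    (simp_all add: scale_kform_add_right contract_add distrib_left scale_kform_scale contract_scale_dd mult.assoc)

lemma contract_sum: "derivation v \<Longrightarrow> contract v (sum f A) = (\<Sum>x\<in>A. contract v (f x))"
  by (induction A rule: infinite_finite_induct) (simp_all add: contract_add)

lemma contract_combination:
  assumes "derivation v" "\<And>j. j \<in> A \<Longrightarrow> derivation (u j)" "\<And>f. v f = (\<Sum>j\<in>A. g j * u j f)"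
  shows "contract v \<omega> = (\<Sum>j\<in>A. g j * contract (u j) \<omega>)"
proof (induction \<omega> rule: kform_induct)
  case (scale_dd f h)
  have "contract v (scale_kform f (dd h)) = f * (\<Sum>j\<in>A. g j * u j h)"
    by (simp only: contract_scale_dd[OF assms(1)] assms(3)[of h])
  then show ?case using assms(2) by (simp add: contract_scale_dd sum_distrib_left mult_ac)
qed (use assms(1,2) in \<open>simp_all add: contract_add distrib_left sum.distrib\<close>)

lemma scale_kform_sum: "scale_kform f (sum \<omega> A) = (\<Sum>x\<in>A. scale_kform f (\<omega> x))"
  by (induction A rule: infinite_finite_induct) (simp_all add: scale_kform_add_right)

lemma translate_kform_0 [simp]: "a \<in> torus \<Longrightarrow> translate_kform a 0 = 0"
  using translate_kform_add[of a 0 0] by simp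

lemma translate_kform_scale:
  "a \<in> torus \<Longrightarrow> translate_kform a (scale_kform f \<omega>) = scale_kform (translate a f) (translate_kform a \<omega>)"
  by (induction \<omega> rule: kform_induct)
    (simp_all add: scale_kform_add_right translate_kform_add scale_kform_scale translate_kform_scale_dd
      translate_mult)

lemma translate_kform_sum:
  "a \<in> torus \<Longrightarrow> translate_kform a (sum f A) = (\<Sum>x\<in>A. translate_kform a (f x))"
  by (induction A rule: infinite_finite_induct) (simp_all add: translate_kform_add)

lemma Lie_T_derivation: "v \<in> Lie_T \<Longrightarrow> derivation v"
  by (simp add: Lie_T_def Der_def)

text \<open>Invariance of v lets translations pass through contraction; an invariant field and an
  invariant form thus pair to an invariant function.\<close>

lemma contract_translate:
  assumes "v \<in> Lie_T" "a \<in> torus"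
  shows "contract v (translate_kform a \<omega>) = translate a (contract v \<omega>)"
proof -
  have "v (translate a f) = translate a (v f)" for f
    using assms by (auto simp: Lie_T_def fun_eq_iff)
  then show ?thesis
    by (induction \<omega> rule: kform_induct)
      (use assms Lie_T_derivation[OF assms(1)] in \<open>simp_all add: translate_kform_add contract_add
        translate_add translate_kform_scale_dd contract_scale_dd translate_mult\<close>)
qed

text \<open>Translation by a multiplies the coefficient at m by the character a^m, and only the
  trivial character equals 1 on all of T.\<close>

lemma translate_invariant_imp_const:
  assumes "\<And>a. a \<in> torus \<Longrightarrow> translate a f = f"
  shows "f = const (Poly_Mapping.lookup f 0)"
proof (rule poly_mapping_eqI)
  fix m
  have "m = 0" if "Poly_Mapping.lookup f m \<noteq> 0"
  proof (rule characters_separated[OF _ that])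
    fix a :: "complex ^ 'a" assume "a \<in> torus"
    from assms[OF this] have "Poly_Mapping.lookup (translate a f) m = Poly_Mapping.lookup f m" by simp
    then show "(\<Prod>j\<in>UNIV. (a $ j) powi (m $ j)) * Poly_Mapping.lookup f m =
        (\<Prod>j\<in>UNIV. (a $ j) powi ((0::int ^ 'a) $ j)) * Poly_Mapping.lookup f m"
      by (simp add: lookup_translate)
  qed
  then show "Poly_Mapping.lookup f m = Poly_Mapping.lookup (const (Poly_Mapping.lookup f 0)) m"
    by (auto simp: const_def lookup_single when_def)
qed

text \<open>The logarithmic differential d(x^m) / x^m, which is additive in m.\<close>

definition dlog :: "int ^ 'l \<Rightarrow> ('l::finite) kform" where
  "dlog m = scale_kform (xpow (- m)) (dd (xpow m))"

lemma dlog_add: "dlog (m + n) = dlog m + dlog n"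
proof -
  have "dlog (m + n) = scale_kform (xpow (- m) * xpow (- n)) (scale_kform (xpow m) (dd (xpow n)) + scale_kform (xpow n) (dd (xpow m)))"
    unfolding dlog_def xpow_add dd_mult by (simp add: mult_single)
  also have "\<dots> = scale_kform ((xpow (- m) * xpow m) * xpow (- n)) (dd (xpow n)) +
      scale_kform ((xpow (- n) * xpow n) * xpow (- m)) (dd (xpow m))"
    by (simp only: scale_kform_add_right scale_kform_scale mult_ac)
  finally show ?thesis by (simp add: dlog_def add.commute)
qed

lemma dlog_expand: "dlog m = (\<Sum>i\<in>UNIV. scale_kform (of_int (m $ i)) (dlog (axis i 1)))"
  by (rule additive_int_vec_eqI[of dlog])
    (simp_all add: dlog_add scale_kform_add sum.distrib axis_def if_distrib if_distribR
      if_distrib[of "\<lambda>x. scale_kform x _"] if_distrib[of of_int] cong: if_cong)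

lemma dd_single: "dd (Poly_Mapping.single m c) = scale_kform (const c * xpow m) (dlog m)"
proof -
  have "dd (Poly_Mapping.single m c) = scale_kform (const c) (dd (xpow m))"
    by (subst single_eq_const_mult) (rule dd_const_mult)
  also have "\<dots> = scale_kform (const c * (xpow m * xpow (- m))) (dd (xpow m))" by simp
  also have "\<dots> = scale_kform (const c * xpow m) (dlog m)"
    by (simp only: dlog_def scale_kform_scale mult.assoc)
  finally show ?thesis .
qed

text \<open>Since d(x^m) = x^m \<Sum> m_i dx_i / x_i, the forms dx_i / x_i generate, and contraction
  with x_i d/dx_i reads off the coefficients. Equality in the quotient type thereby becomes equality
  of Laurent polynomials.\<close>

lemma kform_eq_dlog:
  "\<omega> = (\<Sum>i\<in>UNIV. scale_kform (contract (euler i) \<omega>) (dlog (axis i 1)))"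
proof (induction \<omega> rule: kform_induct)
  case zero
  show ?case by (simp add: Lie_T_derivation euler_in_Lie_T)
next
  case (add \<omega> \<eta>)
  then show ?case
    by (simp add: Lie_T_derivation euler_in_Lie_T contract_add scale_kform_add sum.distrib)
next
  case (scale_dd f g)
  have euler_add: "euler i (a + b) = euler i a + euler i b" for i and a b :: "'a laurent"
    by (simp add: euler_def log_deriv_add)
  have dd: "dd g = (\<Sum>i\<in>UNIV. scale_kform (euler i g) (dlog (axis i 1)))" for g :: "'a laurent"
  proof (induction g rule: poly_mapping_add_induct)
    case zero
    show ?case by (simp add: euler_def)
  next
    case (add g m c)
    have "dd (Poly_Mapping.single m c) = (\<Sum>i\<in>UNIV. scale_kform (euler i (Poly_Mapping.single m c)) (dlog (axis i 1)))"
      unfolding dd_single dlog_expand[of m] scale_kform_sum scale_kform_scale euler_single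
      by (simp only: mult_ac)
    then show ?case by (simp add: dd_add euler_add scale_kform_add sum.distrib add)
  qed
  show ?case
    by (subst dd)
      (simp add: contract_scale_dd Lie_T_derivation euler_in_Lie_T scale_kform_sum scale_kform_scale)
qed

section \<open>Pairing two-forms with two vector fields\<close>

text \<open>The determinant pairing. In the quotient \<open>kform2\<close> a nonvanishing statement
  needs a functional that respects the relations; this one extracts commutators from the flatness
  equation.\<close>

definition contract2 ::
  "(('l::finite) laurent \<Rightarrow> 'l laurent) \<Rightarrow> ('l laurent \<Rightarrow> 'l laurent) \<Rightarrow> 'l kform2 \<Rightarrow> 'l laurent" where
  "contract2 u v \<theta> = extend (\<lambda>f (\<omega>, \<eta>). f * (contract u \<omega> * contract v \<eta> - contract v \<omega> * contract u \<eta>))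
     (rep_kform2 \<theta>)"

lemma contract2_abs:
  assumes "derivation u" "derivation v"
  shows "contract2 u v (abs_kform2 x) =
    extend (\<lambda>f (\<omega>, \<eta>). f * (contract u \<omega> * contract v \<eta> - contract v \<omega> * contract u \<eta>)) x"
proof -
  define h where "h = (\<lambda>f (\<omega>, \<eta>). f * (contract u \<omega> * contract v \<eta> - contract v \<omega> * contract u \<eta>))"
  have h: "h f (\<omega>, \<eta>) = f * (contract u \<omega> * contract v \<eta> - contract v \<omega> * contract u \<eta>)" for f \<omega> \<eta>
    by (simp add: h_def)
  have add: "h (a + b) k = h a k + h b k" for a b k
    by (cases k) (simp add: h distrib_right)
  have single: "extend h (Poly_Mapping.single k c) = h c k" for k c
    by (cases k) (simp add: extend_single h)
  have "extend h (fsmul c s) = 0" if "s \<in> wedge_relations" for c s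
    using that unfolding wedge_relations_def
    by (elim UnE; safe; simp add: free.scale_right_diff_distrib extend_diff[of h, OF add] single h
        contract_add contract_scale assms; simp add: algebra_simps)
  then have "extend h (rep_kform2 (abs_kform2 x) - x) = 0"
    by (intro extend_span[of h, OF add _ rep_abs_kform2])
  then show ?thesis by (simp add: contract2_def h_def[symmetric] extend_diff[of h, OF add])
qed

lemma contract2_wedge:
  assumes "derivation u" "derivation v"
  shows "contract2 u v (wedge \<omega> \<eta>) = contract u \<omega> * contract v \<eta> - contract v \<omega> * contract u \<eta>"
  unfolding wedge_def contract2_abs[OF assms] by (subst extend_single) simp_all

lemma contract2_add:
  assumes "derivation u" "derivation v"
  shows "contract2 u v (\<theta> + \<theta>') = contract2 u v \<theta> + contract2 u v \<theta>'"
  by (induct \<theta>, induct \<theta>')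
    (auto simp add: plus_kform2.abs_eq contract2_abs[OF assms] distrib_right intro!: extend_add)

lemma contract2_0: "derivation u \<Longrightarrow> derivation v \<Longrightarrow> contract2 u v 0 = 0"
  using contract2_add[of u v 0 0] by simp

lemma contract2_sum:
  "derivation u \<Longrightarrow> derivation v \<Longrightarrow> contract2 u v (sum f A) = (\<Sum>x\<in>A. contract2 u v (f x))"
  by (induction A rule: infinite_finite_induct) (simp_all add: contract2_add contract2_0)

lemma wedge_sum_left: "wedge (sum f A) \<eta> = (\<Sum>x\<in>A. wedge (f x) \<eta>)"
  by (induction A rule: infinite_finite_induct) (simp_all add: wedge_add_left)

lemma wedge_sum_right: "wedge \<omega> (sum f A) = (\<Sum>x\<in>A. wedge \<omega> (f x))"
proof -
  have "wedge \<omega> 0 = 0" using wedge_add_right[of \<omega> 0 0] by simp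
  then show ?thesis
    by (induction A rule: infinite_finite_induct) (simp_all add: wedge_add_right)
qed

lemma scale_kform2_add: "scale_kform2 (f + g) \<theta> = scale_kform2 f \<theta> + scale_kform2 g \<theta>"
  by (induct \<theta>) (simp add: scale_kform2_abs plus_kform2.abs_eq free.scale_left_distrib)

lemma scale_kform2_scale: "scale_kform2 f (scale_kform2 g \<theta>) = scale_kform2 (f * g) \<theta>"
  by (induct \<theta>) (simp add: scale_kform2_abs)

lemma scale_kform2_0 [simp]: "scale_kform2 0 \<theta> = 0" "scale_kform2 f 0 = 0"
  using scale_kform2_add[of 0 0 \<theta>] scale_kform2_add_right[of f 0 0] by simp_all

lemma scale_kform2_sum_left: "scale_kform2 (sum f A) \<theta> = (\<Sum>x\<in>A. scale_kform2 (f x) \<theta>)"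
  by (induction A rule: infinite_finite_induct) (simp_all add: scale_kform2_add)

lemma dd1_0 [simp]: "dd1 0 = 0"
  using dd1_add[of 0 0] by simp

lemma dd1_sum: "dd1 (sum f A) = (\<Sum>x\<in>A. dd1 (f x))"
  by (induction A rule: infinite_finite_induct) (simp_all add: dd1_add)

lemma dd1_scale_const: "dd1 (scale_kform (const c) \<omega>) = scale_kform2 (const c) (dd1 \<omega>)"
  by (induction \<omega> rule: kform_induct)
    (simp_all add: scale_kform_add_right dd1_add scale_kform2_add_right scale_kform_scale dd1_scale_dd
      dd_const_mult wedge_scale_left)

text \<open>Up to a factor, d(x^(-m)) \<and> d(x^m) is the wedge of - \<open>dlog m\<close> with
  \<open>dlog m\<close>.\<close>

lemma dd1_dlog: "dd1 (dlog m) = 0"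
proof -
  have "0 = dlog (- m) + dlog m"
    by (simp add: dlog_add[symmetric]) (simp add: dlog_def dd_const[of 1, simplified])
  then have dlog: "dlog (- m) = - dlog m" by (simp add: eq_neg_iff_add_eq_0)
  have "dd1 (dlog m) = wedge (dd (xpow (- m))) (dd (xpow m))"
    by (simp add: dlog_def dd1_scale_dd)
  also have "\<dots> = scale_kform2 (xpow m * xpow (- m)) (wedge (dlog (- m)) (dlog m))"
    by (simp only: dd_single const_1 mult_1_left wedge_scale_left wedge_scale_right scale_kform2_scale)
  also have "\<dots> = scale_kform2 (xpow m * xpow (- m)) 0"
    unfolding dlog using wedge_swap[of "- dlog m" "dlog m"] wedge_add_left[of "- dlog m" "dlog m" "dlog m"] by simp
  finally show ?thesis by simp
qed

text \<open>The coefficients of an invariant form with respect to the closed forms dx_i / x_i are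
  invariant functions, hence constants.\<close>

lemma invariant_form_closed:
  assumes "invariant_form \<omega>"
  shows "dd1 \<omega> = 0"
proof -
  have "contract (euler i) \<omega> = const (Poly_Mapping.lookup (contract (euler i) \<omega>) 0)" for i
  proof (rule translate_invariant_imp_const)
    fix a :: "complex ^ 'a" assume a: "a \<in> torus"
    have "translate_kform a \<omega> = \<omega>" using assms a by (simp add: invariant_form_def)
    then show "translate a (contract (euler i) \<omega>) = contract (euler i) \<omega>"
      using contract_translate[OF euler_in_Lie_T[of i] a, of \<omega>] by simp
  qed
  then have "\<exists>c. contract (euler i) \<omega> = const c" for i by (rule exI)
  then obtain c where c: "\<And>i. contract (euler i) \<omega> = const (c i)" by metis
  then have "\<omega> = (\<Sum>i\<in>UNIV. scale_kform (const (c i)) (dlog (axis i 1)))"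
    using kform_eq_dlog[of \<omega>] by (simp only: c)
  then have "dd1 \<omega> = dd1 (\<Sum>i\<in>UNIV. scale_kform (const (c i)) (dlog (axis i 1)))" by simp
  then show ?thesis by (simp add: dd1_sum dd1_scale_const dd1_dlog)
qed

definition const_form ::
  "('l \<Rightarrow> 'l kform) \<Rightarrow> ('l \<Rightarrow> complex ^ 'n ^ 'n) \<Rightarrow> ('l::finite) kform ^ 'n ^ 'n" where
  "const_form e' A = (\<chi> i k. \<Sum>j\<in>UNIV. scale_kform (const (A j $ i $ k)) (e' j))"

lemma rep_form_eq: "rep_form e e' \<rho> = const_form e' (\<lambda>j. \<rho> (e j))"
  by (simp add: rep_form_def const_form_def)

locale dual_frame = lattice_frame e for e :: "'l \<Rightarrow> ('l::finite) laurent \<Rightarrow> 'l laurent" +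
  fixes e' :: "'l \<Rightarrow> 'l kform"
  assumes dual_basis: "dual_basis e e'"
begin

lemma contract_e': "contract (e i) (e' j) = (if i = j then 1 else 0)"
  and e'_invariant: "invariant_form (e' j)"
  using dual_basis by (simp_all add: dual_basis_def)

text \<open>The fields x_i d/dx_i are constant combinations of the e_j, so contractions with the e_j
  determine all coefficients.\<close>

lemma kform_eqI:
  assumes "\<And>j. contract (e j) \<omega> = contract (e j) \<eta>"
  shows "\<omega> = \<eta>"
proof -
  obtain c where c: "\<And>i. euler i = lincomb (c i) e" using euler_eq_lincomb by blast
  have "contract (euler i) \<omega> = (\<Sum>j\<in>UNIV. const (c i j) * contract (e j) \<omega>)" for i and \<omega> :: "'l kform"
    by (rule contract_combination[OF Lie_T_derivation[OF euler_in_Lie_T] e_derivation])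
      (simp add: c lincomb_def)
  then have "contract (euler i) \<omega> = contract (euler i) \<eta>" for i using assms by simp
  then show ?thesis using kform_eq_dlog[of \<omega>] kform_eq_dlog[of \<eta>] by simp
qed

lemma contract_combination_e':
  "contract (e i) (\<Sum>j\<in>UNIV. scale_kform (f j) (e' j)) = f i"
  by (simp add: contract_sum contract_scale e_derivation contract_e' if_distrib cong: if_cong)

lemma contract_const_form: "contract (e j) (const_form e' A $ i $ k) = const (A j $ i $ k)"
  by (simp add: const_form_def contract_combination_e')

lemma invariant_const_form: "invariant_matrix_form (const_form e' A)"
proof -
  have "translate_kform a (e' j) = e' j" if "a \<in> torus" for a j
    using e'_invariant that by (simp add: invariant_form_def)
  then show ?thesis
    by (simp add: invariant_matrix_form_def invariant_form_def const_form_def translate_kform_sum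
        translate_kform_scale)
qed

lemma invariant_matrix_formE:
  assumes "invariant_matrix_form \<alpha>"
  obtains A where "\<alpha> = const_form e' A"
proof -
  define c where "c i j k = Poly_Mapping.lookup (contract (e j) (\<alpha> $ i $ k)) 0" for i j k
  have c: "contract (e j) (\<alpha> $ i $ k) = const (c i j k)" for i j k
    unfolding c_def
  proof (rule translate_invariant_imp_const)
    fix a :: "complex ^ 'l" assume a: "a \<in> torus"
    have "translate_kform a (\<alpha> $ i $ k) = \<alpha> $ i $ k"
      using assms a by (simp add: invariant_matrix_form_def invariant_form_def)
    then show "translate a (contract (e j) (\<alpha> $ i $ k)) = contract (e j) (\<alpha> $ i $ k)"
      using contract_translate[OF e_Lie_T[of j] a, of "\<alpha> $ i $ k"] by simp
  qed
  have "\<alpha> = const_form e' (\<lambda>j. \<chi> i k. c i j k)"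
    unfolding vec_eq_iff by (intro allI kform_eqI) (simp add: contract_const_form c)
  then show thesis by (rule that)
qed

text \<open>The entries are closed, so flatness concerns the wedge square alone. Its value on e_p,
  e_q is A_p A_q - A_q A_p; conversely, coefficients symmetric in p and q cancel against the
  antisymmetric e^p \<and> e^q.\<close>

lemma flat_const_form_iff:
  "flat (const_form e' A) \<longleftrightarrow> (\<forall>p q. A p ** A q = A q ** A p)"
proof -
  have closed: "dd1 (const_form e' A $ i $ k) = 0" for i k
    using invariant_const_form[of A] by (auto simp: invariant_matrix_form_def intro: invariant_form_closed)
  have wedge: "(\<Sum>k\<in>UNIV. wedge (const_form e' A $ i $ k) (const_form e' A $ k $ j)) =
      (\<Sum>p\<in>UNIV. \<Sum>q\<in>UNIV. scale_kform2 (const ((A p ** A q) $ i $ j)) (wedge (e' p) (e' q)))" for i j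
  proof -
    have "(\<Sum>k\<in>UNIV. wedge (const_form e' A $ i $ k) (const_form e' A $ k $ j)) =
      (\<Sum>k\<in>UNIV. \<Sum>p\<in>UNIV. \<Sum>q\<in>UNIV. scale_kform2 (const (A p $ i $ k * A q $ k $ j)) (wedge (e' p) (e' q)))"
      unfolding const_form_def vec_lambda_beta wedge_sum_left
      unfolding wedge_sum_right wedge_scale_left wedge_scale_right scale_kform2_scale const_mult
      by (simp only: mult.commute)
    also have "\<dots> = (\<Sum>p\<in>UNIV. \<Sum>q\<in>UNIV. \<Sum>k\<in>UNIV. scale_kform2 (const (A p $ i $ k * A q $ k $ j)) (wedge (e' p) (e' q)))"
      by (subst sum.swap) (intro sum.cong refl sum.swap)
    finally show ?thesis
      by (simp add: matrix_matrix_mult_def const_sum scale_kform2_sum_left)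
  qed
  show ?thesis
  proof
    assume flat: "flat (const_form e' A)"
    show "\<forall>p q. A p ** A q = A q ** A p"
    proof (intro allI, unfold vec_eq_iff, intro allI)
      fix p q i j
      have "0 = contract2 (e p) (e q) (dd1 (const_form e' A $ i $ j) +
          (\<Sum>k\<in>UNIV. wedge (const_form e' A $ i $ k) (const_form e' A $ k $ j)))"
        using flat by (simp add: flat_def contract2_0 e_derivation)
      also have "\<dots> = (\<Sum>k\<in>UNIV. const (A p $ i $ k) * const (A q $ k $ j) - const (A q $ i $ k) * const (A p $ k $ j))"
        by (simp add: closed contract2_sum contract2_wedge e_derivation contract_const_form)
      also have "\<dots> = const ((A p ** A q) $ i $ j - (A q ** A p) $ i $ j)"
        by (simp add: matrix_matrix_mult_def const_sum const_diff const_mult sum_subtractf)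
      finally show "(A p ** A q) $ i $ j = (A q ** A p) $ i $ j"
        using const_eq_iff[of _ 0] by (metis const_0 eq_iff_diff_eq_0)
    qed
  next
    assume comm: "\<forall>p q. A p ** A q = A q ** A p"
    show "flat (const_form e' A)"
      unfolding flat_def
    proof (intro allI)
      fix i j
      let ?S = "\<Sum>k\<in>UNIV. wedge (const_form e' A $ i $ k) (const_form e' A $ k $ j)"
      let ?t = "\<lambda>p q. scale_kform2 (const ((A p ** A q) $ i $ j)) (wedge (e' p) (e' q))"
      have anti: "?t p q + ?t q p = 0" for p q
      proof -
        have "A q ** A p = A p ** A q" using comm by blast
        then have "?t p q + ?t q p = scale_kform2 (const ((A p ** A q) $ i $ j)) (wedge (e' p) (e' q) + wedge (e' q) (e' p))"
          by (simp only: scale_kform2_add_right)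
        then show ?thesis using wedge_swap[of "e' p" "e' q"] by simp
      qed
      have "?t p p = 0" for p by simp
      show "dd1 (const_form e' A $ i $ j) + ?S = 0"
      proof -
        have neg: "?t p q = - ?t q p" for p q using anti[of p q] by (simp only: eq_neg_iff_add_eq_0)
        \<comment> \<open>An injection into the naturals orders the indices, so that the terms at
          (p, q) and (q, p) can be matched; the diagonal terms vanish.\<close>
        obtain g :: "'l \<Rightarrow> nat" where g: "inj g"
          using finite_imp_inj_to_nat_seg[of "UNIV :: 'l set"] by auto
        have "?S = (\<Sum>p\<in>UNIV. \<Sum>q\<in>UNIV. ?t p q)" by (rule wedge)
        also have "\<dots> = (\<Sum>p\<in>UNIV. \<Sum>q\<in>UNIV. (if g p < g q then ?t p q else 0) + (if g q < g p then ?t p q else 0))"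
          using g by (intro sum.cong refl) (auto simp: inj_eq linorder_neq_iff not_less_iff_gr_or_eq)
        also have "\<dots> = (\<Sum>p\<in>UNIV. \<Sum>q\<in>UNIV. if g p < g q then ?t p q else 0) +
            (\<Sum>p\<in>UNIV. \<Sum>q\<in>UNIV. if g q < g p then ?t p q else 0)"
          by (simp only: sum.distrib)
        also have "(\<Sum>p\<in>UNIV. \<Sum>q\<in>UNIV. if g q < g p then ?t p q else 0) =
            (\<Sum>p\<in>UNIV. \<Sum>q\<in>UNIV. if g p < g q then ?t q p else 0)"
          by (rule sum.swap)
        also have "(\<Sum>p\<in>UNIV. \<Sum>q\<in>UNIV. if g p < g q then ?t p q else 0) + \<dots> =
            (\<Sum>p\<in>UNIV. \<Sum>q\<in>UNIV. if g p < g q then ?t p q + ?t q p else 0)"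
          by (simp only: sum.distrib[symmetric]) (intro sum.cong refl, simp)
        also have "\<dots> = 0" by (simp only: anti if_cancel sum.neutral_const)
        finally show ?thesis by (simp add: closed)
      qed
    qed
  qed
qed

end

section \<open>Construction of the D-modules\<close>

text \<open>Entrywise this is a complex polynomial with infinitely many roots.\<close>

lemma matrix_polynomial_vanishing:
  fixes C :: "nat \<Rightarrow> 'n::finite sqmat"
  assumes "\<And>\<kappa>::int. (\<Sum>k\<le>N. scal (2 * pi * \<i> * of_int \<kappa>) ^ k * C k) = 0" and "k \<le> N"
  shows "C k = 0"
proof -
  have "mat_of (C k) $ a $ b = 0" for a b
  proof -
    define p where "p = (\<Sum>k\<le>N. monom (mat_of (C k) $ a $ b) k)"
    have "poly p (2 * pi * \<i> * of_int \<kappa>) = 0" for \<kappa>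
    proof -
      have "mat_of (\<Sum>k\<le>N. scal (2 * pi * \<i> * of_int \<kappa>) ^ k * C k) =
          (\<Sum>k\<le>N. mat_of (scal ((2 * pi * \<i> * of_int \<kappa>) ^ k) * C k))"
        by (simp add: linear_sum[OF bounded_linear.linear[OF bounded_linear_mat_of]] scal_power)
      then have "(\<Sum>k\<le>N. mat_of (scal ((2 * pi * \<i> * of_int \<kappa>) ^ k) * C k)) $ a $ b = 0"
        using assms(1)[of \<kappa>] by (simp add: zero_sqmat.rep_eq)
      then show ?thesis
        by (simp add: p_def poly_sum poly_monom times_sqmat.rep_eq mat_of_scal mat_matrix_mult mult.commute)
    qed
    moreover have "infinite (range (\<lambda>\<kappa>::int. 2 * pi * \<i> * of_int \<kappa> :: complex))"
      by (subst finite_image_iff) (auto simp: inj_def infinite_UNIV_int)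
    ultimately have "p = 0"
      using poly_roots_finite[of p] by (meson finite_subset image_subsetI mem_Collect_eq)
    moreover have "coeff p k = mat_of (C k) $ a $ b"
      using assms(2) by (simp add: p_def coeff_sum)
    ultimately show ?thesis by simp
  qed
  then show ?thesis by (simp add: mat_of_inject[symmetric] vec_eq_iff zero_sqmat.rep_eq)
qed

lemma scal_shift_commute:
  assumes "A * B = B * A"
  shows "(scal a + A) * (scal b + B) = (scal b + B) * (scal a + A)"
proof -
  have "scal a * scal b = (scal b * scal a :: 'a sqmat)" "scal a * B = B * scal a" "scal b * A = A * scal b"
    by (rule scal_commute)+
  with assms show ?thesis by (simp add: distrib_left distrib_right add_ac)
qed

text \<open>A list of pairs (coefficient, word) represents a noncommutative polynomial.\<close>

definition word_eval :: "('l \<Rightarrow> 'n::finite sqmat) \<Rightarrow> (complex \<times> 'l list) list \<Rightarrow> 'n sqmat" where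
  "word_eval X L = (\<Sum>(c, s)\<leftarrow>L. scal c * prod_list (map X s))"

lemma prod_list_extract:
  fixes X :: "'l \<Rightarrow> 'a::monoid_mult"
  assumes "\<And>j. X i * X j = X j * X i"
  shows "prod_list (map X s) = X i ^ count_list s i * prod_list (map X (filter (\<lambda>j. j \<noteq> i) s))"
proof (induction s)
  case (Cons j s)
  have "X j * X i ^ k = X i ^ k * X j" for k
    using assms by (metis power_commuting_commutes)
  then show ?case
    by (simp add: Cons mult.assoc power_commutes) (simp add: mult.assoc[symmetric])
qed simp

text \<open>Powers of X i are collected on the left. The remaining words avoid i, so the
  coefficients do not change when X i is replaced by another value.\<close>

lemma word_eval_expand:
  fixes X :: "'l \<Rightarrow> 'n::finite sqmat"
  assumes comm: "\<And>j. X i * X j = X j * X i" and N: "\<And>c s. (c, s) \<in> set L \<Longrightarrow> length s \<le> N"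
  shows "word_eval X L = (\<Sum>k\<le>N. X i ^ k *
    word_eval X (map (\<lambda>(c, s). (c, filter (\<lambda>j. j \<noteq> i) s)) (filter (\<lambda>(c, s). count_list s i = k) L)))"
  using N
proof (induction L)
  case Nil
  show ?case by (simp add: word_eval_def)
next
  case (Cons p L)
  obtain c s where p: "p = (c, s)" by (cases p)
  let ?F = "\<lambda>k L. map (\<lambda>(c, s). (c, filter (\<lambda>j. j \<noteq> i) s)) (filter (\<lambda>(c, s). count_list s i = k) L)"
  let ?r = "scal c * prod_list (map X (filter (\<lambda>j. j \<noteq> i) s))"
  have count: "count_list s i \<le> N"
    using Cons.prems[of c s] count_le_length[of s i] by (simp add: p)
  have "word_eval X (p # L) = scal c * prod_list (map X s) + word_eval X L"
    by (simp add: word_eval_def p)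
  also have "scal c * prod_list (map X s) = X i ^ count_list s i * ?r"
    by (subst prod_list_extract[of X i, OF comm]) (metis mult.assoc scal_commute)
  also have "\<dots> = (\<Sum>k\<le>N. if k = count_list s i then X i ^ k * ?r else 0)"
    using count by simp
  also have "word_eval X L = (\<Sum>k\<le>N. X i ^ k * word_eval X (?F k L))"
    by (rule Cons.IH) (use Cons.prems in auto)
  finally have "word_eval X (p # L) = (\<Sum>k\<le>N. (if k = count_list s i then X i ^ k * ?r else 0) + X i ^ k * word_eval X (?F k L))"
    by (simp add: sum.distrib)
  also have "\<dots> = (\<Sum>k\<le>N. X i ^ k * word_eval X (?F k (p # L)))"
    by (intro sum.cong refl) (auto simp: word_eval_def p distrib_left)
  finally show ?case .
qed

lemma word_eval_cong:
  assumes "\<And>c s j. (c, s) \<in> set L \<Longrightarrow> j \<in> set s \<Longrightarrow> X j = Y j"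
  shows "word_eval X L = word_eval Y L"
proof -
  have "map X s = map Y s" if "(c, s) \<in> set L" for c s
    using assms[OF that] by simp
  then have "map (\<lambda>(c, s). scal c * prod_list (map X s)) L = map (\<lambda>(c, s). scal c * prod_list (map Y s)) L"
    by (intro map_cong refl) (metis (no_types, lifting) case_prod_unfold prod.collapse)
  then show ?thesis by (simp only: word_eval_def)
qed

lemma word_eval_scal:
  "word_eval (\<lambda>j. scal (z j)) L = (scal (\<Sum>(c, s)\<leftarrow>L. c * prod_list (map z s)) :: 'n::finite sqmat)"
proof (induction L)
  case (Cons p L)
  have "prod_list (map (\<lambda>j. scal (z j)) s) = (scal (prod_list (map z s)) :: 'n sqmat)" for s
    by (induction s) (simp_all add: scal_mult)
  with Cons show ?case by (cases p) (simp add: word_eval_def scal_add scal_mult)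
qed (simp add: word_eval_def)

text \<open>The scalar arguments are replaced by matrices one variable at a time.\<close>

lemma word_eval_vanishing:
  fixes X :: "'l::finite \<Rightarrow> 'n::finite sqmat"
  assumes "\<And>\<kappa> :: 'l \<Rightarrow> int. word_eval (\<lambda>j. scal (2 * pi * \<i> * of_int (\<kappa> j)) :: 'n sqmat) L = 0"
    and "\<And>i j. X i * X j = X j * X i"
  shows "word_eval X L = 0"
proof -
  \<comment> \<open>S holds the variables that may already be matrices; all others are still scalars
    in 2 pi i Z.\<close>
  have "finite S \<Longrightarrow> (\<And>i j. X i * X j = X j * X i) \<Longrightarrow>
      (\<And>j. j \<notin> S \<Longrightarrow> \<exists>\<kappa>::int. X j = scal (2 * pi * \<i> * of_int \<kappa>)) \<Longrightarrow> word_eval X L = 0"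
    for S and X :: "'l \<Rightarrow> 'n sqmat"
  proof (induction S arbitrary: X rule: finite_induct)
    case empty
    then obtain \<kappa> :: "'l \<Rightarrow> int" where "X = (\<lambda>j. scal (2 * pi * \<i> * of_int (\<kappa> j)))"
      by (metis (no_types) empty_iff ext)
    then show ?case using assms(1) by simp
  next
    case (insert i S)
    define N where "N = Max (insert 0 ((length \<circ> snd) ` set L))"
    have N: "length s \<le> N" if "(c, s) \<in> set L" for c s
      unfolding N_def using that by (intro Max_ge) force+
    define F where "F k = map (\<lambda>(c, s). (c, filter (\<lambda>j. j \<noteq> i) s)) (filter (\<lambda>(c, s). count_list s i = k) L)" for k
    \<comment> \<open>Replacing X i by 2 pi i \<kappa> puts the tuple under the induction
      hypothesis. The expansion in powers of this scalar vanishes for all integers \<kappa>, and its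
      coefficients do not involve X i.\<close>
    have "word_eval X (F k) = 0" if "k \<le> N" for k
    proof (rule matrix_polynomial_vanishing[OF _ that])
      fix \<kappa> :: int
      let ?Y = "X(i := scal (2 * pi * \<i> * of_int \<kappa>))"
      have comm: "?Y p * ?Y q = ?Y q * ?Y p" for p q
        using insert.prems(1) by (simp add: scal_commute)
      have "word_eval ?Y L = 0"
        by (rule insert.IH[OF comm]) (use insert.prems(2) in auto)
      moreover have "word_eval ?Y L = (\<Sum>k\<le>N. ?Y i ^ k * word_eval ?Y (F k))"
        unfolding F_def by (rule word_eval_expand[of ?Y i, OF comm N])
      moreover have "word_eval ?Y (F k) = word_eval X (F k)" for k
        by (rule word_eval_cong) (auto simp: F_def)
      ultimately show "(\<Sum>k\<le>N. scal (2 * pi * \<i> * of_int \<kappa>) ^ k * word_eval X (F k)) = 0" by simp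
    qed
    moreover have "word_eval X L = (\<Sum>k\<le>N. X i ^ k * word_eval X (F k))"
      unfolding F_def by (rule word_eval_expand[of X i, OF insert.prems(1) N])
    ultimately show ?case by simp
  qed
  from this[of UNIV X] assms(2) show ?thesis by simp
qed

definition cmat :: "complex ^ 'n ^ 'n \<Rightarrow> ('l::finite) laurent ^ 'n ^ 'n" where
  "cmat B = (\<chi> i k. const (B $ i $ k))"

lemma cart_basis_expansion: "u = (\<Sum>j\<in>UNIV. u $ j *s axis j (1 :: 'a::comm_ring_1))"
  by (simp add: vec_eq_iff axis_def if_distrib cong: if_cong)

lemma matrix_vector_mult_smult: "g *v (f *s u) = f *s (g *v u)"
  for g :: "'a::comm_ring_1 ^ 'n ^ 'm"
  by (simp add: vec_eq_iff matrix_vector_mult_def sum_distrib_left mult_ac)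

lemma matrix_vector_mult_axis_nth: "(g *v axis k (1 :: 'a::comm_ring_1)) $ i = g $ i $ k"
  by (simp add: matrix_vector_mult_def axis_def if_distrib cong: if_cong)

definition xvec :: "int ^ 'l \<Rightarrow> complex ^ 'n \<Rightarrow> ('l::finite) laurent ^ 'n" where
  "xvec m w = (\<chi> i. Poly_Mapping.single m (w $ i))"

lemma vec_laurent_induct [case_names zero add]:
  assumes "P 0" "\<And>u m w. P u \<Longrightarrow> P (u + xvec m w)"
  shows "P (u :: ('l::finite) laurent ^ 'n)"
proof -
  have step: "P (u + axis i f)" if "P u" for u i f
    using that
  proof (induction f arbitrary: u rule: poly_mapping_add_induct)
    case zero
    have "axis i (0 :: 'l laurent) = 0" by (simp add: vec_eq_iff axis_def)
    with zero show ?case by (simp only: add_0_right)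
  next
    case (add f k c)
    have "axis i (f + Poly_Mapping.single k c) = axis i f + xvec k (axis i c)"
      by (simp add: vec_eq_iff axis_def xvec_def)
    then show ?case using assms(2)[OF add.IH[OF add.prems]] by (simp add: add.assoc)
  qed
  have "P (\<Sum>i\<in>I. axis i (u $ i))" for I
  proof (induction I rule: infinite_finite_induct)
    case (insert i I)
    then show ?case using step[of "\<Sum>i\<in>I. axis i (u $ i)" i "u $ i"] by (simp add: add.commute)
  qed (simp_all add: assms(1))
  moreover have "u = (\<Sum>i\<in>UNIV. axis i (u $ i))"
    by (simp add: vec_eq_iff axis_def if_distrib cong: if_cong)
  ultimately show ?thesis by metis
qed

section \<open>Connection operators and normal forms of differential operators\<close>

context lattice_frame
begin

definition nab :: "('l \<Rightarrow> complex ^ 'n ^ 'n) \<Rightarrow> 'l \<Rightarrow> 'l laurent ^ 'n \<Rightarrow> 'l laurent ^ 'n" where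
  "nab A j u = (\<chi> i. e j (u $ i)) + cmat (A j) *v u"

lemma nab_add: "nab A j (u + w) = nab A j u + nab A j w"
  by (simp add: nab_def vec_eq_iff e_add matrix_vector_right_distrib algebra_simps)

lemma nab_0 [simp]: "nab A j 0 = 0"
  using nab_add[of A j 0 0] by simp

lemma nab_smult: "nab A j (f *s u) = e j f *s u + f *s nab A j u"
  by (simp add: nab_def vec_eq_iff e_mult matrix_vector_mult_smult algebra_simps)

lemma nab_axis:
  fixes A :: "'l \<Rightarrow> complex ^ 'n::finite ^ 'n"
  shows "nab A p (axis j 1) = (\<Sum>i\<in>UNIV. const (A p $ i $ j) *s axis i 1)"
proof -
  have "e p 1 = 0" using e_mult[of p 1 1] by simp
  then have "e p ((axis j 1 :: 'l laurent ^ 'n) $ i) = 0" for i by (simp add: axis_def)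
  then have "nab A p (axis j 1) = (\<chi> i. const (A p $ i $ j))"
    by (simp add: nab_def vec_eq_iff matrix_vector_mult_axis_nth cmat_def)
  also have "\<dots> = (\<Sum>i\<in>UNIV. const (A p $ i $ j) *s axis i 1)"
    by (subst cart_basis_expansion) simp
  finally show ?thesis .
qed

text \<open>Differential operators are handled through normal forms \<open>\<Sum> g e\<^sub>s\<close> with words \<open>s\<close>, which are not unique;
  the same list of pairs \<open>(g, s)\<close> gives the action \<open>\<Sum> g \<nabla>\<^sub>s\<close> on the module.\<close>

definition word_op :: "('l laurent \<times> 'l list) list \<Rightarrow> 'l laurent \<Rightarrow> 'l laurent" where
  "word_op L f = (\<Sum>(g, s)\<leftarrow>L. g * foldr e s f)"

definition word_act ::
  "('l \<Rightarrow> complex ^ 'n ^ 'n) \<Rightarrow> ('l laurent \<times> 'l list) list \<Rightarrow> 'l laurent ^ 'n \<Rightarrow> 'l laurent ^ 'n" where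
  "word_act A L u = (\<Sum>(g, s)\<leftarrow>L. g *s foldr (nab A) s u)"

lemma word_op_Nil [simp]: "word_op [] f = 0" "word_act A [] u = 0"
  and word_op_Cons [simp]: "word_op ((g, s) # L) f = g * foldr e s f + word_op L f"
  and word_act_Cons [simp]: "word_act A ((g, s) # L) u = g *s foldr (nab A) s u + word_act A L u"
  by (simp_all add: word_op_def word_act_def)

lemma word_op_append: "word_op (L @ L') f = word_op L f + word_op L' f"
  and word_act_append: "word_act A (L @ L') u = word_act A L u + word_act A L' u"
  by (simp_all add: word_op_def word_act_def)

lemma foldr_nab_add: "foldr (nab A) s (u + w) = foldr (nab A) s u + foldr (nab A) s w"
  by (induction s) (simp_all add: nab_add)

lemma word_act_add: "word_act A L (u + w) = word_act A L u + word_act A L w"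
  by (induction L) (auto simp: foldr_nab_add vector_add_ldistrib algebra_simps)

definition mult_words :: "'l laurent \<Rightarrow> ('l laurent \<times> 'l list) list \<Rightarrow> ('l laurent \<times> 'l list) list" where
  "mult_words f L = map (\<lambda>(g, s). (f * g, s)) L"

lemma word_op_mult: "word_op (mult_words f L) h = f * word_op L h"
  by (induction L) (auto simp: mult_words_def algebra_simps)

lemma word_act_mult: "word_act A (mult_words f L) u = f *s word_act A L u"
  by (induction L) (auto simp: mult_words_def vector_add_ldistrib vector_smult_assoc)

text \<open>The Leibniz rule e_j g e_s = (e_j g) e_s + g e_j e_s. The operators
  \<open>nab A j\<close> satisfy the same rule, so one rewriting of lists serves both the operators
  and their action.\<close>

fun e_words :: "'l \<Rightarrow> ('l laurent \<times> 'l list) list \<Rightarrow> ('l laurent \<times> 'l list) list" where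
  "e_words j [] = []"
| "e_words j ((g, s) # L) = (e j g, s) # (g, j # s) # e_words j L"

lemma word_op_e: "word_op (e_words j L) f = e j (word_op L f)"
  by (induction L) (auto simp: e_add e_mult algebra_simps)

lemma word_act_e: "word_act A (e_words j L) u = nab A j (word_act A L u)"
  by (induction L) (auto simp: nab_add nab_smult algebra_simps)

fun comp_words :: "('l laurent \<times> 'l list) list \<Rightarrow> ('l laurent \<times> 'l list) list \<Rightarrow> ('l laurent \<times> 'l list) list" where
  "comp_words [] L' = []"
| "comp_words ((g, s) # L) L' = mult_words g (foldr e_words s L') @ comp_words L L'"

lemma word_op_comp: "word_op (comp_words L L') f = word_op L (word_op L' f)"
proof -
  have "word_op (foldr e_words s L') f = foldr e s (word_op L' f)" for s
    by (induction s) (simp_all add: word_op_e)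
  then show ?thesis by (induction L) (auto simp: word_op_append word_op_mult)
qed

lemma word_act_comp: "word_act A (comp_words L L') u = word_act A L (word_act A L' u)"
proof -
  have "word_act A (foldr e_words s L') u = foldr (nab A) s (word_act A L' u)" for s
    by (induction s) (simp_all add: word_act_e)
  then show ?thesis by (induction L) (auto simp: word_act_append word_act_mult)
qed

definition deriv_words :: "('l \<Rightarrow> 'l laurent) \<Rightarrow> ('l laurent \<times> 'l list) list" where
  "deriv_words g = map (\<lambda>p. (g p, [p])) (SOME ps. distinct ps \<and> set ps = UNIV)"

lemma word_op_deriv: "word_op (deriv_words g) f = (\<Sum>p\<in>UNIV. g p * e p f)"
  and word_act_deriv: "word_act A (deriv_words g) u = (\<Sum>p\<in>UNIV. g p *s nab A p u)"
proof -
  define ps where "ps = (SOME ps. distinct ps \<and> set ps = (UNIV :: 'l set))"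
  have "distinct ps \<and> set ps = UNIV"
    unfolding ps_def by (rule someI_ex) (metis finite_distinct_list finite_class.finite_UNIV)
  then show "word_op (deriv_words g) f = (\<Sum>p\<in>UNIV. g p * e p f)"
    "word_act A (deriv_words g) u = (\<Sum>p\<in>UNIV. g p *s nab A p u)"
    by (simp_all add: deriv_words_def ps_def[symmetric] word_op_def word_act_def o_def
        sum_list_distinct_conv_sum_set)
qed

lemma diff_op_eq_words:
  assumes "P \<in> diff_ops"
  shows "\<exists>L. P = word_op L"
  using assms
proof induction
  case (mult f)
  have "(*) f = word_op [(f, [])]" by (simp add: fun_eq_iff)
  then show ?case ..
next
  case (deriv v)
  then have "derivation v" by (simp add: Der_def)
  then obtain g where "\<And>f. v f = (\<Sum>p\<in>UNIV. g p * e p f)"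
    using derivation_eq_e by blast
  then have "v = word_op (deriv_words g)" by (simp add: fun_eq_iff word_op_deriv)
  then show ?case ..
next
  case (add P Q)
  then obtain L L' where "P = word_op L" "Q = word_op L'" by blast
  then have "(\<lambda>g. P g + Q g) = word_op (L @ L')" by (simp add: fun_eq_iff word_op_append)
  then show ?case ..
next
  case (comp P Q)
  then obtain L L' where "P = word_op L" "Q = word_op L'" by blast
  then have "P \<circ> Q = word_op (comp_words L L')" by (simp add: fun_eq_iff word_op_comp)
  then show ?case ..
qed

lemma foldr_e_xpow: "foldr e s (xpow m) = Poly_Mapping.single m (prod_list (map (\<lambda>j. eig j m) s))"
  by (induction s) (simp_all add: e_single)

text \<open>Each space x^m C^n is stable, because e_j only scales x^m; words in the connection
  operators become products of matrices there.\<close>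

lemma nab_xvec: "nab A j (xvec m w) = xvec m (mat_of (scal (eig j m) + to_sq (A j)) *v w)"
proof -
  have "(cmat (A j) *v xvec m w) $ i = Poly_Mapping.single m ((A j *v w) $ i)" for i
    unfolding matrix_vector_mult_def
    by (simp add: cmat_def xvec_def const_def mult_single) (rule poly_mapping_eqI, simp add: lookup_sum lookup_single when_def)
  moreover have "mat z *v w = z *s w" for z
    by (simp add: vec_eq_iff matrix_vector_mult_def mat_def if_distrib if_distribR cong: if_cong)
  ultimately show ?thesis
    by (simp add: nab_def vec_eq_iff plus_sqmat.rep_eq to_sq_inverse mat_of_scal
        matrix_vector_mult_add_rdistrib) (simp add: xvec_def e_single single_add)
qed

lemma foldr_nab_xvec:
  "foldr (nab A) s (xvec m w) = xvec m (mat_of (prod_list (map (\<lambda>j. scal (eig j m) + to_sq (A j)) s)) *v w)"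
  by (induction s) (simp_all add: one_sqmat.rep_eq nab_xvec times_sqmat.rep_eq matrix_vector_mul_assoc)

lemma lookup_mult_single:
  "Poly_Mapping.lookup (f * Poly_Mapping.single m c) (q + m) = Poly_Mapping.lookup f q * (c :: complex)"
  for m q :: "int ^ 'k"
proof (induction f rule: poly_mapping_add_induct)
  case (add f k d)
  then show ?case
    by (simp add: distrib_right lookup_add mult_single) (simp add: lookup_single when_def)
qed simp

text \<open>This is what makes the action well defined. On x^m the expression reduces to scalar
  polynomials evaluated at the weights of m; the weights take all integer values, so these
  polynomials vanish on 2 pi i Z^l and hence at the commuting matrices by which words act on x^m
  C^n.\<close>

lemma word_act_zero:
  assumes comm: "\<And>p q. A p ** A q = A q ** A p" and zero: "\<And>f. word_op L f = 0"
  shows "word_act A L u = (0 :: 'l laurent ^ 'n::finite)"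
proof -
  \<comment> \<open>The coefficients of x^q in the g's form the part of the expression that sends
    x^m to multiples of x^(q + m).\<close>
  define Lq where "Lq q = map (\<lambda>(g, s). (Poly_Mapping.lookup g q, s)) L" for q :: "int ^ 'l"
  have scalar: "(\<Sum>(c, s)\<leftarrow>Lq q. c * prod_list (map (\<lambda>j. eig j m) s)) = 0" for q m
  proof -
    have "Poly_Mapping.lookup (word_op L (xpow m)) (q + m) =
        (\<Sum>(c, s)\<leftarrow>Lq q. c * prod_list (map (\<lambda>j. eig j m) s))"
      unfolding Lq_def
      by (induction L) (auto simp: lookup_add foldr_e_xpow lookup_mult_single)
    then show ?thesis using zero by simp
  qed
  have vanish: "word_eval X (Lq q) = 0" if "\<And>i j. X i * X j = X j * X i" for q and X :: "'l \<Rightarrow> 'n sqmat"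
  proof (rule word_eval_vanishing[OF _ that])
    fix \<kappa> :: "'l \<Rightarrow> int"
    obtain m where m: "\<And>j. weight j m = \<kappa> j" using weight_surj by blast
    have "(\<Sum>(c, s)\<leftarrow>Lq q. c * prod_list (map (\<lambda>j. 2 * pi * \<i> * of_int (\<kappa> j)) s)) = 0"
      using scalar[of m q] by (simp only: m)
    then show "word_eval (\<lambda>j. scal (2 * pi * \<i> * of_int (\<kappa> j)) :: 'n sqmat) (Lq q) = 0"
      by (simp only: word_eval_scal scal_0)
  qed
  have basis: "word_act A L (xvec m w) = 0" for m w
  proof -
    define X where "X j = scal (eig j m) + to_sq (A j)" for j
    have fold: "foldr (nab A) s (xvec m w) = xvec m (mat_of (prod_list (map X s)) *v w)" for s
      unfolding X_def by (rule foldr_nab_xvec)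
    have X: "X p * X q = X q * X p" for p q
      unfolding X_def by (rule scal_shift_commute) (metis comm to_sq_mult)
    have "Poly_Mapping.lookup (word_act A L (xvec m w) $ i) (q + m) = (mat_of (word_eval X (Lq q)) *v w) $ i" for i q
      unfolding Lq_def
    proof (induction L)
      case Nil
      show ?case by (simp add: word_eval_def zero_sqmat.rep_eq matrix_vector_mult_def)
    next
      case (Cons p L)
      obtain g s where p: "p = (g, s)" by (cases p)
      have "mat z ** B *v w = z *s (B *v w)" for z and B :: "complex ^ 'n ^ 'n"
        by (simp add: mat_matrix_mult vec_eq_iff matrix_vector_mult_def sum_distrib_left mult.assoc)
      then show ?case using Cons
        by (simp add: p lookup_add fold word_eval_def plus_sqmat.rep_eq
            times_sqmat.rep_eq mat_of_scal matrix_vector_mult_add_rdistrib)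
          (simp add: xvec_def lookup_mult_single)
    qed
    then have "Poly_Mapping.lookup (word_act A L (xvec m w) $ i) (q + m) = 0" for i q
      by (simp add: vanish[of X, OF X] zero_sqmat.rep_eq matrix_vector_mult_def)
    then have "Poly_Mapping.lookup (word_act A L (xvec m w) $ i) k = 0" for i k
      by (metis diff_add_cancel)
    then show ?thesis by (simp add: vec_eq_iff poly_mapping_eq_iff fun_eq_iff)
  qed
  show ?thesis
  proof (induction u rule: vec_laurent_induct)
    case zero
    show ?case using word_act_add[of A L 0 0] by simp
  next
    case (add u m w)
    then show ?case by (simp add: word_act_add basis)
  qed
qed

end

section \<open>Existence, uniqueness and isomorphisms of the modules\<close>

lemma matrix_add_rdistrib: "(A + B) ** C = A ** C + B ** (C :: ('a::semiring_1) ^ 'n ^ 'm)"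
  by (vector matrix_matrix_mult_def sum.distrib distrib_right)

lemma D_module_add: "D_module act \<Longrightarrow> P \<in> diff_ops \<Longrightarrow> act P (u + w) = act P u + act P w"
  and D_module_plus: "D_module act \<Longrightarrow> P \<in> diff_ops \<Longrightarrow> Q \<in> diff_ops \<Longrightarrow> act (\<lambda>f. P f + Q f) u = act P u + act Q u"
  and D_module_comp: "D_module act \<Longrightarrow> P \<in> diff_ops \<Longrightarrow> Q \<in> diff_ops \<Longrightarrow> act (P \<circ> Q) u = act P (act Q u)"
  and D_module_ext: "D_module act \<Longrightarrow> P \<notin> diff_ops \<Longrightarrow> act P = undefined"
  by (auto simp: D_module_def extensional_def)

text \<open>The relation between v, f and v f inside \<open>diff_ops\<close> forces the Leibniz rule
  on the module, so a field is determined by its action on the basis vectors. Sums and composites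
  follow, and outside \<open>diff_ops\<close> the value is fixed by extensionality.\<close>

lemma D_module_unique:
  fixes act act' :: "('l::finite, 'n::finite) D_mod"
  assumes act: "D_module act" "\<And>f u. act (\<lambda>g. f * g) u = f *s u"
    and act': "D_module act'" "\<And>f u. act' (\<lambda>g. f * g) u = f *s u"
    and eq: "\<And>v j. v \<in> Der \<Longrightarrow> act v (axis j 1) = act' v (axis j 1)"
  shows "act = act'"
proof -
  have leibniz: "a v (f *s u) = v f *s u + f *s a v u"
    if v: "v \<in> Der" and a: "D_module a" "\<And>f u. a (\<lambda>g. f * g) u = f *s u"
    for a :: "('l, 'n) D_mod" and v f u
  proof -
    have vd: "v \<in> diff_ops" and m: "(\<lambda>g. f * g) \<in> diff_ops" "(\<lambda>g. v f * g) \<in> diff_ops"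
      using v by (auto intro: diff_ops.intros)
    have "v (f * g) = v f * g + f * v g" for g
      using v by (simp add: Der_def derivation_def algebra_simps)
    then have "v \<circ> (\<lambda>g. f * g) = (\<lambda>g. v f * g + ((\<lambda>g. f * g) \<circ> v) g)"
      by (simp add: fun_eq_iff)
    then have "a (v \<circ> (\<lambda>g. f * g)) u = a (\<lambda>g. v f * g) u + a ((\<lambda>g. f * g) \<circ> v) u"
      using D_module_plus[OF a(1) m(2) diff_ops.comp[OF m(1) vd]] by simp
    then show ?thesis
      by (simp add: D_module_comp[OF a(1)] vd m a(2))
  qed
  have sum: "a P (sum h I) = (\<Sum>i\<in>I. a P (h i))" if "D_module a" "P \<in> diff_ops"
    for a :: "('l, 'n) D_mod" and P h and I :: "'n set"
  proof -
    have "a P 0 = 0" using D_module_add[OF that, of 0 0] by simp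
    then show ?thesis
      by (induction I rule: infinite_finite_induct) (simp_all add: D_module_add[OF that])
  qed
  have "act P u = act' P u" if "P \<in> diff_ops" for P u
    using that
  proof (induction arbitrary: u)
    case (mult f)
    show ?case by (simp add: act act')
  next
    case (deriv v)
    then have v: "v \<in> diff_ops" by (rule diff_ops.deriv)
    have "act v (u $ j *s axis j 1) = act' v (u $ j *s axis j 1)" for j
      by (simp add: leibniz[OF deriv] act act' eq[OF deriv])
    then have "act v (\<Sum>j\<in>UNIV. u $ j *s axis j 1) = act' v (\<Sum>j\<in>UNIV. u $ j *s axis j 1)"
      by (simp add: sum act act' v)
    then show ?case by (simp only: cart_basis_expansion[symmetric])
  next
    case (add P Q)
    then show ?case by (simp add: D_module_plus act act')
  next
    case (comp P Q)
    show ?case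
      by (simp only: D_module_comp[OF act(1) comp.hyps] D_module_comp[OF act'(1) comp.hyps] comp.IH)
  qed
  then show ?thesis using D_module_ext[OF act(1)] D_module_ext[OF act'(1)] by (metis ext)
qed

lemma D_module_iso_refl: "D_module_iso act act"
  unfolding D_module_iso_def by (rule exI[of _ id]) simp

lemma D_module_iso_sym:
  assumes "D_module_iso act act'"
  shows "D_module_iso act' act"
proof -
  obtain \<phi> where \<phi>: "bij \<phi>" "\<And>u w. \<phi> (u + w) = \<phi> u + \<phi> w"
    "\<And>P u. P \<in> diff_ops \<Longrightarrow> \<phi> (act P u) = act' P (\<phi> u)"
    using assms by (auto simp: D_module_iso_def)
  have "inv \<phi> (u + w) = inv \<phi> u + inv \<phi> w" for u w
    by (rule injD[OF bij_is_inj[OF \<phi>(1)]]) (simp add: \<phi>(2) surj_f_inv_f[OF bij_is_surj[OF \<phi>(1)]])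
  moreover have "inv \<phi> (act' P u) = act P (inv \<phi> u)" if "P \<in> diff_ops" for P u
    by (rule injD[OF bij_is_inj[OF \<phi>(1)]]) (simp add: \<phi>(3)[OF that] surj_f_inv_f[OF bij_is_surj[OF \<phi>(1)]])
  ultimately show ?thesis
    unfolding D_module_iso_def using bij_imp_bij_inv[OF \<phi>(1)] by blast
qed

lemma D_module_iso_trans:
  assumes "D_module_iso act act'" "D_module_iso act' act''"
  shows "D_module_iso act act''"
proof -
  obtain \<phi> where \<phi>: "bij \<phi>" "\<And>u w. \<phi> (u + w) = \<phi> u + \<phi> w"
    "\<And>P u. P \<in> diff_ops \<Longrightarrow> \<phi> (act P u) = act' P (\<phi> u)"
    using assms(1) by (auto simp: D_module_iso_def)
  obtain \<psi> where \<psi>: "bij \<psi>" "\<And>u w. \<psi> (u + w) = \<psi> u + \<psi> w"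
    "\<And>P u. P \<in> diff_ops \<Longrightarrow> \<psi> (act' P u) = act'' P (\<psi> u)"
    using assms(2) by (auto simp: D_module_iso_def)
  show ?thesis
    unfolding D_module_iso_def
    by (rule exI[of _ "\<psi> \<circ> \<phi>"]) (simp add: bij_comp \<phi> \<psi>)
qed

lemma additive_smult_eq_matrix:
  fixes \<phi> :: "('a::comm_ring_1) ^ 'n::finite \<Rightarrow> 'a ^ 'm"
  assumes "\<And>u w. \<phi> (u + w) = \<phi> u + \<phi> w" "\<And>f u. \<phi> (f *s u) = f *s \<phi> u"
  obtains g where "\<And>u. \<phi> u = g *v u"
proof (rule that)
  fix u
  have \<phi>0: "\<phi> 0 = 0" using assms(1)[of 0 0] by simp
  have sum: "\<phi> (sum h I) = (\<Sum>i\<in>I. \<phi> (h i))" for h and I :: "'n set"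
    by (induction I rule: infinite_finite_induct) (simp_all add: \<phi>0 assms(1))
  have "\<phi> u = \<phi> (\<Sum>j\<in>UNIV. u $ j *s axis j 1)" by (simp only: cart_basis_expansion[symmetric])
  then show "\<phi> u = (\<chi> i j. \<phi> (axis j 1) $ i) *v u"
    by (simp add: sum assms(2) vec_eq_iff matrix_vector_mult_def mult.commute)
qed

lemma matrix_eq_on_axes:
  fixes g h :: "('a::comm_ring_1) ^ 'n::finite ^ 'm"
  assumes "\<And>u. g *v u = h *v u"
  shows "g = h"
  using assms by (simp add: matrix_eq)

section \<open>Values and coefficients of Laurent matrices\<close>

lemma eval_at_1_eq_extend: "eval_at_1 = extend (\<lambda>c (k :: int ^ 'l::finite). c)"
  by (rule ext) (simp add: eval_at_1_def extend_def)

lemma eval_at_1_add: "eval_at_1 (f + g) = eval_at_1 f + eval_at_1 g"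
  unfolding eval_at_1_eq_extend by (rule extend_add) simp

lemma eval_at_1_0 [simp]: "eval_at_1 0 = 0"
  by (simp add: eval_at_1_def)

lemma eval_at_1_single: "eval_at_1 (Poly_Mapping.single m c) = c"
  by (simp add: eval_at_1_def)

lemma eval_at_1_sum: "eval_at_1 (sum f A) = (\<Sum>x\<in>A. eval_at_1 (f x))"
  by (induction A rule: infinite_finite_induct) (simp_all add: eval_at_1_add)

lemma eval_at_1_mult: "eval_at_1 (f * g) = eval_at_1 f * eval_at_1 g"
proof (induction f rule: poly_mapping_add_induct)
  case (add f m c)
  have "eval_at_1 (Poly_Mapping.single m c * g) = c * eval_at_1 g"
    by (induction g rule: poly_mapping_add_induct)
      (simp_all add: distrib_left eval_at_1_add mult_single eval_at_1_single)
  then show ?case using add by (simp add: distrib_right eval_at_1_add eval_at_1_single)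
qed simp

definition meval :: "('l::finite) laurent ^ 'n ^ 'm \<Rightarrow> complex ^ 'n ^ 'm" where
  "meval g = (\<chi> i j. eval_at_1 (g $ i $ j))"

lemma meval_mult: "meval (g ** h) = meval g ** meval h"
  by (simp add: meval_def vec_eq_iff matrix_matrix_mult_def eval_at_1_sum eval_at_1_mult)

lemma eval_at_1_1 [simp]: "eval_at_1 1 = 1"
  using eval_at_1_single[of "0 :: int ^ 'a" 1] by (simp only: single_one)

lemma meval_1: "meval (mat 1) = mat 1"
  by (simp add: meval_def vec_eq_iff mat_def)

definition mcoeff :: "int ^ 'l \<Rightarrow> ('l::finite) laurent ^ 'n ^ 'm \<Rightarrow> complex ^ 'n ^ 'm" where
  "mcoeff m g = (\<chi> i j. Poly_Mapping.lookup (g $ i $ j) m)"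

lemma meval_eq_sum_mcoeff:
  fixes g :: "('l::finite) laurent ^ 'n::finite ^ 'm::finite"
  obtains M where "finite M" "meval g = (\<Sum>m\<in>M. mcoeff m g)"
proof (rule that)
  let ?M = "\<Union>i. \<Union>j. Poly_Mapping.keys (g $ i $ j)"
  show fin: "finite ?M" by auto
  have "eval_at_1 (g $ i $ j) = (\<Sum>m\<in>?M. Poly_Mapping.lookup (g $ i $ j) m)" for i j
    unfolding eval_at_1_def using fin by (intro sum.mono_neutral_left) (auto simp: in_keys_iff)
  then show "meval g = (\<Sum>m\<in>?M. mcoeff m g)"
    by (simp add: meval_def mcoeff_def vec_eq_iff)
qed

context lattice_frame
begin

text \<open>Any normal form of P may be used, by \<open>word_act_cong\<close>; the restriction to
  \<open>diff_ops\<close> matches the convention of \<open>D_module\<close>.\<close>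

definition act_of :: "('l \<Rightarrow> complex ^ 'n ^ 'n) \<Rightarrow> ('l, 'n::finite) D_mod" where
  "act_of A = (\<lambda>P\<in>diff_ops. word_act A (SOME L. P = word_op L))"

text \<open>The formal difference of the two expressions represents the zero operator.\<close>

lemma word_act_cong:
  fixes A :: "'l \<Rightarrow> complex ^ 'n::finite ^ 'n"
  assumes comm: "\<And>p q. A p ** A q = A q ** A p" and eq: "word_op L = word_op L'"
  shows "word_act A L = word_act A L'"
proof
  fix u
  define D where "D = L @ mult_words (- 1) L'"
  have "word_op D f = 0" for f by (simp add: D_def word_op_append word_op_mult eq)
  then have "word_act A D u = 0" by (intro word_act_zero comm) auto
  then have "word_act A L u + (- 1) *s word_act A L' u = 0"
    by (simp add: D_def word_act_append word_act_mult)
  then show "word_act A L u = word_act A L' u"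
    by (simp add: vec_eq_iff)
qed

lemma act_of_word_op:
  fixes A :: "'l \<Rightarrow> complex ^ 'n::finite ^ 'n"
  assumes comm: "\<And>p q. A p ** A q = A q ** A p" and L: "word_op L \<in> diff_ops"
  shows "act_of A (word_op L) u = word_act A L u"
proof -
  have "word_op L = word_op (SOME L'. word_op L = word_op L')" by (rule someI) (rule refl)
  then have "word_act A (SOME L'. word_op L = word_op L') = word_act A L"
    by (rule word_act_cong[OF comm, symmetric])
  then show ?thesis using L by (simp add: act_of_def)
qed

lemma act_of_mult:
  assumes "\<And>p q. A p ** A q = A q ** A p"
  shows "act_of A (\<lambda>g. f * g) u = f *s u"
proof -
  have eq: "word_op [(f, [])] = (\<lambda>g. f * g)" by (simp add: fun_eq_iff)
  have "act_of A (word_op [(f, [])]) u = word_act A [(f, [])] u"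
    by (rule act_of_word_op[OF assms]) (simp only: eq diff_ops.mult)
  then show ?thesis by (simp only: eq) simp
qed

lemma act_of_deriv:
  assumes comm: "\<And>p q. A p ** A q = A q ** A p" and v: "v \<in> Der" "\<And>f. v f = (\<Sum>p\<in>UNIV. g p * e p f)"
  shows "act_of A v u = (\<Sum>p\<in>UNIV. g p *s nab A p u)"
proof -
  have eq: "v = word_op (deriv_words g)" by (simp add: fun_eq_iff word_op_deriv v(2))
  have "v \<in> diff_ops" using v(1) by (rule diff_ops.deriv)
  then show ?thesis using act_of_word_op[OF comm, where L = "deriv_words g" and u = u] by (simp add: eq word_act_deriv)
qed

lemma act_of_e:
  assumes "\<And>p q. A p ** A q = A q ** A p"
  shows "act_of A (e j) u = nab A j u"
proof -
  have "act_of A (e j) u = (\<Sum>p\<in>UNIV. (if p = j then 1 else 0) *s nab A p u)"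
  proof (rule act_of_deriv[OF assms])
    show "e j \<in> Der" using e_Lie_T[of j] by (simp add: Lie_T_def)
    have "(\<Sum>p\<in>UNIV. (if p = j then 1 else 0) * e p f) = (\<Sum>p\<in>UNIV. if p = j then e j f else 0)" for f
      by (intro sum.cong) auto
    then show "e j f = (\<Sum>p\<in>UNIV. (if p = j then 1 else 0) * e p f)" for f by simp
  qed
  also have "\<dots> = (\<Sum>p\<in>UNIV. if p = j then nab A j u else 0)"
    by (intro sum.cong) auto
  finally show ?thesis by simp
qed

lemma D_module_act_of:
  fixes A :: "'l \<Rightarrow> complex ^ 'n::finite ^ 'n"
  assumes comm: "\<And>p q. A p ** A q = A q ** A p"
  shows "D_module (act_of A)"
  unfolding D_module_def
proof (intro conjI ballI allI)
  show "act_of A \<in> extensional diff_ops" by (simp add: act_of_def)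
next
  fix P u w assume "P \<in> (diff_ops :: ('l laurent \<Rightarrow> 'l laurent) set)"
  then show "act_of A P (u + w) = act_of A P u + act_of A P w"
    by (simp add: act_of_def word_act_add)
next
  fix P Q :: "'l laurent \<Rightarrow> 'l laurent" and u assume P: "P \<in> diff_ops" and Q: "Q \<in> diff_ops"
  obtain L L' where L: "P = word_op L" "Q = word_op L'" using diff_op_eq_words P Q by metis
  have "(\<lambda>f. P f + Q f) = word_op (L @ L')" by (simp add: L fun_eq_iff word_op_append)
  then show "act_of A (\<lambda>f. P f + Q f) u = act_of A P u + act_of A Q u"
    using act_of_word_op[OF comm, where L = "L @ L'" and u = u] act_of_word_op[OF comm, where L = L and u = u]
      act_of_word_op[OF comm, where L = L' and u = u] P Q diff_ops.add[OF P Q] L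
    by (simp add: word_act_append)
next
  fix P Q :: "'l laurent \<Rightarrow> 'l laurent" and u assume P: "P \<in> diff_ops" and Q: "Q \<in> diff_ops"
  obtain L L' where L: "P = word_op L" "Q = word_op L'" using diff_op_eq_words P Q by metis
  have "P \<circ> Q = word_op (comp_words L L')" by (simp add: L fun_eq_iff word_op_comp)
  then show "act_of A (P \<circ> Q) u = act_of A P (act_of A Q u)"
    using act_of_word_op[OF comm, where L = "comp_words L L'" and u = u] act_of_word_op[OF comm, where L = L]
      act_of_word_op[OF comm, where L = L' and u = u] P Q diff_ops.comp[OF P Q] L
    by (simp add: word_act_comp)
next
  fix u :: "'l laurent ^ 'n"
  have "id = (\<lambda>g :: 'l laurent. 1 * g)" by (simp add: fun_eq_iff)
  then show "act_of A id u = u" using act_of_mult[OF comm, where f = 1 and u = u] by simp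
qed

text \<open>Compatibility with multiplication operators makes an isomorphism C[T]-linear, hence a
  matrix. In the other direction, multiplications and the e_j generate all operators through their
  normal forms.\<close>

lemma D_module_iso_act_of_iff:
  fixes A A' :: "'l \<Rightarrow> complex ^ 'n::finite ^ 'n"
  assumes comm: "\<And>p q. A p ** A q = A q ** A p" and comm': "\<And>p q. A' p ** A' q = A' q ** A' p"
  shows "D_module_iso (act_of A) (act_of A') \<longleftrightarrow>
    (\<exists>g h. g ** h = mat 1 \<and> h ** g = mat 1 \<and> (\<forall>j u. g *v nab A j u = nab A' j (g *v u)))"
proof
  assume "D_module_iso (act_of A) (act_of A')"
  then obtain \<phi> where \<phi>: "bij \<phi>" "\<And>u w. \<phi> (u + w) = \<phi> u + \<phi> w"
    "\<And>P u. P \<in> diff_ops \<Longrightarrow> \<phi> (act_of A P u) = act_of A' P (\<phi> u)"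
    unfolding D_module_iso_def by blast
  have lin: "\<phi> (f *s u) = f *s \<phi> u" for f u
    using \<phi>(3)[OF diff_ops.mult, of f u] by (simp add: act_of_mult comm comm')
  obtain g where g: "\<And>u. \<phi> u = g *v u" using additive_smult_eq_matrix[OF \<phi>(2) lin] by blast
  have inj: "inj \<phi>" and surj: "\<And>u. \<phi> (inv \<phi> u) = u"
    using \<phi>(1) by (auto simp: bij_is_inj bij_is_surj surj_f_inv_f)
  have "inv \<phi> (u + w) = inv \<phi> u + inv \<phi> w" for u w
    by (rule injD[OF inj]) (simp add: \<phi>(2) surj)
  moreover have "inv \<phi> (f *s u) = f *s inv \<phi> u" for f u
    by (rule injD[OF inj]) (simp add: lin surj)
  ultimately obtain h where h: "\<And>u. inv \<phi> u = h *v u"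
    by (rule additive_smult_eq_matrix) blast
  have "g ** h = mat 1"
    by (rule matrix_eq_on_axes) (metis g h surj matrix_vector_mul_assoc matrix_vector_mul_lid)
  moreover have "h ** g = mat 1"
    by (rule matrix_eq_on_axes) (metis g h inv_f_f[OF inj] matrix_vector_mul_assoc matrix_vector_mul_lid)
  moreover have "g *v nab A j u = nab A' j (g *v u)" for j u
  proof -
    have "e j \<in> diff_ops" using e_Lie_T[of j] by (auto simp: Lie_T_def intro: diff_ops.deriv)
    from \<phi>(3)[OF this, of u] show ?thesis by (simp add: act_of_e comm comm' g)
  qed
  ultimately show "\<exists>g h. g ** h = mat 1 \<and> h ** g = mat 1 \<and> (\<forall>j u. g *v nab A j u = nab A' j (g *v u))"
    by blast
next
  assume "\<exists>g h. g ** h = mat 1 \<and> h ** g = mat 1 \<and> (\<forall>j u. g *v nab A j u = nab A' j (g *v u))"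
  then obtain g h where gh: "g ** h = mat 1" "h ** g = mat 1"
    and nab: "\<And>j u. g *v nab A j u = nab A' j (g *v u)" by blast
  have "foldr (nab A') s (g *v u) = g *v foldr (nab A) s u" for s u
    by (induction s) (simp_all add: nab)
  then have word: "g *v word_act A L u = word_act A' L (g *v u)" for L u
    by (induction L) (auto simp: matrix_vector_right_distrib matrix_vector_mult_smult)
  show "D_module_iso (act_of A) (act_of A')"
    unfolding D_module_iso_def
  proof (intro exI conjI allI ballI)
    show "bij ((*v) g)"
    proof (rule o_bij[of "(*v) h"])
      show "(*v) h \<circ> (*v) g = id" "(*v) g \<circ> (*v) h = id"
        by (simp_all add: fun_eq_iff matrix_vector_mul_assoc gh)
    qed
    show "g *v (u + w) = g *v u + g *v w" for u w by (rule matrix_vector_right_distrib)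
    show "g *v act_of A P u = act_of A' P (g *v u)" if "P \<in> diff_ops" for P u
      using that diff_op_eq_words[OF that] by (auto simp: act_of_word_op comm comm' word)
  qed
qed

text \<open>Comparing coefficients on the basis vectors, each coefficient matrix intertwines A_j
  with a shift of A'_j by an element of 2 pi i Z. The coefficients may be singular; their sum is the
  value at 1.\<close>

lemma gauge_imp_exp_conjugate:
  fixes A A' :: "'l \<Rightarrow> complex ^ 'n::finite ^ 'n"
  assumes "\<And>u. g *v nab A j u = nab A' j (g *v u)"
  shows "meval g ** matrix_exp (A j) = matrix_exp (A' j) ** meval g"
proof -
  have "mcoeff m g ** A j = (mat (eig j m) + A' j) ** mcoeff m g" for m
  proof -
    have "(\<Sum>i\<in>UNIV. g $ a $ i * const (A j $ i $ k)) = e j (g $ a $ k) + (\<Sum>i\<in>UNIV. const (A' j $ a $ i) * g $ i $ k)" for a k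
    proof -
      have "(g *v nab A j (axis k 1)) $ a = (nab A' j (g *v axis k 1)) $ a" by (simp only: assms)
      moreover have "e j ((axis k 1 :: 'l laurent ^ 'n) $ i) = 0" for i
        using e_mult[of j 1 1] by (simp add: axis_def)
      ultimately show ?thesis
        by (simp add: nab_def matrix_vector_mult_axis_nth)
          (simp add: matrix_vector_mult_def cmat_def axis_def if_distrib cong: if_cong)
    qed
    then have "Poly_Mapping.lookup (\<Sum>i\<in>UNIV. g $ a $ i * const (A j $ i $ k)) m =
        Poly_Mapping.lookup (e j (g $ a $ k) + (\<Sum>i\<in>UNIV. const (A' j $ a $ i) * g $ i $ k)) m" for a k
      by simp
    then have "(\<Sum>i\<in>UNIV. A j $ i $ k * Poly_Mapping.lookup (g $ a $ i) m) = eig j m * Poly_Mapping.lookup (g $ a $ k) m +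
        (\<Sum>i\<in>UNIV. A' j $ a $ i * Poly_Mapping.lookup (g $ i $ k) m)" for a k
      by (simp only: lookup_sum lookup_add lookup_e lookup_const_mult mult.commute[of _ "const _"])
    then show ?thesis
      unfolding matrix_add_rdistrib mat_matrix_mult
      by (simp add: mcoeff_def matrix_matrix_mult_def vec_eq_iff mult.commute[of "Poly_Mapping.lookup _ _"])
  qed
  then have "matrix_exp (mat (eig j m) + A' j) ** mcoeff m g = mcoeff m g ** matrix_exp (A j)" for m
    by (intro matrix_exp_intertwine) simp
  moreover have "matrix_exp (mat (eig j m) + A' j) = matrix_exp (A' j)" for m
  proof -
    have "matrix_exp (mat (eig j m) + A' j) = matrix_exp (mat (eig j m)) ** matrix_exp (A' j)"
      by (rule matrix_exp_add) (simp add: mat_matrix_mult matrix_mult_mat)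
    then show ?thesis by (simp only: matrix_exp_mat exp_2pi_i_int matrix_mul_lid)
  qed
  ultimately have eq: "mcoeff m g ** matrix_exp (A j) = matrix_exp (A' j) ** mcoeff m g" for m by simp
  obtain M where M: "finite M" "meval g = (\<Sum>m\<in>M. mcoeff m g)" by (rule meval_eq_sum_mcoeff)
  have sumr: "(\<Sum>m\<in>M. f m) ** B = (\<Sum>m\<in>M. f m ** B)" for f :: "_ \<Rightarrow> complex ^ 'n ^ 'n" and B :: "complex ^ 'n ^ 'n"
    by (induction M rule: infinite_finite_induct) (simp_all add: matrix_add_rdistrib)
  have suml: "B ** (\<Sum>m\<in>M. f m) = (\<Sum>m\<in>M. B ** f m)" for f :: "_ \<Rightarrow> complex ^ 'n ^ 'n" and B :: "complex ^ 'n ^ 'n"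
    by (induction M rule: infinite_finite_induct) (simp_all add: matrix_add_ldistrib)
  show ?thesis by (simp add: M(2) sumr suml eq)
qed

end

section \<open>Isomorphic modules from conjugate exponentials\<close>

lemma matrix_inv:
  assumes "invertible (A :: 'a::semiring_1 ^ 'n ^ 'm)"
  shows "A ** matrix_inv A = mat 1" "matrix_inv A ** A = mat 1"
proof -
  obtain B where "A ** B = mat 1 \<and> B ** A = mat 1" using assms by (auto simp: invertible_def)
  then have "A ** matrix_inv A = mat 1 \<and> matrix_inv A ** A = mat 1"
    unfolding matrix_inv_def by (rule someI[of "\<lambda>B. A ** B = mat 1 \<and> B ** A = mat 1"])
  then show "A ** matrix_inv A = mat 1" "matrix_inv A ** A = mat 1" by simp_all
qed

text \<open>With an explicit inverse h the condition has the same shape as gauge equivalence over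
  C[T], so the two can be compared by evaluation.\<close>

lemma conjugate_iff_intertwined:
  fixes A B :: "'l \<Rightarrow> complex ^ 'n::finite ^ 'n"
  shows "(\<exists>g. invertible g \<and> (\<forall>j. B j = g ** A j ** matrix_inv g)) \<longleftrightarrow>
    (\<exists>g h. g ** h = mat 1 \<and> h ** g = mat 1 \<and> (\<forall>j. B j ** g = g ** A j))"
proof
  assume "\<exists>g. invertible g \<and> (\<forall>j. B j = g ** A j ** matrix_inv g)"
  then obtain g where g: "invertible g" "\<And>j. B j = g ** A j ** matrix_inv g" by blast
  have "B j ** g = g ** A j ** (matrix_inv g ** g)" for j
    unfolding g(2)[of j] by (simp only: matrix_mul_assoc)
  then show "\<exists>g h. g ** h = mat 1 \<and> h ** g = mat 1 \<and> (\<forall>j. B j ** g = g ** A j)"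
    using matrix_inv[OF g(1)] by (intro exI[of _ g] exI[of _ "matrix_inv g"]) simp
next
  assume "\<exists>g h. g ** h = mat 1 \<and> h ** g = mat 1 \<and> (\<forall>j. B j ** g = g ** A j)"
  then obtain g h where g: "g ** h = mat 1" "h ** g = mat 1" "\<And>j. B j ** g = g ** A j" by blast
  have inv: "invertible g" using g by (auto simp: invertible_def)
  have "g ** A j ** matrix_inv g = B j ** (g ** matrix_inv g)" for j
    by (simp only: g(3)[symmetric] matrix_mul_assoc)
  then show "\<exists>g. invertible g \<and> (\<forall>j. B j = g ** A j ** matrix_inv g)"
    using inv matrix_inv[OF inv] by (intro exI[of _ g]) simp
qed

lemma matrix_diff_rdistrib: "(A - B) ** C = A ** C - B ** (C :: ('a::ring_1) ^ 'n ^ 'm)"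
  using matrix_add_rdistrib[of "A - B" B C] by (simp add: eq_diff_eq)

lemma matrix_diff_ldistrib: "C ** (A - B) = C ** A - (C :: ('a::ring_1) ^ 'n ^ 'm) ** B"
  using matrix_add_ldistrib[of C "A - B" B] by (simp add: eq_diff_eq)

lemma sum_matrix_mult_left: "(\<Sum>x\<in>S. f x) ** B = (\<Sum>x\<in>S. f x ** (B :: ('a::semiring_1) ^ 'n ^ 'm))"
proof -
  have "0 ** B = 0" by (simp add: matrix_matrix_mult_def vec_eq_iff)
  then show ?thesis by (induction S rule: infinite_finite_induct) (simp_all add: matrix_add_rdistrib)
qed

lemma sum_matrix_mult_right: "B ** (\<Sum>x\<in>S. f x) = (\<Sum>x\<in>S. (B :: ('a::semiring_1) ^ 'n ^ 'm) ** f x)"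
proof -
  have "B ** 0 = 0" by (simp add: matrix_matrix_mult_def vec_eq_iff)
  then show ?thesis by (induction S rule: infinite_finite_induct) (simp_all add: matrix_add_ldistrib)
qed

lemma sum_matrix_vector_mult: "(\<Sum>x\<in>S. f x) *v u = (\<Sum>x\<in>S. f x *v (u :: ('a::comm_ring_1) ^ 'n))"
proof -
  have "0 *v u = 0" by (simp add: matrix_vector_mult_def vec_eq_iff)
  then show ?thesis
    by (induction S rule: infinite_finite_induct) (simp_all add: matrix_vector_mult_add_rdistrib)
qed

lemma single_sum: "Poly_Mapping.single m (sum f S) = (\<Sum>x\<in>S. Poly_Mapping.single m (f x))"
  by (induction S rule: infinite_finite_induct) (simp_all add: single_add)

definition xmat :: "int ^ 'l \<Rightarrow> complex ^ 'n ^ 'm \<Rightarrow> ('l::finite) laurent ^ 'n ^ 'm" where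
  "xmat m P = (\<chi> a b. Poly_Mapping.single m (P $ a $ b))"

lemma xmat_mult: "xmat m P ** xmat n Q = xmat (m + n) (P ** Q)"
  by (simp add: xmat_def vec_eq_iff matrix_matrix_mult_def mult_single single_sum)

lemma xmat_add: "xmat m (P + Q) = xmat m P + xmat m Q"
  by (simp add: xmat_def vec_eq_iff single_add)

lemma xmat_0 [simp]: "xmat m 0 = 0"
  by (simp add: xmat_def vec_eq_iff)

lemma xmat_sum: "xmat m (sum f S) = (\<Sum>x\<in>S. xmat m (f x))"
  by (induction S rule: infinite_finite_induct) (simp_all add: xmat_add)

lemma xmat_1: "xmat 0 (mat 1) = mat 1"
  by (simp add: xmat_def vec_eq_iff mat_def)

lemma cmat_eq_xmat: "cmat B = xmat 0 B"
  by (simp add: cmat_def xmat_def const_def)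

context lattice_frame
begin

lemma nab_sum: "nab A i (\<Sum>x\<in>S. f x) = (\<Sum>x\<in>S. nab A i (f x))"
  by (induction S rule: infinite_finite_induct) (simp_all add: nab_add)

text \<open>The derivative of x^m contributes the shift by the eigenvalue of e_i on x^m.\<close>

lemma xmat_intertwines_nab:
  fixes A A' :: "'l \<Rightarrow> complex ^ 'n::finite ^ 'n"
  assumes "P ** A i = (mat (eig i m) + A' i) ** P"
  shows "xmat m P *v nab A i u = nab A' i (xmat m P *v u)"
proof -
  have e_xmat: "(\<chi> a. e i ((xmat m P *v u) $ a)) = xmat m P *v (\<chi> a. e i (u $ a)) + xmat m (mat (eig i m) ** P) *v u"
    by (simp only: vec_eq_iff vec_lambda_beta vector_add_component matrix_vector_mult_def xmat_def
        mat_matrix_mult e_sum e_mult e_single sum.distrib mult.commute[of "u $ _"]) simp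
  have "nab A' i (xmat m P *v u) = xmat m P *v (\<chi> a. e i (u $ a)) + (xmat m (mat (eig i m) ** P) *v u + xmat 0 (A' i) *v (xmat m P *v u))"
    unfolding nab_def cmat_eq_xmat e_xmat by (simp only: add.assoc)
  also have "\<dots> = xmat m P *v (\<chi> a. e i (u $ a)) + xmat m ((mat (eig i m) + A' i) ** P) *v u"
    by (simp only: matrix_vector_mul_assoc xmat_mult add_0_left matrix_vector_mult_add_rdistrib[symmetric]
        xmat_add[symmetric] matrix_add_rdistrib)
  also have "xmat m ((mat (eig i m) + A' i) ** P) = xmat m P ** xmat 0 (A i)"
    by (simp only: assms[symmetric] xmat_mult add_0_right)
  also have "xmat m P *v (\<chi> a. e i (u $ a)) + xmat m P ** xmat 0 (A i) *v u = xmat m P *v nab A i u"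
    by (simp only: nab_def cmat_eq_xmat matrix_vector_right_distrib matrix_vector_mul_assoc)
  finally show ?thesis by simp
qed

text \<open>The projections commute with everything that commutes with Y, in particular with all
  A_i, so the gauge leaves the other coordinates alone.\<close>

lemma D_module_iso_subtract_period:
  fixes A :: "'l \<Rightarrow> complex ^ 'n::finite ^ 'n"
  assumes comm: "\<And>p q. A p ** A q = A q ** A p" and Y: "\<And>p. A p ** Y = Y ** A p"
    and exp: "matrix_exp Y = mat 1"
  shows "D_module_iso (act_of A) (act_of (A(j := A j - Y)))"
proof -
  obtain K P where K: "finite K" "(\<Sum>k\<in>K. P k) = mat 1"
    and YP: "\<And>k. Y ** P k = mat (2 * pi * \<i> * of_int k) ** P k"
    and orth: "\<And>k l. k \<noteq> l \<Longrightarrow> P k ** P l = 0" and idem: "\<And>k. P k ** P k = P k"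
    and PD: "\<And>k D. D ** Y = Y ** D \<Longrightarrow> D ** P k = P k ** D"
    using matrix_exp_eq_one_decomposition[OF exp] by metis
  have "\<exists>m. \<forall>i. weight i m = (if i = j then k else 0)" for k
    using weight_surj[of "\<lambda>i. if i = j then k else 0"] by metis
  then obtain m where m: "\<And>k i. weight i (m k) = (if i = j then k else 0)" by metis
  let ?A' = "A(j := A j - Y)"
  have comm': "?A' p ** ?A' q = ?A' q ** ?A' p" for p q
    by (simp add: comm Y matrix_diff_ldistrib matrix_diff_rdistrib algebra_simps)
  have inter: "P k ** A i = (mat (eig i (m k)) + ?A' i) ** P k" for k i
  proof (cases "i = j")
    case True
    have "(mat (eig i (m k)) + ?A' i) ** P k = Y ** P k + (A j ** P k - Y ** P k)"
      using True by (simp add: matrix_add_rdistrib matrix_diff_rdistrib YP m)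
    then show ?thesis using PD[of "A j" k] Y True by simp
  next
    case False
    have "mat 0 + B = B" for B :: "complex ^ 'n ^ 'n" by (simp add: vec_eq_iff mat_def)
    then show ?thesis using PD[of "A i" k] Y False by (simp add: m)
  qed
  define g where "g = (\<Sum>k\<in>K. xmat (m k) (P k))"
  define h where "h = (\<Sum>k\<in>K. xmat (- m k) (P k))"
  \<comment> \<open>Orthogonality leaves the diagonal terms, in which the monomials cancel. The
    exponents m and - m give the two products of g and h.\<close>
  have inv: "(\<Sum>k\<in>K. xmat (a k) (P k)) ** (\<Sum>k\<in>K. xmat (- a k) (P k)) = mat 1" for a :: "int \<Rightarrow> int ^ 'l"
  proof -
    have "(\<Sum>k\<in>K. xmat (a k) (P k)) ** (\<Sum>k\<in>K. xmat (- a k) (P k)) =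
        (\<Sum>k\<in>K. \<Sum>l\<in>K. xmat (a k + - a l) (P k ** P l))"
      by (simp only: sum_matrix_mult_left sum_matrix_mult_right xmat_mult) (rule sum.swap)
    also have "\<dots> = (\<Sum>k\<in>K. \<Sum>l\<in>K. if l = k then xmat 0 (P k) else 0)"
      by (intro sum.cong refl) (auto simp: idem orth)
    also have "\<dots> = xmat 0 (\<Sum>k\<in>K. P k)" using K(1) by (simp add: xmat_sum)
    finally show ?thesis by (simp only: K(2) xmat_1)
  qed
  have "g ** h = mat 1" "h ** g = mat 1"
    using inv[of m] inv[of "\<lambda>k. - m k"] by (simp_all add: g_def h_def)
  moreover have "g *v nab A i u = nab ?A' i (g *v u)" for i u
    unfolding g_def sum_matrix_vector_mult nab_sum
    by (intro sum.cong refl xmat_intertwines_nab inter)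
  ultimately show ?thesis
    unfolding D_module_iso_act_of_iff[OF comm comm'] by blast
qed

text \<open>L_j commutes with whatever commutes with exp A_j, hence with all A_p and then with all
  L_p. So each intermediate tuple \<open>B S\<close>, replaced on S only, is commuting, and exp (A_i
  - L_i) = 1.\<close>

lemma D_module_iso_log:
  fixes A L :: "'l \<Rightarrow> complex ^ 'n::finite ^ 'n"
  assumes comm: "\<And>p q. A p ** A q = A q ** A p"
    and L: "\<And>j. matrix_exp (L j) = matrix_exp (A j)"
    and LD: "\<And>j D. D ** matrix_exp (A j) = matrix_exp (A j) ** D \<Longrightarrow> D ** L j = L j ** D"
  shows "D_module_iso (act_of A) (act_of L)"
proof -
  have AE: "A p ** matrix_exp (A q) = matrix_exp (A q) ** A p" for p q
    using matrix_exp_intertwine[of "A q" "A p" "A q"] comm by simp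
  have AL: "A p ** L q = L q ** A p" for p q by (rule LD) (rule AE)
  have LL: "L p ** L q = L q ** L p" for p q
  proof (rule LD)
    show "L p ** matrix_exp (A q) = matrix_exp (A q) ** L p"
      using matrix_exp_intertwine[of "A q" "L p" "A q"] AL by metis
  qed
  define B where "B S j = (if j \<in> S then L j else A j)" for S j
  have B: "B S p ** B S q = B S q ** B S p" for S p q
    by (simp add: B_def comm AL LL)
  have "D_module_iso (act_of A) (act_of (B S))" if "finite S" for S
    using that
  proof (induction S rule: finite_induct)
    case empty
    have "B {} = A" by (simp add: B_def fun_eq_iff)
    then show ?case by (simp add: D_module_iso_refl)
  next
    case (insert i S)
    let ?Y = "A i - L i"
    have Y_eq: "?Y = A i + - L i" by simp
    have neg: "C ** - D = - (C ** D)" "- C ** D = - (C ** D)" for C D :: "complex ^ 'n ^ 'n"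
      by (simp_all add: matrix_matrix_mult_def vec_eq_iff sum_negf)
    have "matrix_exp ?Y = matrix_exp (A i) ** matrix_exp (- L i)"
      unfolding Y_eq by (rule matrix_exp_add) (simp add: neg AL)
    also have "\<dots> = mat 1" using matrix_exp_minus[of "- L i"] by (simp add: L)
    finally have "matrix_exp ?Y = mat 1" .
    moreover have "B S p ** ?Y = ?Y ** B S p" for p
      by (simp add: matrix_diff_ldistrib matrix_diff_rdistrib B_def comm AL LL)
    ultimately have "D_module_iso (act_of (B S)) (act_of ((B S)(i := B S i - ?Y)))"
      by (intro D_module_iso_subtract_period B)
    moreover have "(B S)(i := B S i - ?Y) = B (insert i S)"
      using insert.hyps by (auto simp: B_def fun_eq_iff)
    ultimately show ?case using insert.IH D_module_iso_trans by metis
  qed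
  moreover have "B UNIV = L" by (simp add: B_def fun_eq_iff)
  ultimately show ?thesis by (metis finite_class.finite_UNIV)
qed

lemma D_module_iso_iff_exp_conjugate:
  fixes A A' :: "'l \<Rightarrow> complex ^ 'n::finite ^ 'n"
  assumes comm: "\<And>p q. A p ** A q = A q ** A p" and comm': "\<And>p q. A' p ** A' q = A' q ** A' p"
  shows "D_module_iso (act_of A) (act_of A') \<longleftrightarrow>
    (\<exists>g h. g ** h = mat 1 \<and> h ** g = mat 1 \<and> (\<forall>j. matrix_exp (A' j) ** g = g ** matrix_exp (A j)))"
proof
  assume "D_module_iso (act_of A) (act_of A')"
  then obtain g h where g: "g ** h = mat 1" "h ** g = mat 1" "\<And>j u. g *v nab A j u = nab A' j (g *v u)"
    unfolding D_module_iso_act_of_iff[OF comm comm'] by blast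
  have "meval g ** meval h = mat 1" "meval h ** meval g = mat 1"
    using g by (simp_all add: meval_mult[symmetric] meval_1)
  moreover have "matrix_exp (A' j) ** meval g = meval g ** matrix_exp (A j)" for j
    using gauge_imp_exp_conjugate[OF g(3)] by simp
  ultimately show "\<exists>g h. g ** h = mat 1 \<and> h ** g = mat 1 \<and> (\<forall>j. matrix_exp (A' j) ** g = g ** matrix_exp (A j))"
    by blast
next
  assume "\<exists>g h. g ** h = mat 1 \<and> h ** g = mat 1 \<and> (\<forall>j. matrix_exp (A' j) ** g = g ** matrix_exp (A j))"
  then obtain g h where gh: "g ** h = mat 1" "h ** g = mat 1"
    and E: "\<And>j. matrix_exp (A' j) ** g = g ** matrix_exp (A j)" by blast
  \<comment> \<open>A constant change of basis is a gauge transformation, and it reduces the claim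
    to two tuples with equal exponentials.\<close>
  define A'' where "A'' j = g ** A j ** h" for j
  have A''g: "A'' j ** g = g ** A j" for j
    unfolding A''_def using gh(2) by (metis matrix_mul_assoc matrix_mul_rid)
  have cancel: "X = Z" if "X ** g = Z ** g" for X Z :: "complex ^ 'n ^ 'n"
    using that gh(1) by (metis matrix_mul_assoc matrix_mul_rid)
  have comm'': "A'' p ** A'' q = A'' q ** A'' p" for p q
    by (rule cancel) (metis A''g comm matrix_mul_assoc)
  have exp'': "matrix_exp (A'' j) = matrix_exp (A' j)" for j
    by (rule cancel) (metis A''g E matrix_exp_intertwine)
  have "D_module_iso (act_of A) (act_of A'')"
    unfolding D_module_iso_act_of_iff[OF comm comm'']
  proof (intro exI conjI allI)
    show "xmat 0 g ** xmat 0 h = (mat 1 :: 'l laurent ^ 'n ^ 'n)" "xmat 0 h ** xmat 0 g = (mat 1 :: 'l laurent ^ 'n ^ 'n)"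
      by (simp_all add: xmat_mult gh xmat_1)
    have "mat 0 + B = B" for B :: "complex ^ 'n ^ 'n" by (simp add: vec_eq_iff mat_def)
    then show "xmat 0 g *v nab A j u = nab A'' j (xmat 0 g *v u)" for j u
      by (intro xmat_intertwines_nab) (simp add: A''g)
  qed
  \<comment> \<open>The logarithms are chosen from exp A' alone, which makes L a common target for
    A'' and A'.\<close>
  moreover have "\<exists>L. matrix_exp L = matrix_exp (A' j) \<and>
      (\<forall>D. D ** matrix_exp (A' j) = matrix_exp (A' j) ** D \<longrightarrow> D ** L = L ** D)" for j
    using matrix_log[OF invertible_matrix_exp[of "A' j"]] by metis
  then obtain L where L: "\<And>j. matrix_exp (L j) = matrix_exp (A' j)"
    "\<And>j D. D ** matrix_exp (A' j) = matrix_exp (A' j) ** D \<Longrightarrow> D ** L j = L j ** D" by metis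
  have "D_module_iso (act_of A'') (act_of L)"
    by (rule D_module_iso_log[OF comm'']) (simp_all add: exp'' L)
  moreover have "D_module_iso (act_of A') (act_of L)"
    by (rule D_module_iso_log[OF comm' L])
  ultimately show "D_module_iso (act_of A) (act_of A')"
    using D_module_iso_trans D_module_iso_sym by metis
qed

end

section \<open>Representations and the exponential map\<close>

context lattice_frame
begin

text \<open>Both fields are diagonal on monomials.\<close>

lemma vf_bracket_Lie_T:
  assumes "u \<in> Lie_T" "v \<in> Lie_T"
  shows "vf_bracket u v = (\<lambda>f. 0)"
proof -
  obtain w w' where uv: "u = log_deriv w" "v = log_deriv w'"
    using assms by (metis Lie_T_eq_log_deriv)
  show ?thesis
    unfolding vf_bracket_def uv
    by (intro ext poly_mapping_eqI) (simp add: lookup_minus lookup_log_deriv)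
qed

lemma Lie_reps_commute:
  assumes \<rho>: "\<rho> \<in> Lie_reps"
  shows "\<rho> (e p) ** \<rho> (e q) = \<rho> (e q) ** \<rho> (e p)"
proof -
  \<comment> \<open>Compatibility with the scalar 0 gives \<rho> = 0 on the zero field, which is the
    bracket of e_p and e_q.\<close>
  have "\<rho> (\<lambda>f. const 0 * e p f) = (\<chi> i k. 0 * \<rho> (e p) $ i $ k)"
    using \<rho> e_Lie_T unfolding Lie_reps_def by blast
  then have "\<rho> (\<lambda>f. 0) = 0" by (simp add: vec_eq_iff)
  moreover have "\<rho> (vf_bracket (e p) (e q)) = \<rho> (e p) ** \<rho> (e q) - \<rho> (e q) ** \<rho> (e p)"
    using \<rho> e_Lie_T unfolding Lie_reps_def by blast
  ultimately show ?thesis by (simp add: vf_bracket_Lie_T e_Lie_T)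
qed

lemma lincomb_Lie_T: "lincomb c e \<in> Lie_T"
  unfolding lincomb_e
  by (rule log_deriv_in_Lie_T) (simp add: weight_add distrib_left sum.distrib)

lemma lincomb_eq_iff: "lincomb c e = lincomb d e \<longleftrightarrow> c = d"
  using Lie_T_coords[OF lincomb_Lie_T[of c]] by metis

text \<open>The linear extension of the A_j is a representation: \<open>Lie_T\<close> is abelian,
  and combinations of commuting matrices commute.\<close>

lemma exists_Lie_rep:
  fixes A :: "'l \<Rightarrow> complex ^ 'n::finite ^ 'n"
  assumes comm: "\<And>p q. A p ** A q = A q ** A p"
  obtains \<rho> where "\<rho> \<in> Lie_reps" "\<And>j. \<rho> (e j) = A j"
proof -
  define lin where "lin c = (\<Sum>j\<in>UNIV. mat (c j) ** A j)" for c :: "'l \<Rightarrow> complex"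
  define coord where "coord v = (THE c. v = lincomb c e)" for v
  define \<rho> where "\<rho> = (\<lambda>v\<in>Lie_T. lin (coord v))"
  have \<rho>: "\<rho> (lincomb c e) = lin c" for c
  proof -
    have "coord (lincomb c e) = c" unfolding coord_def by (rule the_equality) (simp_all add: lincomb_eq_iff)
    then show ?thesis by (simp add: \<rho>_def lincomb_Lie_T)
  qed
  have matA: "mat z ** B = B ** mat z" for z and B :: "complex ^ 'n ^ 'n"
    by (simp add: mat_matrix_mult matrix_mult_mat)
  have lin_comm: "B ** lin d = lin d ** B" if "\<And>j. B ** A j = A j ** B" for B d
    unfolding lin_def sum_matrix_mult_left sum_matrix_mult_right
    by (intro sum.cong refl) (metis matA that matrix_mul_assoc)
  have lin2: "lin c ** lin d = lin d ** lin c" for c d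
    by (rule lin_comm) (rule lin_comm[symmetric], rule comm)
  have "\<rho> \<in> Lie_reps"
    unfolding Lie_reps_def
  proof (intro CollectI conjI ballI allI)
    show "\<rho> \<in> extensional Lie_T" by (simp add: \<rho>_def)
  next
    fix u v :: "'l laurent \<Rightarrow> 'l laurent" assume "u \<in> Lie_T" "v \<in> Lie_T"
    then obtain c d where cd: "u = lincomb c e" "v = lincomb d e" using Lie_T_coords by metis
    have "(\<lambda>f. u f + v f) = lincomb (\<lambda>j. c j + d j) e"
      by (simp add: cd lincomb_def fun_eq_iff const_add distrib_right sum.distrib)
    moreover have "lin (\<lambda>j. c j + d j) = lin c + lin d"
      by (simp add: lin_def mat_matrix_mult vec_eq_iff distrib_right sum.distrib)
    ultimately show "\<rho> (\<lambda>f. u f + v f) = \<rho> u + \<rho> v" by (simp add: \<rho> cd)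
    have "vf_bracket u v = lincomb (\<lambda>_. 0) e"
      using \<open>u \<in> Lie_T\<close> \<open>v \<in> Lie_T\<close> by (simp add: vf_bracket_Lie_T lincomb_def)
    moreover have "lin (\<lambda>_. 0) = 0"
      by (simp add: lin_def mat_matrix_mult vec_eq_iff)
    ultimately show "\<rho> (vf_bracket u v) = \<rho> u ** \<rho> v - \<rho> v ** \<rho> u" by (simp add: \<rho> cd lin2[of c d])
  next
    fix a and v :: "'l laurent \<Rightarrow> 'l laurent" assume "v \<in> Lie_T"
    then obtain c where c: "v = lincomb c e" using Lie_T_coords by metis
    have "(\<lambda>f. const a * v f) = lincomb (\<lambda>j. a * c j) e"
      by (simp add: c lincomb_def fun_eq_iff const_mult sum_distrib_left mult.assoc)
    moreover have "lin (\<lambda>j. a * c j) = (\<chi> i k. a * lin c $ i $ k)"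
      by (simp add: lin_def mat_matrix_mult vec_eq_iff sum_distrib_left mult.assoc)
    ultimately show "\<rho> (\<lambda>f. const a * v f) = (\<chi> i k. a * \<rho> v $ i $ k)" by (simp add: \<rho> c)
  qed
  moreover have "\<rho> (e j) = A j" for j
  proof -
    have "e j = lincomb (\<lambda>i. if i = j then 1 else 0) e"
      by (simp add: lincomb_def fun_eq_iff if_distrib if_distribR cong: if_cong)
    then have "\<rho> (e j) = lin (\<lambda>i. if i = j then 1 else 0)" using \<rho> by metis
    also have "\<dots> = (\<Sum>i\<in>UNIV. if i = j then A j else 0)"
      unfolding lin_def by (intro sum.cong refl) (auto simp: mat_matrix_mult vec_eq_iff)
    finally show ?thesis by simp
  qed
  ultimately show thesis by (rule that)
qed

end

text \<open>The definite description is resolved by \<open>act_of\<close> for existence and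
  \<open>D_module_unique\<close> for uniqueness. For a general field, both sides expand along the
  e_p, on which the contractions of the form are the entries of A_p.\<close>

lemma (in dual_frame) D_module_of_const_form:
  fixes A :: "'l \<Rightarrow> complex ^ 'n::finite ^ 'n"
  assumes comm: "\<And>p q. A p ** A q = A q ** A p"
  shows "D_module_of (const_form e' A) = act_of A"
  unfolding D_module_of_def
proof (rule the_equality)
  have axis: "act_of A v (axis j 1) = (\<Sum>i\<in>UNIV. contract v (const_form e' A $ i $ j) *s axis i 1)"
    if v: "v \<in> Der" for v j
  proof -
    have der: "derivation v" using v by (simp add: Der_def)
    obtain g where g: "\<And>f. v f = (\<Sum>p\<in>UNIV. g p * e p f)" using derivation_eq_e[OF der] by blast
    have "contract v (const_form e' A $ i $ j) = (\<Sum>p\<in>UNIV. g p * const (A p $ i $ j))" for i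
      using contract_combination[OF der e_derivation g] by (simp add: contract_const_form)
    then have "(\<Sum>i\<in>UNIV. contract v (const_form e' A $ i $ j) *s axis i 1) =
        (\<Sum>p\<in>UNIV. g p *s (\<Sum>i\<in>UNIV. const (A p $ i $ j) *s (axis i 1 :: 'l laurent ^ 'n)))"
      by (simp add: vec_eq_iff axis_def if_distrib sum_distrib_left cong: if_cong)
    also have "\<dots> = act_of A v (axis j 1)"
      by (simp only: act_of_deriv[OF comm v g] nab_axis)
    finally show ?thesis by simp
  qed
  show props: "D_module (act_of A) \<and> (\<forall>f u. act_of A ((*) f) u = f *s u) \<and>
      (\<forall>v\<in>Der. \<forall>j. act_of A v (axis j 1) = (\<Sum>i\<in>UNIV. contract v (const_form e' A $ i $ j) *s axis i 1))"
    by (intro conjI allI ballI axis D_module_act_of[where A = A, OF comm] act_of_mult[where A = A, OF comm])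
  fix act :: "('l, 'n) D_mod"
  assume act: "D_module act \<and> (\<forall>f u. act ((*) f) u = f *s u) \<and>
      (\<forall>v\<in>Der. \<forall>j. act v (axis j 1) = (\<Sum>i\<in>UNIV. contract v (const_form e' A $ i $ j) *s axis i 1))"
  show "act = act_of A"
  proof (rule D_module_unique)
    show "act v (axis j 1) = act_of A v (axis j 1)" if "v \<in> Der" for v j
      using act props that by simp
  qed (use act props in blast)+
qed

section \<open>The equivalence relations and the correspondence of classes\<close>

lemma equiv_conj_rel: "equiv commuting_tuples (conj_rel :: (('l \<Rightarrow> complex ^ 'n::finite ^ 'n) \<times> _) set)"
proof (rule equivI)
  have conj_rel: "(A, B) \<in> conj_rel \<longleftrightarrow> A \<in> commuting_tuples \<and> B \<in> commuting_tuples \<and>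
      (\<exists>g h. g ** h = mat 1 \<and> h ** g = mat 1 \<and> (\<forall>j. B j ** g = g ** A j))"
    for A B :: "'l \<Rightarrow> complex ^ 'n ^ 'n"
    by (simp add: conj_rel_def conjugate_iff_intertwined)
  show "(conj_rel :: (('l \<Rightarrow> complex ^ 'n ^ 'n) \<times> _) set) \<subseteq> commuting_tuples \<times> commuting_tuples"
    by (auto simp: conj_rel_def)
  show "refl_on commuting_tuples (conj_rel :: (('l \<Rightarrow> complex ^ 'n ^ 'n) \<times> _) set)"
    by (rule refl_onI) (auto simp: conj_rel intro!: exI[of _ "mat 1"])
  show "sym (conj_rel :: (('l \<Rightarrow> complex ^ 'n ^ 'n) \<times> _) set)"
  proof (rule symI)
    fix A B :: "'l \<Rightarrow> complex ^ 'n ^ 'n" assume "(A, B) \<in> conj_rel"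
    then obtain g h where g: "g ** h = mat 1" "h ** g = mat 1" "\<And>j. B j ** g = g ** A j"
      and AB: "A \<in> commuting_tuples" "B \<in> commuting_tuples" by (auto simp: conj_rel)
    have "A j ** h = h ** B j" for j
    proof -
      have "A j ** h = h ** (g ** A j) ** h" using g(2) by (simp add: matrix_mul_assoc)
      also have "\<dots> = h ** B j ** (g ** h)" by (simp only: g(3)[symmetric] matrix_mul_assoc)
      finally show ?thesis by (simp add: g(1))
    qed
    then show "(B, A) \<in> conj_rel" using g AB by (auto simp: conj_rel)
  qed
  show "trans (conj_rel :: (('l \<Rightarrow> complex ^ 'n ^ 'n) \<times> _) set)"
  proof (rule transI)
    fix A B C :: "'l \<Rightarrow> complex ^ 'n ^ 'n" assume "(A, B) \<in> conj_rel" "(B, C) \<in> conj_rel"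
    then obtain g h g' h' where g: "g ** h = mat 1" "h ** g = mat 1" "\<And>j. B j ** g = g ** A j"
      and g': "g' ** h' = mat 1" "h' ** g' = mat 1" "\<And>j. C j ** g' = g' ** B j"
      and AC: "A \<in> commuting_tuples" "C \<in> commuting_tuples" by (auto simp: conj_rel)
    have "(g' ** g) ** (h ** h') = g' ** (g ** h) ** h'" "(h ** h') ** (g' ** g) = h ** (h' ** g') ** g"
      by (simp_all only: matrix_mul_assoc)
    moreover have "C j ** (g' ** g) = (g' ** g) ** A j" for j
      by (metis g(3) g'(3) matrix_mul_assoc)
    ultimately have "(g' ** g) ** (h ** h') = mat 1 \<and> (h ** h') ** (g' ** g) = mat 1 \<and>
        (\<forall>j. C j ** (g' ** g) = (g' ** g) ** A j)" by (simp add: g(1,2) g'(1,2))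
    then show "(A, C) \<in> conj_rel" using AC unfolding conj_rel by blast
  qed
qed

lemma equiv_D_mod_iso_rel: "equiv invariant_D_modules D_mod_iso_rel"
  by (rule equivI)
    (auto simp: D_mod_iso_rel_def intro!: refl_onI symI transI
      intro: D_module_iso_refl D_module_iso_sym D_module_iso_trans)

theorem theorem0p3:
  fixes e :: "'l \<Rightarrow> ('l::finite) laurent \<Rightarrow> 'l laurent"
    and e' :: "'l \<Rightarrow> 'l kform"
  assumes "lattice_basis e" and "dual_basis e e'"
  shows "Exp e ` (Lie_reps :: (('l laurent \<Rightarrow> 'l laurent) \<Rightarrow> complex ^ 'n::finite ^ 'n) set)
           = commuting_tuples // conj_rel \<and>
         (\<exists>\<Phi>. bij_betw \<Phi> ((commuting_tuples :: ('l \<Rightarrow> complex ^ 'n ^ 'n) set) // conj_rel)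
                ((invariant_D_modules :: ('l, 'n) D_mod set) // D_mod_iso_rel) \<and>
              (\<forall>c \<in> commuting_tuples // conj_rel.
                (\<lambda>\<rho>. D_module_of (rep_form e e' \<rho>)) ` {\<rho> \<in> Lie_reps. Exp e \<rho> = c} = \<Phi> c))"
proof -
  interpret dual_frame e e'
    by unfold_locales (rule assms)+
  let ?R = "Lie_reps :: (('l laurent \<Rightarrow> 'l laurent) \<Rightarrow> complex ^ 'n ^ 'n) set"
  let ?C = "commuting_tuples :: ('l \<Rightarrow> complex ^ 'n ^ 'n) set"
  define ex where "ex \<rho> j = matrix_exp (\<rho> (e j))" for \<rho> :: "_ \<Rightarrow> complex ^ 'n ^ 'n" and j
  define M where "M \<rho> = D_module_of (rep_form e e' \<rho>)" for \<rho> :: "_ \<Rightarrow> complex ^ 'n ^ 'n"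
  have Exp_ex: "Exp e \<rho> = conj_rel `` {ex \<rho>}" for \<rho>
    by (simp add: Exp_def ex_def[abs_def])
  have M_act: "M \<rho> = act_of (\<lambda>j. \<rho> (e j))" if "\<rho> \<in> ?R" for \<rho>
    unfolding M_def rep_form_eq by (rule D_module_of_const_form) (rule Lie_reps_commute[OF that])
  have ex_comm: "ex \<rho> \<in> ?C" if "\<rho> \<in> ?R" for \<rho>
  proof -
    have "ex \<rho> p ** ex \<rho> q = ex \<rho> q ** ex \<rho> p" for p q
      unfolding ex_def
      by (rule matrix_exp_intertwine, rule matrix_exp_intertwine[symmetric]) (rule Lie_reps_commute[OF that])
    then show ?thesis
      by (auto simp: commuting_tuples_def ex_def invertible_matrix_exp)
  qed
  have inv_M: "(invariant_D_modules :: ('l, 'n) D_mod set) = M ` ?R"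
  proof (intro equalityI subsetI)
    fix N assume "N \<in> (invariant_D_modules :: ('l, 'n) D_mod set)"
    then obtain \<alpha> :: "'l kform ^ 'n ^ 'n" where \<alpha>: "N = D_module_of \<alpha>" "flat \<alpha>" "invariant_matrix_form \<alpha>"
      by (auto simp: invariant_D_modules_def)
    obtain A where A: "\<alpha> = const_form e' A" using invariant_matrix_formE[OF \<alpha>(3)] by blast
    have "A p ** A q = A q ** A p" for p q using \<alpha>(2) by (simp add: A flat_const_form_iff)
    then obtain \<rho> where "\<rho> \<in> Lie_reps" "\<And>j. \<rho> (e j) = A j"
      using exists_Lie_rep[of A] by blast
    then show "N \<in> M ` ?R" by (auto simp: M_def rep_form_eq \<alpha>(1) A intro!: image_eqI[of _ _ \<rho>])
  next
    fix N assume "N \<in> M ` ?R"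
    then obtain \<rho> where \<rho>: "\<rho> \<in> ?R" "N = M \<rho>" by blast
    have "flat (rep_form e e' \<rho>)" "invariant_matrix_form (rep_form e e' \<rho>)"
      using Lie_reps_commute[OF \<rho>(1)] by (simp_all add: rep_form_eq flat_const_form_iff invariant_const_form)
    then show "N \<in> invariant_D_modules" by (auto simp: invariant_D_modules_def \<rho>(2) M_def)
  qed
  \<comment> \<open>Both sides are equivalence relations on representations; once they agree,
    \<open>Exp\<close> and M induce the same partition, and the rest is bookkeeping with
    quotients.\<close>
  have iso: "Exp e \<rho> = Exp e \<sigma> \<longleftrightarrow> (M \<rho>, M \<sigma>) \<in> D_mod_iso_rel" if "\<rho> \<in> ?R" "\<sigma> \<in> ?R" for \<rho> \<sigma>
  proof -
    have "Exp e \<rho> = Exp e \<sigma> \<longleftrightarrow> (ex \<rho>, ex \<sigma>) \<in> conj_rel"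
      unfolding Exp_ex by (rule eq_equiv_class_iff[OF equiv_conj_rel]) (simp_all add: ex_comm that)
    also have "\<dots> \<longleftrightarrow> (\<exists>g h. g ** h = mat 1 \<and> h ** g = mat 1 \<and>
        (\<forall>j. matrix_exp (\<sigma> (e j)) ** g = g ** matrix_exp (\<rho> (e j))))"
      using that by (simp add: conj_rel_def conjugate_iff_intertwined ex_comm) (simp add: ex_def)
    also have "\<dots> \<longleftrightarrow> D_module_iso (M \<rho>) (M \<sigma>)"
      unfolding M_act[OF that(1)] M_act[OF that(2)]
      by (rule D_module_iso_iff_exp_conjugate[symmetric]) (rule Lie_reps_commute, rule that)+
    also have "\<dots> \<longleftrightarrow> (M \<rho>, M \<sigma>) \<in> D_mod_iso_rel"
      using that by (simp add: D_mod_iso_rel_def inv_M)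
    finally show ?thesis .
  qed
  have surj: "Exp e ` ?R = ?C // conj_rel"
  proof (intro equalityI subsetI)
    fix c assume "c \<in> Exp e ` ?R"
    then show "c \<in> ?C // conj_rel" by (auto simp: Exp_ex ex_comm intro!: quotientI)
  next
    fix c assume "c \<in> ?C // conj_rel"
    then obtain B where B: "B \<in> ?C" "c = conj_rel `` {B}" by (auto elim: quotientE)
    have "\<exists>L. matrix_exp L = B j \<and> (\<forall>D. D ** B j = B j ** D \<longrightarrow> D ** L = L ** D)" for j
    proof -
      have "invertible (B j)" using B(1) by (simp add: commuting_tuples_def)
      then show ?thesis using matrix_log[of "B j"] by metis
    qed
    then obtain L where L: "\<And>j. matrix_exp (L j) = B j"
      "\<And>j D. D ** B j = B j ** D \<Longrightarrow> D ** L j = L j ** D" by metis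
    \<comment> \<open>The bicommutant property is used twice: B q commutes with B p, hence with L p;
      therefore L p commutes with B q, hence with L q.\<close>
    have "L p ** L q = L q ** L p" for p q
    proof (rule L(2), rule L(2)[symmetric])
      show "B q ** B p = B p ** B q" using B(1) by (simp add: commuting_tuples_def)
    qed
    then obtain \<rho> where \<rho>: "\<rho> \<in> Lie_reps" "\<And>j. \<rho> (e j) = L j"
      using exists_Lie_rep[of L] by blast
    have "Exp e \<rho> = c" by (simp add: Exp_def \<rho>(2) L(1) B(2))
    with \<rho>(1) show "c \<in> Exp e ` ?R" by blast
  qed
  \<comment> \<open>The bijection is the fibre itself, so the description of the fibres of
    \<open>Exp\<close> holds by definition; what remains is that fibres are full isomorphism
    classes.\<close>
  define \<Phi> where "\<Phi> c = M ` {\<rho> \<in> ?R. Exp e \<rho> = c}" for c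
  have \<Phi>_class: "\<Phi> (Exp e \<rho>) = D_mod_iso_rel `` {M \<rho>}" if \<rho>: "\<rho> \<in> ?R" for \<rho>
  proof (intro equalityI subsetI)
    fix N assume "N \<in> \<Phi> (Exp e \<rho>)"
    then obtain \<sigma> where "\<sigma> \<in> ?R" "Exp e \<sigma> = Exp e \<rho>" "N = M \<sigma>" by (auto simp: \<Phi>_def)
    then show "N \<in> D_mod_iso_rel `` {M \<rho>}" using iso[OF \<rho>, of \<sigma>] by simp
  next
    fix N assume N: "N \<in> D_mod_iso_rel `` {M \<rho>}"
    then have "N \<in> M ` ?R" by (auto simp: D_mod_iso_rel_def inv_M)
    then obtain \<sigma> where "\<sigma> \<in> ?R" "N = M \<sigma>" by blast
    then show "N \<in> \<Phi> (Exp e \<rho>)" using iso[OF \<rho>, of \<sigma>] N by (auto simp: \<Phi>_def)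
  qed
  have "bij_betw \<Phi> (?C // conj_rel) (invariant_D_modules // D_mod_iso_rel)"
    unfolding surj[symmetric]
  proof (rule bij_betwI')
    fix c d assume "c \<in> Exp e ` ?R" "d \<in> Exp e ` ?R"
    then obtain \<rho> \<sigma> where \<rho>\<sigma>: "\<rho> \<in> ?R" "\<sigma> \<in> ?R" "c = Exp e \<rho>" "d = Exp e \<sigma>" by blast
    then have "M \<rho> \<in> invariant_D_modules" "M \<sigma> \<in> invariant_D_modules" by (simp_all add: inv_M)
    then show "\<Phi> c = \<Phi> d \<longleftrightarrow> c = d"
      using \<rho>\<sigma> by (simp add: \<Phi>_class iso eq_equiv_class_iff[OF equiv_D_mod_iso_rel])
  next
    fix c assume "c \<in> Exp e ` ?R"
    then obtain \<rho> where \<rho>: "\<rho> \<in> ?R" "c = Exp e \<rho>" by blast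
    then have "M \<rho> \<in> invariant_D_modules" by (simp add: inv_M)
    then show "\<Phi> c \<in> invariant_D_modules // D_mod_iso_rel"
      using \<rho> by (simp add: \<Phi>_class quotientI)
  next
    fix X assume "X \<in> (invariant_D_modules :: ('l, 'n) D_mod set) // D_mod_iso_rel"
    then obtain N where "N \<in> invariant_D_modules" "X = D_mod_iso_rel `` {N}" by (rule quotientE)
    then obtain \<rho> where "\<rho> \<in> ?R" "X = D_mod_iso_rel `` {M \<rho>}" unfolding inv_M by blast
    then show "\<exists>c \<in> Exp e ` ?R. X = \<Phi> c" using \<Phi>_class by blast
  qed
  with surj show ?thesis
    by (intro conjI exI[of _ \<Phi>]) (simp_all add: \<Phi>_def M_def)
qed

end
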